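(* Let $\mathcal P$ be a finite poset, and let $\mathcal F=\{(\mathcal X_i,\mathrm E_i)\}_i$ be a family of $\mathcal P$-order embeddings, with each $\mathcal X_i$ connected, such that for each $i$ there is no chain of length $\ge 3$ in $\mathcal X_i$ (i.e. no three elements $x<y<z$). Denote $\mathrm E=\bigsqcup_i\mathrm E_i$. Then the set (of isomorphism classes) $$\mathcal R_{\mathrm E}:=\{\mathbb I_{\overline{\mathrm{Im} f}}\mid f\in\mathrm E\},$$ consisting of the modules $\mathbb I_{\overline{\mathrm{Im} f}}\cong\Theta_f(\mathbb I_{\mathcal X_i})$ for $f\in\mathrm E_i$, obtained via the intermediate extension functor from the modules $\mathbb I_{\mathcal X_i}$, is a basis of the invariant $\mathbf{mult}_{\mathcal F}$.
   Context: Fix a field $k$. For a finite poset $\mathcal P$, $\mathrm{mod}\,\mathcal P$ is the category of functors from $\mathcal P$ to finite-dimensional $k$-vector spaces. $\mathrm K_0^{\mathrm{sp}}(\mathcal P)$ is the split Grothendieck group (isoclasses $[M]$ modulo $[M\oplus N]=[M]+[N]$). An invariant is a $\mathbb Z$-linear map $\Psi:\mathrm K_0^{\mathrm{sp}}(\mathcal P)\to\mathbb Z^N$; it is finite if its image is finitely generated. A basis of a finite invariant $\Psi$ is a set $\mathcal B$ of (pairwise non-isomorphic) indecomposable $\mathcal P$-modules such that $\Psi$ restricts to an isomorphism of abelian groups from the free subgroup $\langle[U]\mid U\in\mathcal B\rangle$ of $\mathrm K_0^{\mathrm{sp}}(\mathcal P)$ onto $\mathrm{Im}\,\Psi$. A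 subset $S\subseteq\mathcal P$ is an interval if it is order convex and connected (any two elements of $S$ are joined by a zigzag of comparable elements of $S$). The interval module $\mathbb I_S$ is $k$ at each $x\in S$ and $0$ elsewhere, with identity maps between elements $x\le y$ of $S$ and zero maps otherwise; for $\mathcal P$ connected, $\mathbb I_{\mathcal P}$ is the interval module with $S=\mathcal P$. The convex hull of $S\subseteq\mathcal P$ is $\overline S=\{x\in\mathcal P\mid \exists\, y,z\in S,\ y\le x\le z\}$. An order-embedding $f:\mathcal X\to\mathcal P$ is a map with $x\le x'\iff f(x)\le f(x')$; $\mathrm{Emb}_{\mathcal X}^{\mathcal P}$ is the set of order-embeddings up to precomposition with automorphisms of $\mathcal X$ (fix one representative for each class). $f^*$ is restriction along $f$, with left adjoint $f_!$ and right adjoint $f_*$, satisfying $f^*f_!=\mathrm{Id}=f^*f_*$. The intermediate extension functor $\Theta_f$ sends $U\in\mathrm{mod}\,\mathcal X$ to the image of the map $\theta_fU:f_!U\to f_*U$ corresponding to $1_U$ under $\mathrm{Hom}_{\mathcal P}(f_!U,f_*U)\cong\mathrm{End}_{\mathcal X}(U)$. A family of $\mathcal P$-order embeddings is a finite set $\mathcal F=\{(\mathcal X_i,\mathrm E_i)\}_i$ with each $\mathcal X_i$ a finite poset (not necessarily representation-finite) and $\mathrm E_i\subseteq\mathrm{Emb}_{\mathcal X_i}^{\mathcal P}$. With $\mathrm E=\bigsqcup_i\mathrm E_i$, the invariant $\mathbf{mult}_{\mathcal F}:\mathrm K_0^{\mathrm{sp}}(\mathcal P)\to\mathbb Z^{\mathrm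 E}$ is given by $(\mathbf{mult}_{\mathcal F}(M))_f=$ multiplicity of $\mathbb I_{\mathcal X_i}$ as a direct summand of $f^*M$, for $f\in\mathrm E_i$. *)

theory Defs
  imports
    Complex_Main
    "HOL-Library.Function_Algebras"
    "HOL-Algebra.Free_Abelian_Groups"
begin

text \<open>A poset is a relation \<open>P\<close> with \<^term>\<open>Partial_order P\<close>; its underlying set is
  \<^term>\<open>Field P\<close> (relations are reflexive there), and \<open>(x, y) \<in> P\<close> means \<open>x \<le> y\<close>.\<close>

definition finite_poset :: "'p rel \<Rightarrow> bool" where
  "finite_poset P \<longleftrightarrow> Partial_order P \<and> finite (Field P)"

text \<open>The empty poset does not count as connected.\<close>

definition connected_poset :: "'p rel \<Rightarrow> bool" where
  "connected_poset P \<longleftrightarrow> Field P \<noteq> {} \<and> (\<forall>x\<in>Field P. \<forall>y\<in>Field P. (x, y) \<in> (P \<union> P\<inverse>)\<^sup>*)"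

definition no_three_chain :: "'p rel \<Rightarrow> bool" where
  "no_three_chain P \<longleftrightarrow> \<not> (\<exists>x y z. (x, y) \<in> P \<and> x \<noteq> y \<and> (y, z) \<in> P \<and> y \<noteq> z)"

definition convex_hull_in :: "'p rel \<Rightarrow> 'p set \<Rightarrow> 'p set" where
  "convex_hull_in P S = {x \<in> Field P. \<exists>y\<in>S. \<exists>z\<in>S. (y, x) \<in> P \<and> (x, z) \<in> P}"


section \<open>Order-embeddings up to automorphisms\<close>

text \<open>Maps are extensional on \<^term>\<open>Field X\<close>, so that equal maps are equal functions.\<close>

definition order_embeddings :: "'x rel \<Rightarrow> 'p rel \<Rightarrow> ('x \<Rightarrow> 'p) set" where
  "order_embeddings X P =
     {f \<in> Field X \<rightarrow>\<^sub>E Field P. \<forall>x\<in>Field X. \<forall>y\<in>Field X. (x, y) \<in> X \<longleftrightarrow> (f x, f y) \<in> P}"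

definition order_automorphism :: "'x rel \<Rightarrow> ('x \<Rightarrow> 'x) \<Rightarrow> bool" where
  "order_automorphism X \<sigma> \<longleftrightarrow> bij_betw \<sigma> (Field X) (Field X) \<and>
     (\<forall>x\<in>Field X. \<forall>y\<in>Field X. (x, y) \<in> X \<longleftrightarrow> (\<sigma> x, \<sigma> y) \<in> X)"

definition emb_equiv :: "'x rel \<Rightarrow> 'p rel \<Rightarrow> ('x \<Rightarrow> 'p) rel" where
  "emb_equiv X P = {(f, g). f \<in> order_embeddings X P \<and> g \<in> order_embeddings X P \<and>
     (\<exists>\<sigma>. order_automorphism X \<sigma> \<and> (\<forall>x\<in>Field X. g x = f (\<sigma> x)))}"

definition Emb :: "'x rel \<Rightarrow> 'p rel \<Rightarrow> ('x \<Rightarrow> 'p) set set" where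
  "Emb X P = order_embeddings X P // emb_equiv X P"

definition emb_rep :: "('x \<Rightarrow> 'p) set \<Rightarrow> ('x \<Rightarrow> 'p)" where
  "emb_rep c = (SOME f. f \<in> c)"

text \<open>The posets \<open>X\<^sub>i\<close> of a family live in one type \<open>'x\<close>, which is arbitrary in what follows; the
  pairs \<open>(X\<^sub>i, E\<^sub>i)\<close> themselves serve as the indices \<open>i\<close>.\<close>

type_synonym ('x, 'p) emb_family = "('x rel \<times> ('x \<Rightarrow> 'p) set set) set"
type_synonym ('x, 'p) emb_index = "('x rel \<times> ('x \<Rightarrow> 'p) set set) \<times> ('x \<Rightarrow> 'p) set"

definition is_emb_family :: "'p rel \<Rightarrow> ('x, 'p) emb_family \<Rightarrow> bool" where
  "is_emb_family P \<F> \<longleftrightarrow> finite \<F> \<and> (\<forall>(X, E)\<in>\<F>. finite_poset X \<and> E \<subseteq> Emb X P)"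

definition emb_union :: "('x, 'p) emb_family \<Rightarrow> ('x, 'p) emb_index set" where
  "emb_union \<F> = Sigma \<F> snd"

definition index_poset :: "('x, 'p) emb_index \<Rightarrow> 'x rel" where
  "index_poset e = fst (fst e)"

definition index_emb :: "('x, 'p) emb_index \<Rightarrow> 'x \<Rightarrow> 'p" where
  "index_emb e = emb_rep (snd e)"


section \<open>Modules over a poset\<close>

text \<open>Vector spaces over the field \<open>'k\<close> are subspaces of spaces of functions \<open>'i \<Rightarrow> 'k\<close>, where the
  type \<open>'i\<close> may vary from module to module. Every finite-dimensional space is isomorphic to one with
  \<open>'i = nat\<close>, so \<open>'i = nat\<close> is used wherever all modules have to be collected.\<close>

definition fscale :: "'k::field \<Rightarrow> ('i \<Rightarrow> 'k) \<Rightarrow> ('i \<Rightarrow> 'k)" where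
  "fscale c v = (\<lambda>i. c * v i)"

interpretation fs: vector_space fscale
  by unfold_locales (auto simp: fscale_def fun_eq_iff algebra_simps)

definition lin_on :: "('i \<Rightarrow> 'k::field) set \<Rightarrow> ('j \<Rightarrow> 'k) set \<Rightarrow> (('i \<Rightarrow> 'k) \<Rightarrow> ('j \<Rightarrow> 'k)) \<Rightarrow> bool" where
  "lin_on V W \<phi> \<longleftrightarrow> \<phi> \<in> V \<rightarrow> W \<and>
     (\<forall>u\<in>V. \<forall>v\<in>V. \<phi> (u + v) = \<phi> u + \<phi> v) \<and> (\<forall>c. \<forall>v\<in>V. \<phi> (fscale c v) = fscale c (\<phi> v))"

text \<open>\<open>sp M x\<close> is the space at \<open>x\<close> and \<open>tr M x y\<close> the map for \<open>x \<le> y\<close>; only the values for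
  \<^prop>\<open>x \<in> Field P\<close>, \<^prop>\<open>(x, y) \<in> P\<close> and arguments in \<open>sp M x\<close> are meaningful.\<close>

record ('p, 'i, 'k) rep =
  sp :: "'p \<Rightarrow> ('i \<Rightarrow> 'k) set"
  tr :: "'p \<Rightarrow> 'p \<Rightarrow> ('i \<Rightarrow> 'k) \<Rightarrow> ('i \<Rightarrow> 'k)"

definition is_module :: "'p rel \<Rightarrow> ('p, 'i, 'k::field) rep \<Rightarrow> bool" where
  "is_module P M \<longleftrightarrow>
     (\<forall>x\<in>Field P. fs.subspace (sp M x) \<and> (\<exists>B. finite B \<and> fs.span B = sp M x)) \<and>
     (\<forall>(x, y)\<in>P. lin_on (sp M x) (sp M y) (tr M x y)) \<and>
     (\<forall>x\<in>Field P. \<forall>v\<in>sp M x. tr M x x v = v) \<and>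
     (\<forall>x y z. (x, y) \<in> P \<longrightarrow> (y, z) \<in> P \<longrightarrow> (\<forall>v\<in>sp M x. tr M y z (tr M x y v) = tr M x z v))"

definition Hom :: "'p rel \<Rightarrow> ('p, 'i, 'k::field) rep \<Rightarrow> ('p, 'j, 'k) rep \<Rightarrow>
    ('p \<Rightarrow> ('i \<Rightarrow> 'k) \<Rightarrow> ('j \<Rightarrow> 'k)) set" where
  "Hom P M N = {\<phi> \<in> (\<Pi>\<^sub>E x\<in>Field P. sp M x \<rightarrow>\<^sub>E sp N x).
     (\<forall>x\<in>Field P. lin_on (sp M x) (sp N x) (\<phi> x)) \<and>
     (\<forall>(x, y)\<in>P. \<forall>v\<in>sp M x. \<phi> y (tr M x y v) = tr N x y (\<phi> x v))}"

definition isomorphic :: "'p rel \<Rightarrow> ('p, 'i, 'k::field) rep \<Rightarrow> ('p, 'j, 'k) rep \<Rightarrow> bool" where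
  "isomorphic P M N \<longleftrightarrow> (\<exists>\<phi>\<in>Hom P M N. \<forall>x\<in>Field P. bij_betw (\<phi> x) (sp M x) (sp N x))"

definition direct_sum :: "('p, 'i, 'k::field) rep \<Rightarrow> ('p, 'j, 'k) rep \<Rightarrow> ('p, 'i + 'j, 'k) rep" where
  "direct_sum M N =
     \<lparr>sp = (\<lambda>x. {case_sum u v |u v. u \<in> sp M x \<and> v \<in> sp N x}),
      tr = (\<lambda>x y w. case_sum (tr M x y (w \<circ> Inl)) (tr N x y (w \<circ> Inr)))\<rparr>"

text \<open>The direct sum of \<open>n\<close> copies of \<open>M\<close>.\<close>

definition direct_power :: "nat \<Rightarrow> ('p, 'i, 'k::field) rep \<Rightarrow> ('p, nat \<times> 'i, 'k) rep" where
  "direct_power n M =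
     \<lparr>sp = (\<lambda>x. {w. \<forall>m. if m < n then (\<lambda>i. w (m, i)) \<in> sp M x else (\<lambda>i. w (m, i)) = 0}),
      tr = (\<lambda>x y w (m, i). if m < n then tr M x y (\<lambda>j. w (m, j)) i else 0)\<rparr>"

definition zero_module :: "'p rel \<Rightarrow> ('p, 'i, 'k::field) rep \<Rightarrow> bool" where
  "zero_module P M \<longleftrightarrow> (\<forall>x\<in>Field P. sp M x = {0})"

definition indecomposable :: "'p rel \<Rightarrow> ('p, 'i, 'k::field) rep \<Rightarrow> bool" where
  "indecomposable P M \<longleftrightarrow> \<not> zero_module P M \<and>
     (\<forall>(A :: ('p, nat, 'k) rep) (B :: ('p, nat, 'k) rep).
        is_module P A \<and> is_module P B \<and> isomorphic P M (direct_sum A B) \<longrightarrow>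
        zero_module P A \<or> zero_module P B)"

text \<open>This is a module over \<open>P\<close> only if \<open>S\<close> is convex.\<close>

definition interval_module :: "'p set \<Rightarrow> ('p, unit, 'k::field) rep" where
  "interval_module S =
     \<lparr>sp = (\<lambda>x. if x \<in> S then UNIV else {0}),
      tr = (\<lambda>x y v. if x \<in> S \<and> y \<in> S then v else 0)\<rparr>"

definition multiplicity_in :: "'p rel \<Rightarrow> ('p, 'i, 'k::field) rep \<Rightarrow> ('p, 'j, 'k) rep \<Rightarrow> nat" where
  "multiplicity_in P U M = (GREATEST n. \<exists>N :: ('p, nat, 'k) rep.
     is_module P N \<and> isomorphic P M (direct_sum (direct_power n U) N))"


section \<open>Restriction and intermediate extension\<close>

definition restriction :: "('x \<Rightarrow> 'p) \<Rightarrow> ('p, 'i, 'k::field) rep \<Rightarrow> ('x, 'i, 'k) rep" where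
  "restriction f M = \<lparr>sp = (\<lambda>x. sp M (f x)), tr = (\<lambda>x y. tr M (f x) (f y))\<rparr>"

text \<open>The values at \<open>U\<close> of the left and right adjoints of restriction, together with the unit
  \<open>U \<rightarrow> f\<^sup>* f\<^sub>! U\<close> and the counit \<open>f\<^sup>* f\<^sub>* U \<rightarrow> U\<close>, by their universal properties.\<close>

definition is_left_extension :: "'x rel \<Rightarrow> 'p rel \<Rightarrow> ('x \<Rightarrow> 'p) \<Rightarrow> ('x, 'i, 'k::field) rep \<Rightarrow>
    ('p, nat, 'k) rep \<Rightarrow> ('x \<Rightarrow> ('i \<Rightarrow> 'k) \<Rightarrow> (nat \<Rightarrow> 'k)) \<Rightarrow> bool" where
  "is_left_extension X P f U L \<eta> \<longleftrightarrow> is_module P L \<and> \<eta> \<in> Hom X U (restriction f L) \<and>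
     (\<forall>N :: ('p, nat, 'k) rep. is_module P N \<longrightarrow> (\<forall>g\<in>Hom X U (restriction f N).
        \<exists>!h. h \<in> Hom P L N \<and> (\<forall>x\<in>Field X. \<forall>u\<in>sp U x. h (f x) (\<eta> x u) = g x u)))"

definition is_right_extension :: "'x rel \<Rightarrow> 'p rel \<Rightarrow> ('x \<Rightarrow> 'p) \<Rightarrow> ('x, 'i, 'k::field) rep \<Rightarrow>
    ('p, nat, 'k) rep \<Rightarrow> ('x \<Rightarrow> (nat \<Rightarrow> 'k) \<Rightarrow> ('i \<Rightarrow> 'k)) \<Rightarrow> bool" where
  "is_right_extension X P f U R \<epsilon> \<longleftrightarrow> is_module P R \<and> \<epsilon> \<in> Hom X (restriction f R) U \<and>
     (\<forall>N :: ('p, nat, 'k) rep. is_module P N \<longrightarrow> (\<forall>g\<in>Hom X (restriction f N) U.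
        \<exists>!h. h \<in> Hom P N R \<and> (\<forall>x\<in>Field X. \<forall>v\<in>sp N (f x). \<epsilon> x (h (f x) v) = g x v)))"

definition left_extension :: "'x rel \<Rightarrow> 'p rel \<Rightarrow> ('x \<Rightarrow> 'p) \<Rightarrow> ('x, 'i, 'k::field) rep \<Rightarrow>
    ('p, nat, 'k) rep \<times> ('x \<Rightarrow> ('i \<Rightarrow> 'k) \<Rightarrow> (nat \<Rightarrow> 'k))" where
  "left_extension X P f U = (SOME (L, \<eta>). is_left_extension X P f U L \<eta>)"

definition right_extension :: "'x rel \<Rightarrow> 'p rel \<Rightarrow> ('x \<Rightarrow> 'p) \<Rightarrow> ('x, 'i, 'k::field) rep \<Rightarrow>
    ('p, nat, 'k) rep \<times> ('x \<Rightarrow> (nat \<Rightarrow> 'k) \<Rightarrow> ('i \<Rightarrow> 'k))" where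
  "right_extension X P f U = (SOME (R, \<epsilon>). is_right_extension X P f U R \<epsilon>)"

text \<open>A morphism \<open>\<theta>\<close> from \<open>f\<^sub>! U\<close> to \<open>f\<^sub>* U\<close> corresponds under the adjunctions to the endomorphism
  \<open>\<epsilon> \<circ> f\<^sup>* \<theta> \<circ> \<eta>\<close> of \<open>U\<close>.\<close>

definition theta_map :: "'x rel \<Rightarrow> 'p rel \<Rightarrow> ('x \<Rightarrow> 'p) \<Rightarrow> ('x, 'i, 'k::field) rep \<Rightarrow>
    'p \<Rightarrow> (nat \<Rightarrow> 'k) \<Rightarrow> (nat \<Rightarrow> 'k)" where
  "theta_map X P f U = (case left_extension X P f U of (L, \<eta>) \<Rightarrow>
     case right_extension X P f U of (R, \<epsilon>) \<Rightarrow>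
       (THE \<theta>. \<theta> \<in> Hom P L R \<and> (\<forall>x\<in>Field X. \<forall>u\<in>sp U x. \<epsilon> x (\<theta> (f x) (\<eta> x u)) = u)))"

definition image_module :: "('p \<Rightarrow> ('i \<Rightarrow> 'k) \<Rightarrow> ('j \<Rightarrow> 'k)) \<Rightarrow> ('p, 'i, 'k::field) rep \<Rightarrow>
    ('p, 'j, 'k) rep \<Rightarrow> ('p, 'j, 'k) rep" where
  "image_module \<phi> M N = \<lparr>sp = (\<lambda>x. \<phi> x ` sp M x), tr = tr N\<rparr>"

definition intermediate_extension :: "'x rel \<Rightarrow> 'p rel \<Rightarrow> ('x \<Rightarrow> 'p) \<Rightarrow> ('x, 'i, 'k::field) rep \<Rightarrow>
    ('p, nat, 'k) rep" where
  "intermediate_extension X P f U = image_module (theta_map X P f U)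
     (fst (left_extension X P f U)) (fst (right_extension X P f U))"


section \<open>The split Grothendieck group, invariants and bases\<close>

type_synonym ('p, 'k) isoclass = "('p, nat, 'k) rep set"
type_synonym ('p, 'k) K0_elem = "(('p, 'k) isoclass \<Rightarrow>\<^sub>0 int) set"

definition isoclass :: "'p rel \<Rightarrow> ('p, 'i, 'k::field) rep \<Rightarrow> ('p, 'k) isoclass" where
  "isoclass P M = {N :: ('p, nat, 'k) rep. is_module P N \<and> isomorphic P N M}"

definition isoclasses :: "'p rel \<Rightarrow> ('p, 'k::field) isoclass set" where
  "isoclasses P = {isoclass P M |M :: ('p, nat, 'k) rep. is_module P M}"

definition K0_relations :: "'p rel \<Rightarrow> (('p, 'k::field) isoclass \<Rightarrow>\<^sub>0 int) set" where
  "K0_relations P = generate (free_Abelian_group (isoclasses P))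
     {frag_of (isoclass P (direct_sum M N)) - (frag_of (isoclass P M) + frag_of (isoclass P N))
      |(M :: ('p, nat, 'k) rep) (N :: ('p, nat, 'k) rep). is_module P M \<and> is_module P N}"

definition K0 :: "'p rel \<Rightarrow> ('p, 'k::field) K0_elem monoid" where
  "K0 P = free_Abelian_group (isoclasses P) Mod K0_relations P"

definition K0_proj :: "'p rel \<Rightarrow> (('p, 'k::field) isoclass \<Rightarrow>\<^sub>0 int) \<Rightarrow> ('p, 'k) K0_elem" where
  "K0_proj P a = K0_relations P #>\<^bsub>free_Abelian_group (isoclasses P)\<^esub> a"

definition int_power_group :: "'e set \<Rightarrow> ('e \<Rightarrow> int) monoid" where
  "int_power_group E = product_group E (\<lambda>_. integer_group)"

definition is_invariant :: "'p rel \<Rightarrow> 'e set \<Rightarrow> (('p, 'k::field) K0_elem \<Rightarrow> ('e \<Rightarrow> int)) \<Rightarrow> bool" where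
  "is_invariant P E \<Psi> \<longleftrightarrow> \<Psi> \<in> hom (K0 P) (int_power_group E)"

definition is_finite_invariant ::
    "'p rel \<Rightarrow> 'e set \<Rightarrow> (('p, 'k::field) K0_elem \<Rightarrow> ('e \<Rightarrow> int)) \<Rightarrow> bool" where
  "is_finite_invariant P E \<Psi> \<longleftrightarrow> is_invariant P E \<Psi> \<and>
     (\<exists>S. finite S \<and> S \<subseteq> carrier (int_power_group E) \<and>
        \<Psi> ` carrier (K0 P) = generate (int_power_group E) S)"

text \<open>The elements of a basis are isomorphism classes, hence pairwise non-isomorphic. The injectivity
  condition says that the classes \<open>[U]\<close> freely generate their span.\<close>

definition is_basis :: "'p rel \<Rightarrow> 'e set \<Rightarrow> (('p, 'k::field) K0_elem \<Rightarrow> ('e \<Rightarrow> int)) \<Rightarrow>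
    ('p, 'k) isoclass set \<Rightarrow> bool" where
  "is_basis P E \<Psi> \<B> \<longleftrightarrow> is_finite_invariant P E \<Psi> \<and>
     \<B> \<subseteq> {isoclass P U |U :: ('p, nat, 'k) rep. is_module P U \<and> indecomposable P U} \<and>
     inj_on (K0_proj P) (carrier (free_Abelian_group \<B>)) \<and>
     \<Psi> \<in> iso (subgroup_generated (K0 P) ((\<lambda>U. K0_proj P (frag_of U)) ` \<B>))
              ((int_power_group E)\<lparr>carrier := \<Psi> ` carrier (K0 P)\<rparr>)"

text \<open>The map on \<open>K0 P\<close> induced by a function on modules, obtained by applying its linear extension
  to the members of a coset; \<^const>\<open>the_elem\<close> picks the common value on an isomorphism class, and
  on a coset. It is meaningful for isomorphism-invariant functions that are additive on direct sums.\<close>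

definition K0_induced :: "'e set \<Rightarrow> ('e \<Rightarrow> ('p, nat, 'k::field) rep \<Rightarrow> int) \<Rightarrow>
    ('p, 'k) K0_elem \<Rightarrow> ('e \<Rightarrow> int)" where
  "K0_induced E v C = the_elem
     ((\<lambda>a. \<lambda>e\<in>E. \<Sum>c\<in>Poly_Mapping.keys a. Poly_Mapping.lookup a c * the_elem (v e ` c)) ` C)"

definition mult_invariant :: "('x, 'p) emb_family \<Rightarrow>
    ('p, 'k::field) K0_elem \<Rightarrow> (('x, 'p) emb_index \<Rightarrow> int)" where
  "mult_invariant \<F> = K0_induced (emb_union \<F>) (\<lambda>e M. int (multiplicity_in (index_poset e)
     (interval_module (Field (index_poset e)) :: ('x, unit, 'k) rep) (restriction (index_emb e) M)))"

definition R_set :: "'p rel \<Rightarrow> ('x, 'p) emb_family \<Rightarrow> ('p, 'k::field) isoclass set" where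
  "R_set P \<F> = (\<lambda>e. isoclass P (interval_module (convex_hull_in P
     (index_emb e ` Field (index_poset e))) :: ('p, unit, 'k) rep)) ` emb_union \<F>"

end

theory Submission
  imports Defs
begin

text \<open>
  Let \<open>X\<close> be a connected finite poset and \<open>N\<close> an \<open>X\<close>-module. A sum of \<open>n\<close> copies of the constant module
  \<open>I\<^sub>X\<close> splits off from \<open>N\<close> exactly when there are \<open>n\<close> sections \<open>s\<^sub>i\<close> of \<open>N\<close> (elements of the limit) and
  cosections \<open>l\<^sub>j\<close> (functionals on the colimit) with \<open>l\<^sub>j(s\<^sub>i) = \<delta>\<^sub>i\<^sub>j\<close>: the sections define
  \<open>I\<^sub>X\<^sup>n \<rightarrow> N\<close>, the cosections a retraction. So the multiplicity of \<open>I\<^sub>X\<close> is the rank of the pairing between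
  sections and cosections (\<open>multiplicity_interval_eq_generalized_rank\<close>). This rank is additive on direct
  sums (\<open>generalized_rank_direct_sum\<close>), which makes the multiplicities well defined on the split
  Grothendieck group. The multiplicity in \<open>f\<^sup>* M\<close> is the rank of \<open>M\<close> over the subset \<open>Im f\<close> of \<open>P\<close>, so it depends on \<open>f\<close> only through \<open>Im f\<close>.

  On an interval module \<open>I\<^sub>S\<close> the value at \<open>f\<close> is \<open>1\<close> if \<open>Im f \<subseteq> S\<close> and \<open>0\<close> otherwise. For the convex
  hull \<open>S\<close> of \<open>Im g\<close> this means that the hull of \<open>Im f\<close> is contained in the hull of \<open>Im g\<close>. Indexed by the
  hulls, the values of the invariant on \<open>R_set\<close> therefore form the incidence matrix of inclusion,
  which is unitriangular and so invertible over the integers. The absence of three-element chains in \<open>X\<close>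
  enters through \<open>image_determined_by_convex_hull\<close>: the image of \<open>f\<close> consists of the minimal and maximal
  points of its hull, so embeddings with equal hulls give equal coordinates of the invariant. Hence
  the classes of \<open>R_set\<close> are independent and their values span the whole image
  (\<open>is_basis_unitriangular\<close>).

  For the intermediate extension, the canonical map \<open>f\<^sub>! I\<^sub>X \<rightarrow> f\<^sub>* I\<^sub>X\<close> factors as a surjection onto the
  interval module of the hull followed by an injection (\<open>isomorphic_image_theta\<close>). Both factors come
  from the universal properties of the two adjoints, whose values on \<open>I\<^sub>X\<close> are constructed explicitly
  (\<open>left_extension_exists\<close>, \<open>right_extension_exists\<close>).
\<close>

section \<open>Linear maps between spaces of functions\<close>

lemma sum_fun_apply: "(\<Sum>i\<in>A. f i) x = (\<Sum>i\<in>A. f i x)"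
  for f :: "'a \<Rightarrow> 'b \<Rightarrow> 'c::comm_monoid_add"
  by (induction A rule: infinite_finite_induct) auto

lemma fscale_apply [simp]: "fscale c v i = c * v i"
  by (simp add: fscale_def)

lemma lin_onI:
  assumes "\<And>v. v \<in> V \<Longrightarrow> \<phi> v \<in> W"
    and "\<And>u v. u \<in> V \<Longrightarrow> v \<in> V \<Longrightarrow> \<phi> (u + v) = \<phi> u + \<phi> v"
    and "\<And>c v. v \<in> V \<Longrightarrow> \<phi> (fscale c v) = fscale c (\<phi> v)"
  shows "lin_on V W \<phi>"
  using assms by (auto simp: lin_on_def)

lemma lin_onD:
  assumes "lin_on V W \<phi>"
  shows "v \<in> V \<Longrightarrow> \<phi> v \<in> W"
    and "u \<in> V \<Longrightarrow> v \<in> V \<Longrightarrow> \<phi> (u + v) = \<phi> u + \<phi> v"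
    and "v \<in> V \<Longrightarrow> \<phi> (fscale c v) = fscale c (\<phi> v)"
  using assms by (auto simp: lin_on_def)

lemma lin_on_cong:
  assumes "lin_on V W \<phi>" and "fs.subspace V" and "\<And>v. v \<in> V \<Longrightarrow> \<psi> v = \<phi> v"
  shows "lin_on V W \<psi>"
  using assms by (auto simp: lin_on_def fs.subspace_add fs.subspace_scale)

lemma lin_on_zero:
  assumes "lin_on V W \<phi>" and "fs.subspace V"
  shows "\<phi> 0 = 0"
  using lin_onD(3)[OF assms(1) fs.subspace_0[OF assms(2)], of 0] by simp

lemma lin_on_diff:
  assumes "lin_on V W \<phi>" and "fs.subspace V" and "u \<in> V" and "v \<in> V"
  shows "\<phi> (u - v) = \<phi> u - \<phi> v"
  using lin_onD(2)[OF assms(1) fs.subspace_diff[OF assms(2,3,4)] assms(4)]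
  by (simp add: algebra_simps)

lemma lin_on_sum:
  assumes "lin_on V W \<phi>" and "fs.subspace V" and "\<And>i. i \<in> A \<Longrightarrow> v i \<in> V"
  shows "\<phi> (\<Sum>i\<in>A. v i) = (\<Sum>i\<in>A. \<phi> (v i))"
  using assms(3)
proof (induction A rule: infinite_finite_induct)
  case (insert a A)
  have "(\<Sum>i\<in>A. v i) \<in> V"
    by (rule fs.subspace_sum) (use assms(2) insert.prems in auto)
  then have "\<phi> (v a + (\<Sum>i\<in>A. v i)) = \<phi> (v a) + \<phi> (\<Sum>i\<in>A. v i)"
    by (intro lin_onD(2)[OF assms(1)] insert.prems) simp_all
  moreover have "\<phi> (\<Sum>i\<in>A. v i) = (\<Sum>i\<in>A. \<phi> (v i))"
    by (rule insert.IH) (use insert.prems in blast)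
  ultimately show ?case
    by (simp only: sum.insert[OF insert.hyps])
qed (auto simp: lin_on_zero[OF assms(1,2)])

lemma lin_on_comp:
  assumes "lin_on U V \<phi>" and "lin_on V W \<psi>"
  shows "lin_on U W (\<lambda>v. \<psi> (\<phi> v))"
  by (rule lin_onI) (auto simp: lin_onD[OF assms(1)] lin_onD[OF assms(2)])

lemma lin_on_inv_into:
  assumes lin: "lin_on V W \<phi>" and bij: "bij_betw \<phi> V W" and V: "fs.subspace V"
  shows "lin_on W V (inv_into V \<phi>)"
proof -
  have surj: "\<phi> ` V = W" and inj: "inj_on \<phi> V"
    using bij by (auto simp: bij_betw_def)
  have mem: "inv_into V \<phi> w \<in> V" and inv: "\<phi> (inv_into V \<phi> w) = w" if "w \<in> W" for w
    using that surj by (auto simp: inv_into_into f_inv_into_f)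
  have eq: "inv_into V \<phi> w = v" if "v \<in> V" and "\<phi> v = w" for v w
    using that inj by auto
  show ?thesis
    by (rule lin_onI)
      (auto intro!: eq simp: mem inv lin_onD[OF lin] fs.subspace_add[OF V] fs.subspace_scale[OF V])
qed

lemma subspace_lin_image:
  assumes "lin_on V W \<phi>" and "fs.subspace V"
  shows "fs.subspace (\<phi> ` V)"
proof (rule fs.subspaceI)
  show "0 \<in> \<phi> ` V"
    using lin_on_zero[OF assms] fs.subspace_0[OF assms(2)] by force
next
  fix u v assume "u \<in> \<phi> ` V" and "v \<in> \<phi> ` V"
  then obtain a b where "a \<in> V" "b \<in> V" "u = \<phi> a" "v = \<phi> b" by auto
  then show "u + v \<in> \<phi> ` V"
    by (intro image_eqI[of _ _ "a + b"]) (auto simp: lin_onD[OF assms(1)] fs.subspace_add[OF assms(2)])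
next
  fix c u assume "u \<in> \<phi> ` V"
  then obtain a where "a \<in> V" "u = \<phi> a" by auto
  then show "fscale c u \<in> \<phi> ` V"
    by (intro image_eqI[of _ _ "fscale c a"]) (auto simp: lin_onD[OF assms(1)] fs.subspace_scale[OF assms(2)])
qed

lemma finitely_generated_subspace:
  assumes "fs.subspace V" and "V \<subseteq> fs.span T" and "finite T"
  shows "\<exists>B. finite B \<and> fs.span B = V"
proof -
  obtain B where B: "B \<subseteq> V" "fs.independent B" "V \<subseteq> fs.span B"
    using fs.maximal_independent_subset[of V] by blast
  have "finite B"
    using fs.independent_span_bound[OF assms(3) B(2)] B(1) assms(2) by auto
  moreover have "fs.span B = V"
    using B assms(1) by (simp add: fs.span_minimal subset_antisym)
  ultimately show ?thesis by blast
qed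

lemma finitely_generated_lin_image:
  assumes "lin_on V W \<phi>" and "fs.subspace V" and "\<exists>B. finite B \<and> fs.span B = V"
  shows "\<exists>B. finite B \<and> fs.span B = \<phi> ` V"
proof -
  obtain B where B: "finite B" "fs.span B = V"
    using assms(3) by blast
  show ?thesis
  proof (rule finitely_generated_subspace[of _ "\<phi> ` B"])
    show "fs.subspace (\<phi> ` V)" by (rule subspace_lin_image[OF assms(1,2)])
    show "finite (\<phi> ` B)" using B(1) by simp
    show "\<phi> ` V \<subseteq> fs.span (\<phi> ` B)"
    proof
      fix w assume "w \<in> \<phi> ` V"
      then obtain v where v: "v \<in> V" "w = \<phi> v" by auto
      have BV: "B \<subseteq> V" using B(2) fs.span_superset by blast
      have "v \<in> range (\<lambda>u. \<Sum>b\<in>B. fscale (u b) b)"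
        using v(1) by (simp only: B(2)[symmetric] fs.span_finite[OF B(1)])
      then obtain u where u: "v = (\<Sum>b\<in>B. fscale (u b) b)" ..
      have "\<phi> (\<Sum>b\<in>B. fscale (u b) b) = (\<Sum>b\<in>B. \<phi> (fscale (u b) b))"
        using BV fs.subspace_scale[OF assms(2)] by (intro lin_on_sum[OF assms(1,2)]) blast
      also have "\<dots> = (\<Sum>b\<in>B. fscale (u b) (\<phi> b))"
        using BV by (intro sum.cong refl lin_onD(3)[OF assms(1)]) blast
      finally have "w = (\<Sum>b\<in>B. fscale (u b) (\<phi> b))"
        by (simp only: v(2) u)
      then show "w \<in> fs.span (\<phi> ` B)"
        by (simp only:) (intro fs.span_sum fs.span_scale fs.span_base imageI)
    qed
  qed
qed

lemma supported_in_span_unit_vectors: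
  fixes w :: "'a \<Rightarrow> 'k::field"
  assumes "finite A" and "\<And>i. i \<notin> A \<Longrightarrow> w i = 0"
  shows "w \<in> fs.span ((\<lambda>i j. if j = i then 1 else 0) ` A)"
proof -
  have "w = (\<Sum>i\<in>A. fscale (w i) (\<lambda>j. if j = i then 1 else 0))"
    using assms by (auto simp: fun_eq_iff sum_fun_apply if_distrib cong: if_cong)
  also have "\<dots> \<in> fs.span ((\<lambda>i j. if j = i then 1 else 0) ` A)"
    by (intro fs.span_sum fs.span_scale fs.span_base imageI)
  finally show ?thesis .
qed

lemma finitely_generated_finite_support:
  assumes "fs.subspace V" and "finite A" and "\<And>w n. w \<in> V \<Longrightarrow> n \<notin> A \<Longrightarrow> w n = 0"
  shows "\<exists>B. finite B \<and> fs.span B = V"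
proof (rule finitely_generated_subspace[OF assms(1)])
  show "V \<subseteq> fs.span ((\<lambda>i j. if j = i then 1 else 0) ` A)"
    using assms(3) by (intro subsetI supported_in_span_unit_vectors[OF assms(2)])
qed (use assms(2) in simp)

text \<open>The columns of the second factor of an \<open>m \<times> m\<close> identity matrix are independent vectors of
  the intermediate space, because the first factor recovers the coefficients of any linear relation.\<close>

lemma identity_factorization_bound:
  fixes \<alpha> :: "nat \<Rightarrow> 'a \<Rightarrow> 'k::field" and \<beta> :: "'a \<Rightarrow> nat \<Rightarrow> 'k"
  assumes A: "finite A"
    and id: "\<And>p q. p < m \<Longrightarrow> q < m \<Longrightarrow> (\<Sum>i\<in>A. \<alpha> p i * \<beta> i q) = (if p = q then 1 else 0)"
  shows "m \<le> card A"
proof -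
  define b where "b q = (\<lambda>i. if i \<in> A then \<beta> i q else 0)" for q
  have id': "(\<Sum>i\<in>A. \<alpha> p i * b q i) = (if p = q then 1 else 0)" if "p < m" "q < m" for p q
    using id[OF that] by (simp add: b_def)
  have inj: "inj_on b {..<m}"
  proof (rule inj_onI, rule ccontr)
    fix p q assume "p \<in> {..<m}" "q \<in> {..<m}" "b p = b q" "p \<noteq> q"
    then show False
      using id'[of p p] id'[of p q] by simp
  qed
  have "fs.independent (b ` {..<m})"
  proof
    assume "fs.dependent (b ` {..<m})"
    then obtain u p where p: "p < m" "u (b p) \<noteq> 0"
      and "(\<Sum>v\<in>b ` {..<m}. fscale (u v) v) = 0"
      by (auto simp: fs.dependent_finite)
    then have "(\<Sum>q<m. fscale (u (b q)) (b q)) = 0"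
      by (simp add: sum.reindex[OF inj])
    then have 0: "(\<Sum>q<m. u (b q) * b q i) = 0" for i
      by (auto simp: fun_eq_iff sum_fun_apply)
    have "0 = (\<Sum>i\<in>A. \<alpha> p i * (\<Sum>q<m. u (b q) * b q i))"
      by (simp add: 0)
    also have "\<dots> = (\<Sum>q<m. u (b q) * (\<Sum>i\<in>A. \<alpha> p i * b q i))"
      by (simp add: sum_distrib_left algebra_simps) (rule sum.swap)
    also have "\<dots> = (\<Sum>q<m. if q = p then u (b p) else 0)"
      using p(1) by (intro sum.cong) (auto simp: id')
    also have "\<dots> = u (b p)"
      using p(1) by simp
    finally show False using p(2) by simp
  qed
  moreover have "b ` {..<m} \<subseteq> fs.span ((\<lambda>i j. if j = i then 1 else 0) ` A)"
    by (auto intro!: supported_in_span_unit_vectors[OF A] simp: b_def)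
  ultimately have "card (b ` {..<m}) \<le> card ((\<lambda>i j. if j = i then (1::'k) else 0) ` A)"
    using fs.independent_span_bound A by blast
  also have "\<dots> \<le> card A"
    by (rule card_image_le[OF A])
  finally show ?thesis
    by (simp add: card_image[OF inj])
qed

section \<open>Modules and their isomorphisms\<close>

lemma is_moduleD:
  assumes "is_module P M"
  shows "x \<in> Field P \<Longrightarrow> fs.subspace (sp M x)"
    and "x \<in> Field P \<Longrightarrow> \<exists>B. finite B \<and> fs.span B = sp M x"
    and "(x, y) \<in> P \<Longrightarrow> lin_on (sp M x) (sp M y) (tr M x y)"
    and "x \<in> Field P \<Longrightarrow> v \<in> sp M x \<Longrightarrow> tr M x x v = v"
    and "(x, y) \<in> P \<Longrightarrow> (y, z) \<in> P \<Longrightarrow> v \<in> sp M x \<Longrightarrow> tr M y z (tr M x y v) = tr M x z v"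
    and "(x, y) \<in> P \<Longrightarrow> v \<in> sp M x \<Longrightarrow> tr M x y v \<in> sp M y"
proof -
  show "x \<in> Field P \<Longrightarrow> fs.subspace (sp M x)"
    and "x \<in> Field P \<Longrightarrow> \<exists>B. finite B \<and> fs.span B = sp M x"
    and "x \<in> Field P \<Longrightarrow> v \<in> sp M x \<Longrightarrow> tr M x x v = v"
    and "(x, y) \<in> P \<Longrightarrow> (y, z) \<in> P \<Longrightarrow> v \<in> sp M x \<Longrightarrow> tr M y z (tr M x y v) = tr M x z v"
    using assms unfolding is_module_def by blast+
  show lin: "(x, y) \<in> P \<Longrightarrow> lin_on (sp M x) (sp M y) (tr M x y)"
    using assms unfolding is_module_def by blast
  show "(x, y) \<in> P \<Longrightarrow> v \<in> sp M x \<Longrightarrow> tr M x y v \<in> sp M y"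
    using lin lin_onD(1) by blast
qed

lemma is_moduleI:
  assumes "\<And>x. x \<in> Field P \<Longrightarrow> fs.subspace (sp M x)"
    and "\<And>x. x \<in> Field P \<Longrightarrow> \<exists>B. finite B \<and> fs.span B = sp M x"
    and "\<And>x y. (x, y) \<in> P \<Longrightarrow> lin_on (sp M x) (sp M y) (tr M x y)"
    and "\<And>x v. x \<in> Field P \<Longrightarrow> v \<in> sp M x \<Longrightarrow> tr M x x v = v"
    and "\<And>x y z v. (x, y) \<in> P \<Longrightarrow> (y, z) \<in> P \<Longrightarrow> v \<in> sp M x \<Longrightarrow> tr M y z (tr M x y v) = tr M x z v"
  shows "is_module P M"
  unfolding is_module_def using assms by blast

lemma HomD:
  assumes "\<phi> \<in> Hom P M N"
  shows "x \<in> Field P \<Longrightarrow> lin_on (sp M x) (sp N x) (\<phi> x)"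
    and "(x, y) \<in> P \<Longrightarrow> v \<in> sp M x \<Longrightarrow> \<phi> y (tr M x y v) = tr N x y (\<phi> x v)"
    and "x \<in> Field P \<Longrightarrow> v \<in> sp M x \<Longrightarrow> \<phi> x v \<in> sp N x"
    and "x \<in> Field P \<Longrightarrow> v \<notin> sp M x \<Longrightarrow> \<phi> x v = undefined"
    and "x \<notin> Field P \<Longrightarrow> \<phi> x = undefined"
proof -
  show "x \<in> Field P \<Longrightarrow> lin_on (sp M x) (sp N x) (\<phi> x)"
    and "(x, y) \<in> P \<Longrightarrow> v \<in> sp M x \<Longrightarrow> \<phi> y (tr M x y v) = tr N x y (\<phi> x v)"
    using assms unfolding Hom_def by blast+
  have \<phi>: "\<phi> \<in> (\<Pi>\<^sub>E x\<in>Field P. sp M x \<rightarrow>\<^sub>E sp N x)"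
    using assms unfolding Hom_def by blast
  show "x \<notin> Field P \<Longrightarrow> \<phi> x = undefined"
    using \<phi> by (rule PiE_arb)
  have "x \<in> Field P \<Longrightarrow> \<phi> x \<in> sp M x \<rightarrow>\<^sub>E sp N x"
    using \<phi> by (rule PiE_mem)
  then show "x \<in> Field P \<Longrightarrow> v \<in> sp M x \<Longrightarrow> \<phi> x v \<in> sp N x"
    and "x \<in> Field P \<Longrightarrow> v \<notin> sp M x \<Longrightarrow> \<phi> x v = undefined"
    by (auto dest: PiE_mem PiE_arb)
qed

text \<open>The members of \<^const>\<open>Hom\<close> are extensional. A family of maps given by a formula becomes a
  morphism after its values outside the spaces of \<open>M\<close> have been normalised.\<close>

definition ext_hom :: "'p rel \<Rightarrow> ('p, 'i, 'k::field) rep \<Rightarrow> ('p \<Rightarrow> ('i \<Rightarrow> 'k) \<Rightarrow> ('j \<Rightarrow> 'k))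
    \<Rightarrow> ('p \<Rightarrow> ('i \<Rightarrow> 'k) \<Rightarrow> ('j \<Rightarrow> 'k))" where
  "ext_hom P M \<phi> = (\<lambda>x\<in>Field P. restrict (\<phi> x) (sp M x))"

lemma ext_hom_apply [simp]: "x \<in> Field P \<Longrightarrow> v \<in> sp M x \<Longrightarrow> ext_hom P M \<phi> x v = \<phi> x v"
  by (simp add: ext_hom_def)

lemma ext_hom_in_Hom:
  assumes "is_module P M"
    and "\<And>x. x \<in> Field P \<Longrightarrow> lin_on (sp M x) (sp N x) (\<phi> x)"
    and "\<And>x y v. (x, y) \<in> P \<Longrightarrow> v \<in> sp M x \<Longrightarrow> \<phi> y (tr M x y v) = tr N x y (\<phi> x v)"
  shows "ext_hom P M \<phi> \<in> Hom P M N"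
proof -
  have "lin_on (sp M x) (sp N x) (ext_hom P M \<phi> x)" if "x \<in> Field P" for x
    using that by (intro lin_on_cong[OF assms(2)] is_moduleD(1)[OF assms(1)]) auto
  moreover have "ext_hom P M \<phi> y (tr M x y v) = tr N x y (ext_hom P M \<phi> x v)"
    if "(x, y) \<in> P" "v \<in> sp M x" for x y v
    using that assms(3) is_moduleD(6)[OF assms(1)] by (simp add: FieldI1 FieldI2)
  moreover have "ext_hom P M \<phi> \<in> (\<Pi>\<^sub>E x\<in>Field P. sp M x \<rightarrow>\<^sub>E sp N x)"
    using lin_onD(1)[OF assms(2)] by (auto simp: ext_hom_def)
  ultimately show ?thesis
    unfolding Hom_def by blast
qed

lemma Hom_eqI:
  assumes "\<phi> \<in> Hom P M N" and "\<psi> \<in> Hom P M N"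
    and "\<And>x v. x \<in> Field P \<Longrightarrow> v \<in> sp M x \<Longrightarrow> \<phi> x v = \<psi> x v"
  shows "\<phi> = \<psi>"
proof (rule ext, rule ext)
  fix x v show "\<phi> x v = \<psi> x v"
    using HomD(4,5)[OF assms(1)] HomD(4,5)[OF assms(2)] assms(3) by metis
qed

lemma isomorphicI:
  assumes "is_module P M"
    and "\<And>x. x \<in> Field P \<Longrightarrow> lin_on (sp M x) (sp N x) (\<phi> x)"
    and "\<And>x. x \<in> Field P \<Longrightarrow> bij_betw (\<phi> x) (sp M x) (sp N x)"
    and "\<And>x y v. (x, y) \<in> P \<Longrightarrow> v \<in> sp M x \<Longrightarrow> \<phi> y (tr M x y v) = tr N x y (\<phi> x v)"
  shows "isomorphic P M N"
  unfolding isomorphic_def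
proof (intro bexI[of _ "ext_hom P M \<phi>"] ballI)
  show "ext_hom P M \<phi> \<in> Hom P M N"
    by (rule ext_hom_in_Hom[OF assms(1,2,4)])
  show "bij_betw (ext_hom P M \<phi> x) (sp M x) (sp N x)" if "x \<in> Field P" for x
    using assms(3)[OF that] that by (subst bij_betw_cong[of _ _ "\<phi> x"]) auto
qed

lemma isomorphicE:
  assumes "isomorphic P M N"
  obtains \<phi> where "\<phi> \<in> Hom P M N" "\<And>x. x \<in> Field P \<Longrightarrow> bij_betw (\<phi> x) (sp M x) (sp N x)"
  using assms unfolding isomorphic_def by blast

lemma isomorphic_refl: "is_module P M \<Longrightarrow> isomorphic P M M"
  by (rule isomorphicI[where \<phi> = "\<lambda>_ v. v"]) (auto intro: lin_onI bij_betw_byWitness)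

lemma isomorphic_trans:
  assumes "is_module P L" and "isomorphic P L M" and "isomorphic P M N"
  shows "isomorphic P L N"
proof -
  obtain \<phi> where \<phi>: "\<phi> \<in> Hom P L M" "\<And>x. x \<in> Field P \<Longrightarrow> bij_betw (\<phi> x) (sp L x) (sp M x)"
    using assms(2) by (rule isomorphicE) blast
  obtain \<psi> where \<psi>: "\<psi> \<in> Hom P M N" "\<And>x. x \<in> Field P \<Longrightarrow> bij_betw (\<psi> x) (sp M x) (sp N x)"
    using assms(3) by (rule isomorphicE) blast
  show ?thesis
  proof (rule isomorphicI[OF assms(1), where \<phi> = "\<lambda>x v. \<psi> x (\<phi> x v)"])
    show "lin_on (sp L x) (sp N x) (\<lambda>v. \<psi> x (\<phi> x v))" if "x \<in> Field P" for x
      using HomD(1)[OF \<phi>(1) that] HomD(1)[OF \<psi>(1) that] by (rule lin_on_comp)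
    show "bij_betw (\<lambda>v. \<psi> x (\<phi> x v)) (sp L x) (sp N x)" if "x \<in> Field P" for x
      using bij_betw_trans[OF \<phi>(2) \<psi>(2), OF that that] by (simp add: o_def)
    show "\<psi> y (\<phi> y (tr L x y v)) = tr N x y (\<psi> x (\<phi> x v))" if "(x, y) \<in> P" "v \<in> sp L x" for x y v
      using that HomD(2,3)[OF \<phi>(1)] HomD(2)[OF \<psi>(1)] by (simp add: FieldI1)
  qed
qed

lemma isomorphic_sym:
  assumes M: "is_module P M" and N: "is_module P N" and iso: "isomorphic P M N"
  shows "isomorphic P N M"
proof -
  obtain \<phi> where \<phi>: "\<phi> \<in> Hom P M N" "\<And>x. x \<in> Field P \<Longrightarrow> bij_betw (\<phi> x) (sp M x) (sp N x)"
    using iso by (rule isomorphicE) blast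
  show ?thesis
  proof (rule isomorphicI[OF N, where \<phi> = "\<lambda>x. inv_into (sp M x) (\<phi> x)"])
    show "lin_on (sp N x) (sp M x) (inv_into (sp M x) (\<phi> x))" if "x \<in> Field P" for x
      by (rule lin_on_inv_into[OF HomD(1)[OF \<phi>(1)] \<phi>(2) is_moduleD(1)[OF M]]) (use that in auto)
    show "bij_betw (inv_into (sp M x) (\<phi> x)) (sp N x) (sp M x)" if "x \<in> Field P" for x
      by (rule bij_betw_inv_into[OF \<phi>(2)[OF that]])
    show "inv_into (sp M y) (\<phi> y) (tr N x y w) = tr M x y (inv_into (sp M x) (\<phi> x) w)"
      if "(x, y) \<in> P" and w: "w \<in> sp N x" for x y w
    proof -
      have x: "x \<in> Field P" and y: "y \<in> Field P" using that(1) by (auto simp: FieldI1 FieldI2)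
      have "w \<in> \<phi> x ` sp M x" using \<phi>(2)[OF x] w by (simp add: bij_betw_def)
      then obtain v where v: "v \<in> sp M x" "w = \<phi> x v" by auto
      have inj: "inj_on (\<phi> x) (sp M x)" "inj_on (\<phi> y) (sp M y)"
        using \<phi>(2) x y by (auto simp: bij_betw_def)
      have "tr N x y w = \<phi> y (tr M x y v)"
        using HomD(2)[OF \<phi>(1) that(1) v(1)] v(2) by simp
      then show ?thesis
        using inj v is_moduleD(6)[OF M that(1) v(1)] by simp
    qed
  qed
qed

lemma isoclass_eq:
  assumes M: "is_module P M" and N: "is_module P N" and iso: "isomorphic P M N"
  shows "isoclass P M = isoclass P N"
proof -
  have "isomorphic P L M \<longleftrightarrow> isomorphic P L N" if "is_module P L" for L :: "('a, nat, 'c) rep"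
    using isomorphic_trans[OF that _ iso] isomorphic_trans[OF that _ isomorphic_sym[OF M N iso]]
    by iprover
  then show ?thesis
    unfolding isoclass_def by (auto simp only:)
qed

section \<open>Direct sums, relabelling and interval modules\<close>

lemma comp_linear [simp]:
  "(u + v) \<circ> f = (u \<circ> f) + (v \<circ> f)" "fscale c u \<circ> f = fscale c (u \<circ> f)" "0 \<circ> f = 0"
  by (auto simp: fun_eq_iff)

lemma mem_direct_sum:
  "w \<in> sp (direct_sum M N) x \<longleftrightarrow> w \<circ> Inl \<in> sp M x \<and> w \<circ> Inr \<in> sp N x"
proof -
  have "w = case_sum (w \<circ> Inl) (w \<circ> Inr)"
    by (auto simp: fun_eq_iff split: sum.split)
  then show ?thesis
    by (auto simp: direct_sum_def comp_def)
qed

lemma sum_fun_eqI: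
  assumes "w \<circ> Inl = w' \<circ> Inl" and "w \<circ> Inr = w' \<circ> Inr"
  shows "w = w'"
proof
  fix z show "w z = w' z"
    using assms by (cases z) (simp_all add: fun_eq_iff)
qed

lemma tr_direct_sum [simp]:
  "tr (direct_sum M N) x y w \<circ> Inl = tr M x y (w \<circ> Inl)"
  "tr (direct_sum M N) x y w \<circ> Inr = tr N x y (w \<circ> Inr)"
  by (auto simp: direct_sum_def fun_eq_iff)

lemma case_sum_comp [simp]: "case_sum f g \<circ> Inl = f" "case_sum f g \<circ> Inr = g"
  by (auto simp: fun_eq_iff)

lemma is_module_direct_sum:
  assumes M: "is_module P M" and N: "is_module P N"
  shows "is_module P (direct_sum M N)"
proof (rule is_moduleI)
  fix x assume x: "x \<in> Field P"
  note sub = is_moduleD(1)[OF M x] is_moduleD(1)[OF N x]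
  show "fs.subspace (sp (direct_sum M N) x)"
    by (rule fs.subspaceI) (auto simp: mem_direct_sum fs.subspace_0[OF sub(1)] fs.subspace_0[OF sub(2)]
        fs.subspace_add[OF sub(1)] fs.subspace_add[OF sub(2)]
        fs.subspace_scale[OF sub(1)] fs.subspace_scale[OF sub(2)])
  have lin: "lin_on (sp M x) UNIV (\<lambda>u. case_sum u 0 :: 'b + 'd \<Rightarrow> 'c)"
    "lin_on (sp N x) UNIV (\<lambda>u. case_sum 0 u :: 'b + 'd \<Rightarrow> 'c)"
    by (auto intro!: lin_onI simp: fun_eq_iff split: sum.split)
  obtain B where B: "finite B" "fs.span B = (\<lambda>u. case_sum u 0 :: 'b + 'd \<Rightarrow> 'c) ` sp M x"
    using finitely_generated_lin_image[OF lin(1) sub(1) is_moduleD(2)[OF M x]] by (elim exE conjE)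
  obtain C where C: "finite C" "fs.span C = (\<lambda>u. case_sum 0 u :: 'b + 'd \<Rightarrow> 'c) ` sp N x"
    using finitely_generated_lin_image[OF lin(2) sub(2) is_moduleD(2)[OF N x]] by (elim exE conjE)
  have add: "case_sum u 0 + case_sum 0 v = (case_sum u v :: 'b + 'd \<Rightarrow> 'c)" for u v
    by (auto simp: fun_eq_iff split: sum.split)
  have "fs.span (B \<union> C) = sp (direct_sum M N) x"
    unfolding fs.span_Un B(2) C(2)
  proof (intro subset_antisym subsetI)
    fix w assume "w \<in> sp (direct_sum M N) x"
    then obtain u v where "u \<in> sp M x" "v \<in> sp N x" "w = case_sum u v"
      by (auto simp: direct_sum_def)
    then show "w \<in> {a + b |a b. a \<in> (\<lambda>u. case_sum u 0) ` sp M x \<and> b \<in> case_sum 0 ` sp N x}"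
      by (simp only: add[symmetric, of u v]) blast
  qed (auto simp: add mem_direct_sum)
  then show "\<exists>B. finite B \<and> fs.span B = sp (direct_sum M N) x"
    using B(1) C(1) by blast
next
  fix x y assume xy: "(x, y) \<in> P"
  note lin = lin_onD[OF is_moduleD(3)[OF M xy]] lin_onD[OF is_moduleD(3)[OF N xy]]
  show "lin_on (sp (direct_sum M N) x) (sp (direct_sum M N) y) (tr (direct_sum M N) x y)"
    by (rule lin_onI) (auto simp: mem_direct_sum lin intro: sum_fun_eqI)
next
  fix x v assume "x \<in> Field P" and "v \<in> sp (direct_sum M N) x"
  then show "tr (direct_sum M N) x x v = v"
    by (intro sum_fun_eqI) (simp_all add: mem_direct_sum is_moduleD(4)[OF M] is_moduleD(4)[OF N])
next
  fix x y z v assume "(x, y) \<in> P" "(y, z) \<in> P" and "v \<in> sp (direct_sum M N) x"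
  then show "tr (direct_sum M N) y z (tr (direct_sum M N) x y v) = tr (direct_sum M N) x z v"
    by (intro sum_fun_eqI) (simp_all add: mem_direct_sum is_moduleD(5)[OF M] is_moduleD(5)[OF N])
qed

definition push :: "('i \<Rightarrow> 'j) \<Rightarrow> ('i \<Rightarrow> 'k::field) \<Rightarrow> ('j \<Rightarrow> 'k)" where
  "push \<rho> w = (\<lambda>j. if j \<in> range \<rho> then w (inv_into UNIV \<rho> j) else 0)"

definition relabel :: "('i \<Rightarrow> 'j) \<Rightarrow> ('p, 'i, 'k::field) rep \<Rightarrow> ('p, 'j, 'k) rep" where
  "relabel \<rho> M = \<lparr>sp = (\<lambda>x. push \<rho> ` sp M x), tr = (\<lambda>x y w. push \<rho> (tr M x y (w \<circ> \<rho>)))\<rparr>"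

lemma push_comp [simp]: "inj \<rho> \<Longrightarrow> push \<rho> w \<circ> \<rho> = w"
  by (auto simp: push_def fun_eq_iff)

lemma lin_on_push: "push \<rho> ` V \<subseteq> W \<Longrightarrow> lin_on V W (push \<rho>)"
  by (rule lin_onI) (auto simp: push_def fun_eq_iff)

text \<open>Isomorphism classes consist of \<^typ>\<open>nat\<close>-indexed modules; relabelling along an injection into
  \<^typ>\<open>nat\<close> provides representatives for modules with other countable index types.\<close>

lemma relabel_module:
  fixes \<rho> :: "'i \<Rightarrow> 'j"
  assumes M: "is_module P M" and inj_r: "inj \<rho>"
  shows "is_module P (relabel \<rho> M)" and "isomorphic P M (relabel \<rho> M)"
proof -
  have inj: "inj_on (push \<rho>) V" for V :: "('i \<Rightarrow> 'b) set"
    by (rule inj_on_inverseI[of _ "\<lambda>w. w \<circ> \<rho>"]) (simp add: inj_r)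
  show "is_module P (relabel \<rho> M)"
  proof (rule is_moduleI)
    fix x assume x: "x \<in> Field P"
    have lin: "lin_on (sp M x) UNIV (push \<rho>)"
      by (rule lin_on_push) simp
    show "fs.subspace (sp (relabel \<rho> M) x)"
      using subspace_lin_image[OF lin is_moduleD(1)[OF M x]] by (simp add: relabel_def)
    show "\<exists>B. finite B \<and> fs.span B = sp (relabel \<rho> M) x"
      using finitely_generated_lin_image[OF lin is_moduleD(1,2)[OF M x]]
      by (simp add: relabel_def)
  next
    fix x y assume xy: "(x, y) \<in> P"
    have "lin_on (sp (relabel \<rho> M) x) (sp M x) (\<lambda>w. w \<circ> \<rho>)"
      by (rule lin_onI) (auto simp: relabel_def inj_r)
    moreover have "lin_on (sp M y) (sp (relabel \<rho> M) y) (push \<rho>)"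
      by (rule lin_on_push) (simp add: relabel_def)
    ultimately have "lin_on (sp (relabel \<rho> M) x) (sp (relabel \<rho> M) y) (\<lambda>w. push \<rho> (tr M x y (w \<circ> \<rho>)))"
      by (intro lin_on_comp[OF lin_on_comp[OF _ is_moduleD(3)[OF M xy]]])
    then show "lin_on (sp (relabel \<rho> M) x) (sp (relabel \<rho> M) y) (tr (relabel \<rho> M) x y)"
      by (simp add: relabel_def)
  qed (auto simp: relabel_def inj_r is_moduleD[OF M])
  show "isomorphic P M (relabel \<rho> M)"
    by (rule isomorphicI[OF M, where \<phi> = "\<lambda>_. push \<rho>"])
      (auto simp: relabel_def inj_r intro!: lin_on_push inj bij_betw_imageI)
qed

definition order_convex :: "'p rel \<Rightarrow> 'p set \<Rightarrow> bool" where
  "order_convex P S \<longleftrightarrow> S \<subseteq> Field P \<and>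
     (\<forall>x y z. x \<in> S \<longrightarrow> z \<in> S \<longrightarrow> (x, y) \<in> P \<longrightarrow> (y, z) \<in> P \<longrightarrow> y \<in> S)"

lemma is_module_interval:
  assumes "order_convex P S"
  shows "is_module P (interval_module S :: ('p, unit, 'k::field) rep)"
proof (rule is_moduleI)
  fix x
  show "fs.subspace (sp (interval_module S :: ('p, unit, 'k) rep) x)"
    by (auto simp: interval_module_def intro!: fs.subspaceI)
  have "UNIV \<subseteq> fs.span ((\<lambda>i j. if j = i then 1 else 0) ` (UNIV::unit set) :: (unit \<Rightarrow> 'k) set)"
    by (intro subsetI supported_in_span_unit_vectors) auto
  then have "\<exists>B. finite B \<and> fs.span B = (UNIV :: (unit \<Rightarrow> 'k) set)"
    by (intro finitely_generated_subspace) auto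
  moreover have "\<exists>B. finite B \<and> fs.span B = ({0} :: (unit \<Rightarrow> 'k) set)"
    by (intro exI[of _ "{}"]) simp
  ultimately show "\<exists>B. finite B \<and> fs.span B = sp (interval_module S :: ('p, unit, 'k) rep) x"
    by (simp add: interval_module_def)
next
  fix x y assume "(x, y) \<in> P"
  then show "lin_on (sp (interval_module S) x) (sp (interval_module S) y)
      (tr (interval_module S :: ('p, unit, 'k) rep) x y)"
    by (intro lin_onI) (auto simp: interval_module_def fun_eq_iff)
next
  fix x v assume "x \<in> Field P" and "v \<in> sp (interval_module S :: ('p, unit, 'k) rep) x"
  then show "tr (interval_module S) x x v = v"
    by (auto simp: interval_module_def split: if_splits)
next
  fix x y z v assume "(x, y) \<in> P" "(y, z) \<in> P"
  then have "x \<in> S \<Longrightarrow> z \<in> S \<Longrightarrow> y \<in> S"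
    using assms unfolding order_convex_def by blast
  then show "tr (interval_module S) y z (tr (interval_module S) x y v) =
      tr (interval_module S :: ('p, unit, 'k) rep) x z v"
    by (auto simp: interval_module_def)
qed

section \<open>Biorthogonal systems and multiplicities\<close>

text \<open>Sections are the elements of the limit of \<open>M\<close> over the full subposet \<open>T\<close>; cosections are the
  linear functionals on its colimit. A cosection is evaluated on a section at any point of \<open>T\<close>, and
  the value does not depend on the point if \<open>T\<close> is connected.\<close>

definition is_section :: "'p rel \<Rightarrow> 'p set \<Rightarrow> ('p, 'i, 'k::field) rep \<Rightarrow> ('p \<Rightarrow> 'i \<Rightarrow> 'k) \<Rightarrow> bool" where
  "is_section P T M s \<longleftrightarrow> (\<forall>x\<in>T. s x \<in> sp M x) \<and>
     (\<forall>x\<in>T. \<forall>y\<in>T. (x, y) \<in> P \<longrightarrow> tr M x y (s x) = s y)"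

definition is_cosection :: "'p rel \<Rightarrow> 'p set \<Rightarrow> ('p, 'i, 'k::field) rep \<Rightarrow>
    ('p \<Rightarrow> ('i \<Rightarrow> 'k) \<Rightarrow> 'k) \<Rightarrow> bool" where
  "is_cosection P T M l \<longleftrightarrow> (\<forall>x\<in>T. lin_on (sp M x) UNIV (\<lambda>v (_::unit). l x v)) \<and>
     (\<forall>x\<in>T. \<forall>y\<in>T. (x, y) \<in> P \<longrightarrow> (\<forall>v\<in>sp M x. l y (tr M x y v) = l x v))"

definition biorthogonal :: "'p rel \<Rightarrow> 'p set \<Rightarrow> ('p, 'i, 'k::field) rep \<Rightarrow> nat \<Rightarrow>
    (nat \<Rightarrow> 'p \<Rightarrow> 'i \<Rightarrow> 'k) \<Rightarrow> (nat \<Rightarrow> 'p \<Rightarrow> ('i \<Rightarrow> 'k) \<Rightarrow> 'k) \<Rightarrow> bool" where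
  "biorthogonal P T M n s l \<longleftrightarrow>
     (\<forall>i<n. is_section P T M (s i)) \<and> (\<forall>i<n. is_cosection P T M (l i)) \<and>
     (\<forall>i<n. \<forall>j<n. \<forall>x\<in>T. l i x (s j x) = (if i = j then 1 else 0))"

definition has_biorthogonal :: "'p rel \<Rightarrow> 'p set \<Rightarrow> ('p, 'i, 'k::field) rep \<Rightarrow> nat \<Rightarrow> bool" where
  "has_biorthogonal P T M n \<longleftrightarrow> (\<exists>s l. biorthogonal P T M n s l)"

text \<open>For connected \<open>T\<close>, this is the rank of the canonical map from the limit to the colimit of \<open>M\<close>
  over \<open>T\<close>.\<close>

definition generalized_rank :: "'p rel \<Rightarrow> 'p set \<Rightarrow> ('p, 'i, 'k::field) rep \<Rightarrow> nat" where
  "generalized_rank P T M = (GREATEST n. has_biorthogonal P T M n)"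

text \<open>Connectedness is phrased through subsets that are closed under comparability in both
  directions: applied to the fibres of a function, it says that a function which is constant along
  comparable elements is constant.\<close>

definition connected_in :: "'p rel \<Rightarrow> 'p set \<Rightarrow> bool" where
  "connected_in P T \<longleftrightarrow> T \<noteq> {} \<and>
     (\<forall>C. (\<forall>x\<in>T. \<forall>y\<in>T. (x, y) \<in> P \<longrightarrow> (x \<in> C \<longleftrightarrow> y \<in> C)) \<longrightarrow> T \<subseteq> C \<or> T \<inter> C = {})"

lemma sectionD:
  assumes "is_section P T M s"
  shows "x \<in> T \<Longrightarrow> s x \<in> sp M x"
    and "x \<in> T \<Longrightarrow> y \<in> T \<Longrightarrow> (x, y) \<in> P \<Longrightarrow> tr M x y (s x) = s y"
  using assms by (auto simp: is_section_def)

lemma cosectionD: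
  assumes "is_cosection P T M l"
  shows "x \<in> T \<Longrightarrow> u \<in> sp M x \<Longrightarrow> v \<in> sp M x \<Longrightarrow> l x (u + v) = l x u + l x v"
    and "x \<in> T \<Longrightarrow> v \<in> sp M x \<Longrightarrow> l x (fscale c v) = c * l x v"
    and "x \<in> T \<Longrightarrow> y \<in> T \<Longrightarrow> (x, y) \<in> P \<Longrightarrow> v \<in> sp M x \<Longrightarrow> l y (tr M x y v) = l x v"
  using assms by (auto simp: is_cosection_def lin_on_def fun_eq_iff)

lemma cosection_diff:
  assumes "is_cosection P T M l" and "x \<in> T" and "fs.subspace (sp M x)"
    and "u \<in> sp M x" and "v \<in> sp M x"
  shows "l x (u - v) = l x u - l x v"
  using lin_on_diff[of "sp M x" UNIV "\<lambda>v (_::unit). l x v"] assms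
  by (auto simp: is_cosection_def fun_eq_iff)

lemma cosection_sum:
  assumes "is_cosection P T M l" and "x \<in> T" and "fs.subspace (sp M x)"
    and "\<And>i. i \<in> A \<Longrightarrow> v i \<in> sp M x"
  shows "l x (\<Sum>i\<in>A. v i) = (\<Sum>i\<in>A. l x (v i))"
proof -
  have "lin_on (sp M x) UNIV (\<lambda>v (_::unit). l x v)"
    using assms(1,2) by (simp add: is_cosection_def)
  from lin_on_sum[OF this assms(3,4)] show ?thesis
    by (simp add: fun_eq_iff sum_fun_apply)
qed

lemma cosection_combination:
  assumes "is_cosection P T M l" and "x \<in> T" and "fs.subspace (sp M x)"
    and "\<And>i. i \<in> A \<Longrightarrow> v i \<in> sp M x"
  shows "l x (\<Sum>i\<in>A. fscale (c i) (v i)) = (\<Sum>i\<in>A. c i * l x (v i))"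
proof -
  have "l x (\<Sum>i\<in>A. fscale (c i) (v i)) = (\<Sum>i\<in>A. l x (fscale (c i) (v i)))"
    by (intro cosection_sum[OF assms(1-3)] fs.subspace_scale[OF assms(3)] assms(4))
  also have "\<dots> = (\<Sum>i\<in>A. c i * l x (v i))"
    by (intro sum.cong refl cosectionD(2)[OF assms(1,2)] assms(4))
  finally show ?thesis .
qed

lemma pairing_constant:
  assumes conn: "connected_in P T" and s: "is_section P T M s" and l: "is_cosection P T M l"
    and x: "x \<in> T" and y: "y \<in> T"
  shows "l x (s x) = l y (s y)"
proof -
  define C where "C = {z. l z (s z) = l x (s x)}"
  have "(a \<in> C \<longleftrightarrow> b \<in> C)" if "a \<in> T" "b \<in> T" "(a, b) \<in> P" for a b
    using cosectionD(3)[OF l that sectionD(1)[OF s]] sectionD(2)[OF s that] that by (simp add: C_def)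
  then have "T \<subseteq> C \<or> T \<inter> C = {}"
    using conn unfolding connected_in_def by blast
  moreover have "x \<in> T \<inter> C" using x by (simp add: C_def)
  ultimately have "y \<in> C" using y by blast
  then show ?thesis by (simp add: C_def)
qed

lemma biorthogonalD:
  assumes "biorthogonal P T M n s l"
  shows "i < n \<Longrightarrow> is_section P T M (s i)" and "i < n \<Longrightarrow> is_cosection P T M (l i)"
    and "i < n \<Longrightarrow> j < n \<Longrightarrow> x \<in> T \<Longrightarrow> l i x (s j x) = (if i = j then 1 else 0)"
  using assms by (auto simp: biorthogonal_def)

lemma section_correction:
  assumes M: "is_module P M" and T: "T \<subseteq> Field P" and u: "is_section P T M u"
    and s: "\<And>i. i \<in> A \<Longrightarrow> is_section P T M (s i)"
  shows "is_section P T M (\<lambda>y. fscale d (u y - (\<Sum>i\<in>A. fscale (a i) (s i y))))"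
  unfolding is_section_def
proof (intro conjI ballI impI)
  have mem: "(\<Sum>i\<in>A. fscale (a i) (s i x)) \<in> sp M x" "u x - (\<Sum>i\<in>A. fscale (a i) (s i x)) \<in> sp M x"
    if x: "x \<in> T" for x
  proof -
    have sub: "fs.subspace (sp M x)" using M T x by (auto intro: is_moduleD(1))
    show *: "(\<Sum>i\<in>A. fscale (a i) (s i x)) \<in> sp M x"
      by (intro fs.subspace_sum[OF sub] fs.subspace_scale[OF sub] sectionD(1)[OF s x])
    show "u x - (\<Sum>i\<in>A. fscale (a i) (s i x)) \<in> sp M x"
      by (rule fs.subspace_diff[OF sub sectionD(1)[OF u x] *])
  qed
  show "fscale d (u x - (\<Sum>i\<in>A. fscale (a i) (s i x))) \<in> sp M x" if x: "x \<in> T" for x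
  proof -
    have sub: "fs.subspace (sp M x)" using M T x by (auto intro: is_moduleD(1))
    show ?thesis by (rule fs.subspace_scale[OF sub mem(2)[OF x]])
  qed
  fix x y assume x: "x \<in> T" and y: "y \<in> T" and xy: "(x, y) \<in> P"
  have sub: "fs.subspace (sp M x)" using M T x by (auto intro: is_moduleD(1))
  note lin = is_moduleD(3)[OF M xy]
  have "tr M x y (\<Sum>i\<in>A. fscale (a i) (s i x)) = (\<Sum>i\<in>A. tr M x y (fscale (a i) (s i x)))"
    by (intro lin_on_sum[OF lin sub] fs.subspace_scale[OF sub] sectionD(1)[OF s x])
  also have "\<dots> = (\<Sum>i\<in>A. fscale (a i) (s i y))"
    by (intro sum.cong refl) (simp add: lin_onD(3)[OF lin] sectionD(1)[OF s x] sectionD(2)[OF s x y xy])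
  finally show "tr M x y (fscale d (u x - (\<Sum>i\<in>A. fscale (a i) (s i x)))) =
      fscale d (u y - (\<Sum>i\<in>A. fscale (a i) (s i y)))"
    by (simp only: lin_onD(3)[OF lin] lin_on_diff[OF lin sub] mem[OF x] sectionD(1)[OF u x]
        sectionD(2)[OF u x y xy])
qed

lemma cosection_correction:
  assumes m: "is_cosection P T M m" and l: "\<And>i. i \<in> A \<Longrightarrow> is_cosection P T M (l i)"
  shows "is_cosection P T M (\<lambda>y v. m y v - (\<Sum>i\<in>A. b i * l i y v))"
  unfolding is_cosection_def
proof (intro conjI ballI impI)
  show "lin_on (sp M x) UNIV (\<lambda>v (_::unit). m x v - (\<Sum>i\<in>A. b i * l i x v))" if x: "x \<in> T" for x
    by (rule lin_onI) (auto simp: fun_eq_iff cosectionD(1,2)[OF m x] cosectionD(1,2)[OF l x]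
        algebra_simps sum.distrib sum_distrib_left)
qed (simp add: cosectionD(3)[OF m] cosectionD(3)[OF l])

text \<open>If some pairing were not reproduced by a biorthogonal system, subtracting the projections
  onto the system from the section and from the cosection would leave a pair that, after rescaling,
  prolongs the system.\<close>

lemma maximal_biorthogonal_expansion:
  assumes M: "is_module P M" and T: "T \<subseteq> Field P" and conn: "connected_in P T"
    and sl: "biorthogonal P T M n s l" and max: "\<not> has_biorthogonal P T M (Suc n)"
    and u: "is_section P T M u" and m: "is_cosection P T M m" and x: "x \<in> T"
  shows "m x (u x) = (\<Sum>i<n. m x (s i x) * l i x (u x))"
proof (rule ccontr)
  assume neq: "m x (u x) \<noteq> (\<Sum>i<n. m x (s i x) * l i x (u x))"
  note s = biorthogonalD(1)[OF sl] and l = biorthogonalD(2)[OF sl] and sl1 = biorthogonalD(3)[OF sl]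
  define d where "d = m x (u x) - (\<Sum>i<n. m x (s i x) * l i x (u x))"
  define u' where "u' y = fscale (1/d) (u y - (\<Sum>i<n. fscale (l i x (u x)) (s i y)))" for y
  define m' where "m' y v = m y v - (\<Sum>i<n. m x (s i x) * l i y v)" for y v
  have d: "d \<noteq> 0" using neq by (simp add: d_def)
  have u': "is_section P T M u'"
    unfolding u'_def by (rule section_correction[OF M T u]) (use s in auto)
  have m': "is_cosection P T M m'"
    unfolding m'_def by (rule cosection_correction[OF m]) (use l in auto)
  have sub: "fs.subspace (sp M x)" using M T x by (auto intro: is_moduleD(1))
  have "(\<Sum>i<n. fscale (l i x (u x)) (s i x)) \<in> sp M x"
    using s by (intro fs.subspace_sum[OF sub] fs.subspace_scale[OF sub]) (auto intro: sectionD(1)[OF _ x])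
  note mem = this fs.subspace_diff[OF sub sectionD(1)[OF u x] this]
  have pair_u': "k x (u' x) = (k x (u x) - (\<Sum>i<n. l i x (u x) * k x (s i x))) / d"
    if k: "is_cosection P T M k" for k
  proof -
    have "k x (\<Sum>i<n. fscale (l i x (u x)) (s i x)) = (\<Sum>i<n. l i x (u x) * k x (s i x))"
      using s by (intro cosection_combination[OF k x sub]) (auto intro: sectionD(1)[OF _ x])
    then show ?thesis
      unfolding u'_def by (simp add: cosectionD(2)[OF k x mem(2)]
          cosection_diff[OF k x sub sectionD(1)[OF u x] mem(1)])
  qed
  have lu': "l j y (u' y) = 0" if "j < n" "y \<in> T" for j y
  proof -
    have "(\<Sum>i<n. l i x (u x) * l j x (s i x)) = (\<Sum>i<n. if i = j then l j x (u x) else 0)"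
      using that(1) by (intro sum.cong) (auto simp: sl1[OF _ _ x])
    then have "l j x (u' x) = 0"
      using that(1) by (simp add: pair_u'[OF l])
    then show ?thesis
      using pairing_constant[OF conn u' l[OF that(1)] x that(2)] by simp
  qed
  have m's: "m' y (s j y) = 0" if "j < n" "y \<in> T" for j y
  proof -
    have "(\<Sum>i<n. m x (s i x) * l i x (s j x)) = (\<Sum>i<n. if i = j then m x (s j x) else 0)"
      using that(1) by (intro sum.cong) (auto simp: sl1[OF _ _ x])
    then have "m' x (s j x) = 0"
      using that(1) by (simp add: m'_def)
    then show ?thesis
      using pairing_constant[OF conn s[OF that(1)] m' x that(2)] by simp
  qed
  have m'u': "m' y (u' y) = 1" if "y \<in> T" for y
  proof -
    have "m' x (u' x) = m x (u' x)"
      by (simp add: m'_def lu'[OF _ x])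
    also have "\<dots> = 1"
      using d by (simp add: pair_u'[OF m] d_def mult.commute)
    finally show ?thesis
      using pairing_constant[OF conn u' m' x that] by simp
  qed
  have "biorthogonal P T M (Suc n) (\<lambda>i. if i < n then s i else u') (\<lambda>i. if i < n then l i else m')"
    unfolding biorthogonal_def
    by (auto simp: s l sl1 u' m' lu' m's m'u' less_Suc_eq)
  with max show False
    unfolding has_biorthogonal_def by blast
qed

lemma has_biorthogonal_0: "has_biorthogonal P T M 0"
  by (simp add: has_biorthogonal_def biorthogonal_def)

text \<open>Expanding the values of the sections at \<open>x\<close> in a generating set of \<open>M\<close> at \<open>x\<close> factors the
  identity matrix through that set.\<close>

lemma has_biorthogonal_bound:
  assumes M: "is_module P M" and T: "T \<subseteq> Field P" and x: "x \<in> T"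
    and B: "finite B" "fs.span B = sp M x" and n: "has_biorthogonal P T M n"
  shows "n \<le> card B"
proof -
  obtain s l where sl: "biorthogonal P T M n s l"
    using n by (auto simp: has_biorthogonal_def)
  have sub: "fs.subspace (sp M x)" using M T x by (auto intro: is_moduleD(1))
  have B': "b \<in> sp M x" if "b \<in> B" for b
    using that B(2) fs.span_base by blast
  have "\<exists>c. s q x = (\<Sum>b\<in>B. fscale (c b) b)" if "q < n" for q
  proof -
    have "s q x \<in> range (\<lambda>c. \<Sum>b\<in>B. fscale (c b) b)"
      using sectionD(1)[OF biorthogonalD(1)[OF sl that] x]
      by (simp only: B(2)[symmetric] fs.span_finite[OF B(1)])
    then show ?thesis by blast
  qed
  then obtain c where c: "\<And>q. q < n \<Longrightarrow> s q x = (\<Sum>b\<in>B. fscale (c q b) b)"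
    by metis
  show ?thesis
  proof (rule identity_factorization_bound[OF B(1), of n "\<lambda>p b. l p x b" "\<lambda>b q. c q b"])
    fix p q assume p: "p < n" and q: "q < n"
    have "(\<Sum>b\<in>B. c q b * l p x b) = l p x (s q x)"
      unfolding c[OF q]
      by (rule cosection_combination[OF biorthogonalD(2)[OF sl p] x sub B', symmetric])
    then show "(\<Sum>b\<in>B. l p x b * c q b) = (if p = q then 1 else 0)"
      by (simp add: biorthogonalD(3)[OF sl p q x] mult.commute)
  qed
qed

lemma has_biorthogonal_generalized_rank:
  assumes "is_module P M" and "T \<subseteq> Field P" and "T \<noteq> {}"
  shows "has_biorthogonal P T M (generalized_rank P T M)"
    and "has_biorthogonal P T M n \<Longrightarrow> n \<le> generalized_rank P T M"
proof -
  obtain x where x: "x \<in> T" using assms(3) by blast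
  obtain B where B: "finite B" "fs.span B = sp M x"
    using is_moduleD(2)[OF assms(1)] x assms(2) by blast
  note bound = has_biorthogonal_bound[OF assms(1,2) x B]
  show "has_biorthogonal P T M (generalized_rank P T M)"
    unfolding generalized_rank_def
    by (rule GreatestI_nat[where P = "has_biorthogonal P T M", OF has_biorthogonal_0 bound])
  show "has_biorthogonal P T M n \<Longrightarrow> n \<le> generalized_rank P T M"
    unfolding generalized_rank_def
    by (rule Greatest_le_nat[where P = "has_biorthogonal P T M", OF _ bound])
qed

lemma sections_direct_sum:
  assumes M: "is_module P M" and N: "is_module P N" and T: "T \<subseteq> Field P"
  shows "is_section P T M s \<Longrightarrow> is_section P T (direct_sum M N) (\<lambda>x. case_sum (s x) 0)"
    and "is_section P T N t \<Longrightarrow> is_section P T (direct_sum M N) (\<lambda>x. case_sum 0 (t x))"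
    and "is_section P T (direct_sum M N) u \<Longrightarrow> is_section P T M (\<lambda>x. u x \<circ> Inl)"
    and "is_section P T (direct_sum M N) u \<Longrightarrow> is_section P T N (\<lambda>x. u x \<circ> Inr)"
proof -
  have 0: "0 \<in> sp M x" "0 \<in> sp N x" if "x \<in> T" for x
    using that T fs.subspace_0[OF is_moduleD(1)[OF M]] fs.subspace_0[OF is_moduleD(1)[OF N]] by auto
  have tr0: "tr M x y 0 = 0" "tr N x y 0 = 0" if "(x, y) \<in> P" for x y
    using lin_on_zero[OF is_moduleD(3,1)[OF M]] lin_on_zero[OF is_moduleD(3,1)[OF N]] that
    by (auto simp: FieldI1)
  show "is_section P T M s \<Longrightarrow> is_section P T (direct_sum M N) (\<lambda>x. case_sum (s x) 0)"
    by (auto simp: is_section_def mem_direct_sum 0 tr0 intro!: sum_fun_eqI)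
  show "is_section P T N t \<Longrightarrow> is_section P T (direct_sum M N) (\<lambda>x. case_sum 0 (t x))"
    by (auto simp: is_section_def mem_direct_sum 0 tr0 intro!: sum_fun_eqI)
  show "is_section P T (direct_sum M N) u \<Longrightarrow> is_section P T M (\<lambda>x. u x \<circ> Inl)"
    by (auto simp: is_section_def mem_direct_sum) (metis tr_direct_sum(1))
  show "is_section P T (direct_sum M N) u \<Longrightarrow> is_section P T N (\<lambda>x. u x \<circ> Inr)"
    by (auto simp: is_section_def mem_direct_sum) (metis tr_direct_sum(2))
qed

lemma cosections_direct_sum:
  assumes M: "is_module P M" and N: "is_module P N" and T: "T \<subseteq> Field P"
  shows "is_cosection P T M l \<Longrightarrow> is_cosection P T (direct_sum M N) (\<lambda>x w. l x (w \<circ> Inl))"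
    and "is_cosection P T N k \<Longrightarrow> is_cosection P T (direct_sum M N) (\<lambda>x w. k x (w \<circ> Inr))"
    and "is_cosection P T (direct_sum M N) m \<Longrightarrow> is_cosection P T M (\<lambda>x v. m x (case_sum v 0))"
    and "is_cosection P T (direct_sum M N) m \<Longrightarrow> is_cosection P T N (\<lambda>x v. m x (case_sum 0 v))"
    and "is_cosection P T (direct_sum M N) m \<Longrightarrow> x \<in> T \<Longrightarrow> w \<in> sp (direct_sum M N) x \<Longrightarrow>
           m x w = m x (case_sum (w \<circ> Inl) 0) + m x (case_sum 0 (w \<circ> Inr))"
proof -
  have 0: "0 \<in> sp M x" "0 \<in> sp N x" if "x \<in> T" for x
    using that T fs.subspace_0[OF is_moduleD(1)[OF M]] fs.subspace_0[OF is_moduleD(1)[OF N]] by auto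
  have tr0: "tr M x y 0 = 0" "tr N x y 0 = 0" if "(x, y) \<in> P" for x y
    using lin_on_zero[OF is_moduleD(3,1)[OF M]] lin_on_zero[OF is_moduleD(3,1)[OF N]] that
    by (auto simp: FieldI1)
  show "is_cosection P T M l \<Longrightarrow> is_cosection P T (direct_sum M N) (\<lambda>x w. l x (w \<circ> Inl))"
    by (auto simp: is_cosection_def mem_direct_sum lin_on_def)
  show "is_cosection P T N k \<Longrightarrow> is_cosection P T (direct_sum M N) (\<lambda>x w. k x (w \<circ> Inr))"
    by (auto simp: is_cosection_def mem_direct_sum lin_on_def)
  {
    assume m: "is_cosection P T (direct_sum M N) m"
    have add: "case_sum (u + v) 0 = case_sum u 0 + (case_sum v 0 :: 'b + 'd \<Rightarrow> 'c)"
      "case_sum 0 (u' + v') = case_sum 0 u' + (case_sum 0 v' :: 'b + 'd \<Rightarrow> 'c)"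
      "case_sum (fscale c u) 0 = fscale c (case_sum u 0 :: 'b + 'd \<Rightarrow> 'c)"
      "case_sum 0 (fscale c u') = fscale c (case_sum 0 u' :: 'b + 'd \<Rightarrow> 'c)"
      for u v :: "'b \<Rightarrow> 'c" and u' v' :: "'d \<Rightarrow> 'c" and c
      by (auto intro!: sum_fun_eqI)
    have trl: "tr (direct_sum M N) x y (case_sum v 0) = case_sum (tr M x y v) 0"
      "tr (direct_sum M N) x y (case_sum 0 v') = case_sum 0 (tr N x y v')" if "(x, y) \<in> P" for x y v v'
      using tr0[OF that] by (auto intro!: sum_fun_eqI)
    have mem: "case_sum v 0 \<in> sp (direct_sum M N) x" "case_sum 0 v' \<in> sp (direct_sum M N) x"
      if "x \<in> T" "v \<in> sp M x" "v' \<in> sp N x" for x v v'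
      using that 0 by (auto simp: mem_direct_sum)
    show "is_cosection P T M (\<lambda>x v. m x (case_sum v 0))"
      unfolding is_cosection_def
    proof (intro conjI ballI impI)
      show "lin_on (sp M x) UNIV (\<lambda>v (_::unit). m x (case_sum v 0))" if x: "x \<in> T" for x
        by (rule lin_onI) (auto simp: add cosectionD(1,2)[OF m x] mem[OF x _ 0(2)[OF x]] fun_eq_iff)
      show "m y (case_sum (tr M x y v) 0) = m x (case_sum v 0)"
        if "x \<in> T" "y \<in> T" "(x, y) \<in> P" "v \<in> sp M x" for x y v
        using cosectionD(3)[OF m that(1-3) mem(1)[OF that(1,4) 0(2)[OF that(1)]]] trl[OF that(3)] by simp
    qed
    show "is_cosection P T N (\<lambda>x v. m x (case_sum 0 v))"
      unfolding is_cosection_def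
    proof (intro conjI ballI impI)
      show "lin_on (sp N x) UNIV (\<lambda>v (_::unit). m x (case_sum 0 v))" if x: "x \<in> T" for x
        by (rule lin_onI) (auto simp: add cosectionD(1,2)[OF m x] mem[OF x 0(1)[OF x]] fun_eq_iff)
      show "m y (case_sum 0 (tr N x y v)) = m x (case_sum 0 v)"
        if "x \<in> T" "y \<in> T" "(x, y) \<in> P" "v \<in> sp N x" for x y v
        using cosectionD(3)[OF m that(1-3) mem(2)[OF that(1) 0(1)[OF that(1)] that(4)]] trl[OF that(3)] by simp
    qed
    show "m x w = m x (case_sum (w \<circ> Inl) 0) + m x (case_sum 0 (w \<circ> Inr))"
      if x: "x \<in> T" and w: "w \<in> sp (direct_sum M N) x"
    proof -
      have "w = case_sum (w \<circ> Inl) 0 + case_sum 0 (w \<circ> Inr)"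
        by (rule sum_fun_eqI) auto
      then have "m x w = m x (case_sum (w \<circ> Inl) 0 + case_sum 0 (w \<circ> Inr))" by (rule arg_cong)
      also have "\<dots> = m x (case_sum (w \<circ> Inl) 0) + m x (case_sum 0 (w \<circ> Inr))"
        using w by (intro cosectionD(1)[OF m x] mem[OF x]) (auto simp: mem_direct_sum)
      finally show ?thesis .
    qed
  }
qed

text \<open>For the upper bound, each pairing over \<open>M \<oplus> N\<close> splits into a pairing over \<open>M\<close> and one over
  \<open>N\<close>, and these factor through maximal biorthogonal systems of \<open>M\<close> and \<open>N\<close>. So the identity matrix
  of a biorthogonal system over \<open>M \<oplus> N\<close> factors through the disjoint union of the two index sets.\<close>

lemma generalized_rank_direct_sum:
  assumes M: "is_module P M" and N: "is_module P N" and T: "T \<subseteq> Field P" and conn: "connected_in P T"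
  shows "generalized_rank P T (direct_sum M N) = generalized_rank P T M + generalized_rank P T N"
proof (rule antisym)
  have ne: "T \<noteq> {}" using conn by (simp add: connected_in_def)
  then obtain x where x: "x \<in> T" by blast
  note D = is_module_direct_sum[OF M N]
  let ?a = "generalized_rank P T M" and ?b = "generalized_rank P T N"
  let ?m = "generalized_rank P T (direct_sum M N)"
  obtain s l where sl: "biorthogonal P T M ?a s l"
    using has_biorthogonal_generalized_rank(1)[OF M T ne] by (auto simp: has_biorthogonal_def)
  obtain t k where tk: "biorthogonal P T N ?b t k"
    using has_biorthogonal_generalized_rank(1)[OF N T ne] by (auto simp: has_biorthogonal_def)
  obtain u m where um: "biorthogonal P T (direct_sum M N) ?m u m"
    using has_biorthogonal_generalized_rank(1)[OF D T ne] by (auto simp: has_biorthogonal_def)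
  have maxM: "\<not> has_biorthogonal P T M (Suc ?a)"
    using has_biorthogonal_generalized_rank(2)[OF M T ne] by fastforce
  have maxN: "\<not> has_biorthogonal P T N (Suc ?b)"
    using has_biorthogonal_generalized_rank(2)[OF N T ne] by fastforce

  have "?m \<le> card ({..<?a} <+> {..<?b})"
  proof (rule identity_factorization_bound)
    fix p q assume p: "p < ?m" and q: "q < ?m"
    note up = biorthogonalD(1)[OF um q] and mp = biorthogonalD(2)[OF um p]
    have "(if p = q then 1 else 0) = m p x (u q x)"
      by (simp add: biorthogonalD(3)[OF um p q x])
    also have "\<dots> = m p x (case_sum (u q x \<circ> Inl) 0) + m p x (case_sum 0 (u q x \<circ> Inr))"
      by (rule cosections_direct_sum(5)[OF M N T mp x sectionD(1)[OF up x]])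
    also have "m p x (case_sum (u q x \<circ> Inl) 0) =
        (\<Sum>i<?a. m p x (case_sum (s i x) 0) * l i x (u q x \<circ> Inl))"
      by (rule maximal_biorthogonal_expansion[OF M T conn sl maxM
            sections_direct_sum(3)[OF M N T up] cosections_direct_sum(3)[OF M N T mp] x])
    also have "m p x (case_sum 0 (u q x \<circ> Inr)) =
        (\<Sum>i<?b. m p x (case_sum 0 (t i x)) * k i x (u q x \<circ> Inr))"
      by (rule maximal_biorthogonal_expansion[OF N T conn tk maxN
            sections_direct_sum(4)[OF M N T up] cosections_direct_sum(4)[OF M N T mp] x])
    finally show "(\<Sum>i\<in>{..<?a} <+> {..<?b}.
        case_sum (\<lambda>i. m p x (case_sum (s i x) 0)) (\<lambda>i. m p x (case_sum 0 (t i x))) i *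
        case_sum (\<lambda>i. l i x (u q x \<circ> Inl)) (\<lambda>i. k i x (u q x \<circ> Inr)) i) = (if p = q then 1 else 0)"
      by (simp only: sum.Plus finite_lessThan o_def sum.case)
  qed simp
  then show "?m \<le> ?a + ?b"
    by (simp add: card_Plus)

  have "biorthogonal P T (direct_sum M N) (?a + ?b)
      (\<lambda>i x. if i < ?a then case_sum (s i x) 0 else case_sum 0 (t (i - ?a) x))
      (\<lambda>i x w. if i < ?a then l i x (w \<circ> Inl) else k (i - ?a) x (w \<circ> Inr))"
    unfolding biorthogonal_def
  proof (intro conjI allI impI ballI)
    fix i assume i: "i < ?a + ?b"
    show "is_section P T (direct_sum M N) (\<lambda>x. if i < ?a then case_sum (s i x) 0 else case_sum 0 (t (i - ?a) x))"
      using i sections_direct_sum(1,2)[OF M N T] biorthogonalD(1)[OF sl] biorthogonalD(1)[OF tk]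
      by (cases "i < ?a") auto
    show "is_cosection P T (direct_sum M N) (\<lambda>x w. if i < ?a then l i x (w \<circ> Inl) else k (i - ?a) x (w \<circ> Inr))"
      using i cosections_direct_sum(1,2)[OF M N T] biorthogonalD(2)[OF sl] biorthogonalD(2)[OF tk]
      by (cases "i < ?a") auto
    fix j y assume j: "j < ?a + ?b" and y: "y \<in> T"
    have zero: "l i y 0 = 0" if "i < ?a" for i
      using cosectionD(2)[OF biorthogonalD(2)[OF sl that] y, of 0 0] fs.subspace_0[OF is_moduleD(1)[OF M]] y T
      by auto
    have zero': "k i y 0 = 0" if "i < ?b" for i
      using cosectionD(2)[OF biorthogonalD(2)[OF tk that] y, of 0 0] fs.subspace_0[OF is_moduleD(1)[OF N]] y T
      by auto
    show "(if i < ?a then l i y ((if j < ?a then case_sum (s j y) 0 else case_sum 0 (t (j - ?a) y)) \<circ> Inl)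
        else k (i - ?a) y ((if j < ?a then case_sum (s j y) 0 else case_sum 0 (t (j - ?a) y)) \<circ> Inr))
        = (if i = j then 1 else 0)"
      using i j y biorthogonalD(3)[OF sl] biorthogonalD(3)[OF tk] zero zero'
      by (cases "i < ?a"; cases "j < ?a") auto
  qed
  then show "?a + ?b \<le> ?m"
    by (intro has_biorthogonal_generalized_rank(2)[OF D T ne]) (auto simp: has_biorthogonal_def)
qed

lemma has_biorthogonal_iso:
  assumes M: "is_module P M" and T: "T \<subseteq> Field P" and iso: "isomorphic P M N"
    and n: "has_biorthogonal P T N n"
  shows "has_biorthogonal P T M n"
proof -
  obtain \<phi> where \<phi>: "\<phi> \<in> Hom P M N" "\<And>x. x \<in> Field P \<Longrightarrow> bij_betw (\<phi> x) (sp M x) (sp N x)"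
    using iso by (rule isomorphicE) blast
  obtain s l where sl: "biorthogonal P T N n s l"
    using n by (auto simp: has_biorthogonal_def)
  define s' where "s' i x = inv_into (sp M x) (\<phi> x) (s i x)" for i x
  define l' where "l' i x v = l i x (\<phi> x v)" for i x v
  have s': "s' i x \<in> sp M x" "\<phi> x (s' i x) = s i x" if "i < n" "x \<in> T" for i x
  proof -
    have "s i x \<in> \<phi> x ` sp M x"
      using \<phi>(2)[of x] that T sectionD(1)[OF biorthogonalD(1)[OF sl]] by (auto simp: bij_betw_def)
    then show "s' i x \<in> sp M x" "\<phi> x (s' i x) = s i x"
      unfolding s'_def by (rule inv_into_into, rule f_inv_into_f)
  qed
  have "is_section P T M (s' i)" if i: "i < n" for i
    unfolding is_section_def
  proof (intro conjI ballI impI s'(1)[OF i])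
    fix x y assume x: "x \<in> T" and y: "y \<in> T" and xy: "(x, y) \<in> P"
    have "\<phi> y (tr M x y (s' i x)) = \<phi> y (s' i y)"
      using HomD(2)[OF \<phi>(1) xy s'(1)[OF i x]] sectionD(2)[OF biorthogonalD(1)[OF sl i] x y xy]
      by (simp add: s'[OF i x] s'[OF i y])
    moreover have "inj_on (\<phi> y) (sp M y)"
      using \<phi>(2) y T by (auto simp: bij_betw_def)
    ultimately show "tr M x y (s' i x) = s' i y"
      using is_moduleD(6)[OF M xy s'(1)[OF i x]] s'(1)[OF i y] by (meson inj_onD)
  qed
  moreover have "is_cosection P T M (l' i)" if i: "i < n" for i
    unfolding is_cosection_def
  proof (intro conjI ballI impI)
    show "lin_on (sp M x) UNIV (\<lambda>v (_::unit). l' i x v)" if x: "x \<in> T" for x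
    proof -
      have "lin_on (sp N x) UNIV (\<lambda>v (_::unit). l i x v)"
        using biorthogonalD(2)[OF sl i] x by (simp add: is_cosection_def)
      moreover have "lin_on (sp M x) (sp N x) (\<phi> x)"
        using HomD(1)[OF \<phi>(1)] x T by blast
      ultimately show ?thesis
        unfolding l'_def using lin_on_comp by fast
    qed
    show "l' i y (tr M x y v) = l' i x v" if "x \<in> T" "y \<in> T" "(x, y) \<in> P" "v \<in> sp M x" for x y v
      using cosectionD(3)[OF biorthogonalD(2)[OF sl i] that(1-3)] HomD(2,3)[OF \<phi>(1)] that T
      by (auto simp: l'_def)
  qed
  ultimately have "biorthogonal P T M n s' l'"
    using biorthogonalD(3)[OF sl] s'(2) by (auto simp: biorthogonal_def l'_def)
  then show ?thesis
    by (auto simp: has_biorthogonal_def)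
qed

lemma generalized_rank_iso:
  assumes "is_module P M" and "is_module P N" and "T \<subseteq> Field P" and "isomorphic P M N"
  shows "generalized_rank P T M = generalized_rank P T N"
  using has_biorthogonal_iso[OF assms(1,3,4)]
    has_biorthogonal_iso[OF assms(2,3) isomorphic_sym[OF assms(1,2,4)]]
  unfolding generalized_rank_def by metis

section \<open>Multiplicities of constant modules\<close>

lemma mem_direct_power_interval:
  "x \<in> S \<Longrightarrow> w \<in> sp (direct_power n (interval_module S)) x \<longleftrightarrow> (\<forall>m\<ge>n. w (m, ()) = 0)"
  by (auto simp: direct_power_def interval_module_def fun_eq_iff not_less)

lemma tr_direct_power_interval:
  "x \<in> S \<Longrightarrow> y \<in> S \<Longrightarrow> tr (direct_power n (interval_module S)) x y w (m, i) = (if m < n then w (m, ()) else 0)"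
  by (simp add: direct_power_def interval_module_def)

lemma summand_imp_has_biorthogonal:
  assumes M: "is_module X M" and N: "is_module X N"
    and iso: "isomorphic X M (direct_sum (direct_power n (interval_module (Field X))) N)"
  shows "has_biorthogonal X (Field X) M n"
proof (rule has_biorthogonal_iso[OF M order_refl iso])
  let ?D = "direct_sum (direct_power n (interval_module (Field X))) N"
  define s :: "nat \<Rightarrow> 'a \<Rightarrow> ((nat \<times> unit) + 'd \<Rightarrow> 'c)" where
    "s i x = case_sum (\<lambda>(m, _). if m = i then 1 else 0) 0" for i x
  define l :: "nat \<Rightarrow> 'a \<Rightarrow> ((nat \<times> unit) + 'd \<Rightarrow> 'c) \<Rightarrow> 'c" where
    "l i x w = w (Inl (i, ()))" for i x w
  have "is_section X (Field X) ?D (s i)" if i: "i < n" for i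
    unfolding is_section_def
  proof (intro conjI ballI impI)
    show "s i x \<in> sp ?D x" if "x \<in> Field X" for x
      using that i fs.subspace_0[OF is_moduleD(1)[OF N that]]
      by (simp add: mem_direct_sum mem_direct_power_interval s_def)
    fix x y assume "x \<in> Field X" "y \<in> Field X" and xy: "(x, y) \<in> X"
    show "tr ?D x y (s i x) = s i y"
    proof (rule sum_fun_eqI)
      show "tr ?D x y (s i x) \<circ> Inl = s i y \<circ> Inl"
        using i \<open>x \<in> Field X\<close> \<open>y \<in> Field X\<close>
        by (auto simp: fun_eq_iff tr_direct_power_interval s_def)
      show "tr ?D x y (s i x) \<circ> Inr = s i y \<circ> Inr"
        using lin_on_zero[OF is_moduleD(3)[OF N xy] is_moduleD(1)[OF N \<open>x \<in> Field X\<close>]]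
        by (simp add: s_def)
    qed
  qed
  moreover have "is_cosection X (Field X) ?D (l i)" if i: "i < n" for i
    unfolding is_cosection_def
  proof (intro conjI ballI impI)
    show "lin_on (sp ?D x) UNIV (\<lambda>v (_::unit). l i x v)" for x
      by (rule lin_onI) (auto simp: l_def)
    fix x y v assume "x \<in> Field X" "y \<in> Field X"
    then have "(tr ?D x y v \<circ> Inl) (i, ()) = (v \<circ> Inl) (i, ())"
      using i by (simp only: tr_direct_sum tr_direct_power_interval if_True)
    then show "l i y (tr ?D x y v) = l i x v"
      by (simp only: l_def o_apply)
  qed
  ultimately have "biorthogonal X (Field X) ?D n s l"
    by (auto simp: biorthogonal_def s_def l_def)
  then show "has_biorthogonal X (Field X) ?D n"
    by (auto simp: has_biorthogonal_def)
qed

text \<open>The cosections of a biorthogonal system of size \<open>n\<close> map \<open>M\<close> onto \<open>n\<close> copies of the constant module,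
  the sections split this surjection, and its kernel is the complementary summand.\<close>

lemma has_biorthogonal_imp_summand:
  fixes M :: "('x, 'i, 'k::field) rep"
  assumes M: "is_module X M" and n: "has_biorthogonal X (Field X) M n"
  shows "\<exists>N :: ('x, 'i, 'k) rep. is_module X N \<and>
           isomorphic X M (direct_sum (direct_power n (interval_module (Field X))) N)"
proof -
  obtain s l where sl: "biorthogonal X (Field X) M n s l"
    using n by (auto simp: has_biorthogonal_def)
  note s = biorthogonalD(1)[OF sl] and l = biorthogonalD(2)[OF sl] and sl1 = biorthogonalD(3)[OF sl]
  note sub = is_moduleD(1)[OF M]
  define N where "N = \<lparr>sp = (\<lambda>x. {v \<in> sp M x. \<forall>i<n. l i x v = 0}), tr = tr M\<rparr>"
  have memN: "v \<in> sp N x \<longleftrightarrow> v \<in> sp M x \<and> (\<forall>i<n. l i x v = 0)" for v x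
    by (simp add: N_def)
  have trN: "tr N = tr M" by (simp add: N_def)
  have l0: "l i x 0 = 0" if "i < n" "x \<in> Field X" for i x
    using cosectionD(2)[OF l[OF that(1)] that(2) fs.subspace_0[OF sub[OF that(2)]], of 0] by simp
  have N: "is_module X N"
  proof (rule is_moduleI)
    fix x assume x: "x \<in> Field X"
    show sN: "fs.subspace (sp N x)"
    proof (rule fs.subspaceI)
      show "0 \<in> sp N x"
        using l0 x fs.subspace_0[OF sub[OF x]] by (simp add: memN)
      show "u + v \<in> sp N x" if "u \<in> sp N x" "v \<in> sp N x" for u v
        using that cosectionD(1)[OF l x] fs.subspace_add[OF sub[OF x]] by (auto simp: memN)
      show "fscale c u \<in> sp N x" if "u \<in> sp N x" for c u
        using that cosectionD(2)[OF l x] fs.subspace_scale[OF sub[OF x]] by (auto simp: memN)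
    qed
    obtain B where B: "finite B" "fs.span B = sp M x"
      using is_moduleD(2)[OF M x] by (elim exE conjE)
    show "\<exists>B. finite B \<and> fs.span B = sp N x"
      by (rule finitely_generated_subspace[OF sN _ B(1)]) (auto simp: B(2) memN)
  next
    fix x y assume xy: "(x, y) \<in> X"
    have xy': "x \<in> Field X" "y \<in> Field X" using xy by (auto simp: FieldI1 FieldI2)
    note lin = is_moduleD(3)[OF M xy]
    show "lin_on (sp N x) (sp N y) (tr N x y)"
      unfolding trN
    proof (rule lin_onI)
      show "tr M x y v \<in> sp N y" if "v \<in> sp N x" for v
        using that cosectionD(3)[OF l xy' xy] lin_onD(1)[OF lin] by (auto simp: memN)
      show "tr M x y (u + v) = tr M x y u + tr M x y v" if "u \<in> sp N x" "v \<in> sp N x" for u v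
        by (rule lin_onD(2)[OF lin]) (use that in \<open>auto simp: memN\<close>)
      show "tr M x y (fscale c v) = fscale c (tr M x y v)" if "v \<in> sp N x" for c v
        by (rule lin_onD(3)[OF lin]) (use that in \<open>auto simp: memN\<close>)
    qed
  qed (simp_all add: trN memN is_moduleD(4,5)[OF M])

  let ?D = "direct_sum (direct_power n (interval_module (Field X))) N"
  define \<pi> where "\<pi> x v = (\<Sum>i<n. fscale (l i x v) (s i x))" for x v
  define \<phi> :: "'x \<Rightarrow> ('i \<Rightarrow> 'k) \<Rightarrow> ((nat \<times> unit) + 'i \<Rightarrow> 'k)" where
    "\<phi> x v = case_sum (\<lambda>(m, _). if m < n then l m x v else 0) (v - \<pi> x v)" for x v
  define \<psi> :: "'x \<Rightarrow> ((nat \<times> unit) + 'i \<Rightarrow> 'k) \<Rightarrow> ('i \<Rightarrow> 'k)" where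
    "\<psi> x w = (w \<circ> Inr) + (\<Sum>i<n. fscale (w (Inl (i, ()))) (s i x))" for x w
  have smem: "s i x \<in> sp M x" if "i < n" "x \<in> Field X" for i x
    by (rule sectionD(1)[OF s[OF that(1)] that(2)])
  have comb: "(\<Sum>i<n. fscale (c i) (s i x)) \<in> sp M x"
    and lcomb: "j < n \<Longrightarrow> l j x (\<Sum>i<n. fscale (c i) (s i x)) = c j" if x: "x \<in> Field X" for c x j
  proof -
    show "(\<Sum>i<n. fscale (c i) (s i x)) \<in> sp M x"
      by (intro fs.subspace_sum[OF sub[OF x]] fs.subspace_scale[OF sub[OF x]] smem x) simp
    assume j: "j < n"
    have "l j x (\<Sum>i<n. fscale (c i) (s i x)) = (\<Sum>i<n. c i * l j x (s i x))"
      by (rule cosection_combination[OF l[OF j] x sub[OF x]]) (simp add: smem x)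
    also have "\<dots> = (\<Sum>i<n. if i = j then c j else 0)"
      by (intro sum.cong) (auto simp: sl1[OF j _ x])
    finally show "l j x (\<Sum>i<n. fscale (c i) (s i x)) = c j"
      using j by simp
  qed
  have \<pi>: "\<pi> x v \<in> sp M x" "v - \<pi> x v \<in> sp N x" if "x \<in> Field X" "v \<in> sp M x" for x v
  proof -
    show *: "\<pi> x v \<in> sp M x"
      unfolding \<pi>_def by (rule comb[OF that(1)])
    show "v - \<pi> x v \<in> sp N x"
      unfolding memN using that *
      by (auto simp: cosection_diff[OF l _ sub] fs.subspace_diff[OF sub]) (simp add: \<pi>_def lcomb)
  qed
  have \<phi>mem: "\<phi> x v \<in> sp ?D x" if "x \<in> Field X" "v \<in> sp M x" for x v
    using that \<pi> by (auto simp: mem_direct_sum mem_direct_power_interval \<phi>_def)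
  have "isomorphic X M ?D"
  proof (rule isomorphicI[OF M])
    fix x assume x: "x \<in> Field X"
    show "lin_on (sp M x) (sp ?D x) (\<phi> x)"
    proof (rule lin_onI)
      show "\<phi> x v \<in> sp ?D x" if "v \<in> sp M x" for v
        by (rule \<phi>mem[OF x that])
      show "\<phi> x (u + v) = \<phi> x u + \<phi> x v" if "u \<in> sp M x" "v \<in> sp M x" for u v
      proof -
        have "\<pi> x (u + v) = \<pi> x u + \<pi> x v"
          unfolding \<pi>_def sum.distrib[symmetric]
          by (intro sum.cong) (simp_all add: cosectionD(1)[OF l x that] fs.scale_left_distrib)
        then show ?thesis
          by (intro sum_fun_eqI) (auto simp: \<phi>_def fun_eq_iff cosectionD(1)[OF l x that] algebra_simps)
      qed
      show "\<phi> x (fscale c v) = fscale c (\<phi> x v)" if "v \<in> sp M x" for c v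
      proof -
        have "\<pi> x (fscale c v) = fscale c (\<pi> x v)"
          unfolding \<pi>_def fs.scale_sum_right
          by (intro sum.cong) (simp_all add: cosectionD(2)[OF l x that])
        then show ?thesis
          by (intro sum_fun_eqI) (auto simp: \<phi>_def fun_eq_iff cosectionD(2)[OF l x that] algebra_simps)
      qed
    qed
    show "bij_betw (\<phi> x) (sp M x) (sp ?D x)"
    proof (rule bij_betw_byWitness[of _ "\<psi> x"])
      show "\<forall>v\<in>sp M x. \<psi> x (\<phi> x v) = v"
        by (auto simp: \<psi>_def \<phi>_def \<pi>_def)
      show "\<phi> x ` sp M x \<subseteq> sp ?D x"
        using \<phi>mem[OF x] by blast
      have r: "w \<circ> Inr \<in> sp M x" "\<And>j. j < n \<Longrightarrow> l j x (w \<circ> Inr) = 0" "\<And>m. m \<ge> n \<Longrightarrow> w (Inl (m, ())) = 0"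
        if "w \<in> sp ?D x" for w
        using that x by (auto simp: mem_direct_sum memN mem_direct_power_interval)
      show mem: "\<psi> x ` sp ?D x \<subseteq> sp M x"
        using r(1) comb[OF x] fs.subspace_add[OF sub[OF x]] by (auto simp: \<psi>_def)
      show "\<forall>w\<in>sp ?D x. \<phi> x (\<psi> x w) = w"
      proof
        fix w assume w: "w \<in> sp ?D x"
        have lw: "l j x (\<psi> x w) = w (Inl (j, ()))" if "j < n" for j
          unfolding \<psi>_def using cosectionD(1)[OF l[OF that] x r(1)[OF w] comb[OF x]] r(2)[OF w that]
          by (simp add: lcomb[OF x that])
        show "\<phi> x (\<psi> x w) = w"
        proof (rule sum_fun_eqI)
          show "\<phi> x (\<psi> x w) \<circ> Inl = w \<circ> Inl"
            using r(3)[OF w] by (auto simp: \<phi>_def fun_eq_iff lw)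
          have "\<pi> x (\<psi> x w) = (\<Sum>i<n. fscale (w (Inl (i, ()))) (s i x))"
            by (auto simp: \<pi>_def lw intro!: sum.cong)
          then show "\<phi> x (\<psi> x w) \<circ> Inr = w \<circ> Inr"
            by (simp add: \<phi>_def \<psi>_def)
        qed
      qed
    qed
  next
    fix x y v assume xy: "(x, y) \<in> X" and v: "v \<in> sp M x"
    have x: "x \<in> Field X" and y: "y \<in> Field X" using xy by (auto simp: FieldI1 FieldI2)
    note lin = is_moduleD(3)[OF M xy]
    note lv = cosectionD(3)[OF l x y xy v]
    show "\<phi> y (tr M x y v) = tr ?D x y (\<phi> x v)"
    proof (rule sum_fun_eqI)
      show "\<phi> y (tr M x y v) \<circ> Inl = tr ?D x y (\<phi> x v) \<circ> Inl"
        unfolding tr_direct_sum by (auto simp: fun_eq_iff tr_direct_power_interval x y \<phi>_def lv)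
      have "tr M x y (\<pi> x v) = (\<Sum>i<n. tr M x y (fscale (l i x v) (s i x)))"
        unfolding \<pi>_def by (rule lin_on_sum[OF lin sub[OF x]]) (simp add: fs.subspace_scale[OF sub[OF x]] smem x)
      also have "\<dots> = \<pi> y (tr M x y v)"
        unfolding \<pi>_def
        by (intro sum.cong) (simp_all add: lv lin_onD(3)[OF lin] smem x sectionD(2)[OF s x y xy])
      finally have "tr M x y (v - \<pi> x v) = tr M x y v - \<pi> y (tr M x y v)"
        by (simp only: lin_on_diff[OF lin sub[OF x] v \<pi>(1)[OF x v]])
      then show "\<phi> y (tr M x y v) \<circ> Inr = tr ?D x y (\<phi> x v) \<circ> Inr"
        by (simp add: \<phi>_def trN)
    qed
  qed
  with N show ?thesis by blast
qed

lemma multiplicity_interval_eq_generalized_rank: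
  fixes M :: "('x, nat, 'k::field) rep"
  assumes "is_module X M"
  shows "multiplicity_in X (interval_module (Field X) :: ('x, unit, 'k) rep) M =
    generalized_rank X (Field X) M"
  unfolding multiplicity_in_def generalized_rank_def
  using summand_imp_has_biorthogonal[OF assms] has_biorthogonal_imp_summand[OF assms]
  by (intro arg_cong[where f = Greatest] ext) blast

lemma order_embeddingD:
  assumes "f \<in> order_embeddings X P"
  shows "x \<in> Field X \<Longrightarrow> f x \<in> Field P"
    and "x \<in> Field X \<Longrightarrow> y \<in> Field X \<Longrightarrow> (f x, f y) \<in> P \<longleftrightarrow> (x, y) \<in> X"
    and "f ` Field X \<subseteq> Field P"
  using assms by (auto simp: order_embeddings_def)

lemma order_embedding_inj_on:
  assumes "Partial_order X" and "Partial_order P" and f: "f \<in> order_embeddings X P"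
  shows "inj_on f (Field X)"
proof (rule inj_onI)
  fix x y assume x: "x \<in> Field X" and y: "y \<in> Field X" and eq: "f x = f y"
  have "(f x, f y) \<in> P" "(f y, f x) \<in> P"
    using eq order_embeddingD(1)[OF f x] assms(2)
    by (auto simp: partial_order_on_def preorder_on_def refl_on_def)
  then show "x = y"
    using assms(1) x y unfolding order_embeddingD(2)[OF f x y] order_embeddingD(2)[OF f y x]
    by (auto simp: partial_order_on_def antisym_def)
qed

lemma is_module_restriction:
  assumes "f \<in> order_embeddings X P" and "is_module P M"
  shows "is_module X (restriction f M)"
  by (rule is_moduleI)
    (auto simp: restriction_def order_embeddingD[OF assms(1)] FieldI1 FieldI2
      intro: is_moduleD[OF assms(2)])

lemma generalized_rank_restriction:
  assumes X: "Partial_order X" and P: "Partial_order P" and f: "f \<in> order_embeddings X P"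
  shows "generalized_rank X (Field X) (restriction f M) = generalized_rank P (f ` Field X) M"
proof -
  have inj: "inj_on f (Field X)"
    by (rule order_embedding_inj_on[OF assms])
  define g where "g = inv_into (Field X) f"
  have g [simp]: "g (f x) = x" if "x \<in> Field X" for x
    using inj that by (simp add: g_def)
  have "has_biorthogonal X (Field X) (restriction f M) n \<longleftrightarrow> has_biorthogonal P (f ` Field X) M n" for n
  proof
    assume "has_biorthogonal X (Field X) (restriction f M) n"
    then obtain s l where "biorthogonal X (Field X) (restriction f M) n s l"
      by (auto simp: has_biorthogonal_def)
    then have "biorthogonal P (f ` Field X) M n (\<lambda>i. s i \<circ> g) (\<lambda>i. l i \<circ> g)"
      by (simp add: biorthogonal_def is_section_def is_cosection_def restriction_def
          order_embeddingD(2)[OF f])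
    then show "has_biorthogonal P (f ` Field X) M n"
      unfolding has_biorthogonal_def by blast
  next
    assume "has_biorthogonal P (f ` Field X) M n"
    then obtain s l where "biorthogonal P (f ` Field X) M n s l"
      by (auto simp: has_biorthogonal_def)
    then have "biorthogonal X (Field X) (restriction f M) n (\<lambda>i. s i \<circ> f) (\<lambda>i. l i \<circ> f)"
      by (simp add: biorthogonal_def is_section_def is_cosection_def restriction_def
          order_embeddingD(2)[OF f])
    then show "has_biorthogonal X (Field X) (restriction f M) n"
      unfolding has_biorthogonal_def by blast
  qed
  then show ?thesis
    by (simp add: generalized_rank_def)
qed

lemma generalized_rank_interval:
  assumes P: "Partial_order P" and T: "T \<subseteq> Field P" and ne: "T \<noteq> {}" and S: "order_convex P S"
  shows "generalized_rank P T (interval_module S :: ('p, unit, 'k::field) rep) = (if T \<subseteq> S then 1 else 0)"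
proof -
  let ?I = "interval_module S :: ('p, unit, 'k) rep"
  have I: "is_module P ?I" by (rule is_module_interval[OF S])
  note rank = has_biorthogonal_generalized_rank[OF I T ne]
  show ?thesis
  proof (cases "T \<subseteq> S")
    case True
    obtain x where x: "x \<in> T" using ne by blast
    have "biorthogonal P T ?I 1 (\<lambda>_ _ _. 1) (\<lambda>_ _ v. v ())"
      using True by (auto simp: biorthogonal_def is_section_def is_cosection_def interval_module_def
          lin_on_def subset_iff)
    then have "1 \<le> generalized_rank P T ?I"
      by (intro rank(2)) (auto simp: has_biorthogonal_def)
    moreover have "generalized_rank P T ?I \<le> card ((\<lambda>i j. if j = i then 1 else (0::'k)) ` (UNIV::unit set))"
    proof (rule has_biorthogonal_bound[OF I T x _ _ rank(1)])
      show "fs.span ((\<lambda>i j. if j = i then 1 else 0) ` (UNIV::unit set)) = sp ?I x"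
      proof (intro subset_antisym subsetI)
        fix v show "v \<in> fs.span ((\<lambda>i j. if j = i then 1 else (0::'k)) ` (UNIV::unit set))"
          by (rule supported_in_span_unit_vectors) auto
      qed (use x True in \<open>auto simp: interval_module_def\<close>)
    qed simp
    ultimately show ?thesis using True by simp
  next
    case False
    then obtain x where x: "x \<in> T" "x \<notin> S" by blast
    have "fs.span {} = sp ?I x"
      using x by (simp add: interval_module_def)
    from has_biorthogonal_bound[OF I T x(1) _ this rank(1)] show ?thesis
      using False by simp
  qed
qed

section \<open>Convex hulls of embedded posets\<close>

lemma partial_orderD:
  assumes "Partial_order P"
  shows "x \<in> Field P \<Longrightarrow> (x, x) \<in> P"
    and "(x, y) \<in> P \<Longrightarrow> (y, z) \<in> P \<Longrightarrow> (x, z) \<in> P"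
    and "(x, y) \<in> P \<Longrightarrow> (y, x) \<in> P \<Longrightarrow> x = y"
  using assms unfolding partial_order_on_def preorder_on_def refl_on_def trans_def antisym_def
  by blast+

lemma subset_convex_hull:
  assumes "Partial_order P" and "S \<subseteq> Field P"
  shows "S \<subseteq> convex_hull_in P S"
  using partial_orderD(1)[OF assms(1)] assms(2) by (auto simp: convex_hull_in_def)

lemma order_convex_convex_hull:
  assumes "Partial_order P"
  shows "order_convex P (convex_hull_in P S)"
  unfolding order_convex_def convex_hull_in_def
  using partial_orderD(2)[OF assms] by (blast intro: FieldI1 FieldI2)

lemma convex_hull_subset_iff:
  assumes "Partial_order P" and "S \<subseteq> Field P" and "order_convex P C"
  shows "convex_hull_in P S \<subseteq> C \<longleftrightarrow> S \<subseteq> C"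
proof
  show "convex_hull_in P S \<subseteq> C \<Longrightarrow> S \<subseteq> C"
    using subset_convex_hull[OF assms(1,2)] by blast
  show "S \<subseteq> C \<Longrightarrow> convex_hull_in P S \<subseteq> C"
    using assms(3) unfolding convex_hull_in_def order_convex_def by blast
qed

lemma connected_inI:
  assumes "T \<noteq> {}"
    and "\<And>C x y. (\<And>a b. a \<in> T \<Longrightarrow> b \<in> T \<Longrightarrow> (a, b) \<in> P \<Longrightarrow> (a \<in> C \<longleftrightarrow> b \<in> C)) \<Longrightarrow>
           x \<in> T \<Longrightarrow> y \<in> T \<Longrightarrow> x \<in> C \<Longrightarrow> y \<in> C"
  shows "connected_in P T"
  unfolding connected_in_def
proof (intro conjI allI impI assms(1))
  fix C assume *: "\<forall>x\<in>T. \<forall>y\<in>T. (x, y) \<in> P \<longrightarrow> (x \<in> C) = (y \<in> C)"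
  then have "y \<in> C" if "x \<in> T" "y \<in> T" "x \<in> C" for x y
    using that assms(2)[of C x y] by blast
  then show "T \<subseteq> C \<or> T \<inter> C = {}"
    by blast
qed

lemma connected_inD:
  assumes "connected_in P T"
    and "\<And>a b. a \<in> T \<Longrightarrow> b \<in> T \<Longrightarrow> (a, b) \<in> P \<Longrightarrow> (a \<in> C \<longleftrightarrow> b \<in> C)"
    and "x \<in> T" and "y \<in> T" and "x \<in> C"
  shows "y \<in> C"
proof -
  have "T \<subseteq> C \<or> T \<inter> C = {}"
    using assms(1,2) unfolding connected_in_def by blast
  then show ?thesis using assms(3-5) by blast
qed

lemma connected_in_Field:
  assumes "connected_poset X"
  shows "connected_in X (Field X)"
proof (rule connected_inI)
  show "Field X \<noteq> {}" using assms by (simp add: connected_poset_def)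
  fix C x y
  assume C: "\<And>a b. a \<in> Field X \<Longrightarrow> b \<in> Field X \<Longrightarrow> (a, b) \<in> X \<Longrightarrow> (a \<in> C \<longleftrightarrow> b \<in> C)"
    and x: "x \<in> Field X" "y \<in> Field X" "x \<in> C"
  have "(x, y) \<in> (X \<union> X\<inverse>)\<^sup>*"
    using assms x by (simp add: connected_poset_def)
  then show "y \<in> C"
    by (induction rule: rtrancl_induct) (use x C in \<open>auto simp: FieldI1 FieldI2\<close>)
qed

lemma connected_in_image:
  assumes f: "f \<in> order_embeddings X P" and conn: "connected_in X (Field X)"
  shows "connected_in P (f ` Field X)"
proof (rule connected_inI)
  show "f ` Field X \<noteq> {}" using conn by (simp add: connected_in_def)
  fix C x y
  assume C: "\<And>a b. a \<in> f ` Field X \<Longrightarrow> b \<in> f ` Field X \<Longrightarrow> (a, b) \<in> P \<Longrightarrow> (a \<in> C \<longleftrightarrow> b \<in> C)"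
    and "x \<in> f ` Field X" "y \<in> f ` Field X" "x \<in> C"
  then obtain a b where ab: "a \<in> Field X" "b \<in> Field X" "x = f a" "y = f b" by blast
  have "b \<in> f -` C"
    by (rule connected_inD[OF conn, of _ a])
      (use ab C \<open>x \<in> C\<close> order_embeddingD(2)[OF f] in auto)
  then show "y \<in> C" using ab by simp
qed

lemma connected_in_convex_hull:
  assumes P: "Partial_order P" and T: "T \<subseteq> Field P" and conn: "connected_in P T"
  shows "connected_in P (convex_hull_in P T)"
proof (rule connected_inI)
  note sub = subset_convex_hull[OF P T]
  show "convex_hull_in P T \<noteq> {}"
    using conn sub by (auto simp: connected_in_def)
  fix C x y
  assume C: "\<And>a b. a \<in> convex_hull_in P T \<Longrightarrow> b \<in> convex_hull_in P T \<Longrightarrow> (a, b) \<in> P \<Longrightarrow>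
      (a \<in> C \<longleftrightarrow> b \<in> C)"
    and x: "x \<in> convex_hull_in P T" and y: "y \<in> convex_hull_in P T" and "x \<in> C"
  obtain a where a: "a \<in> T" "(a, x) \<in> P" using x by (auto simp: convex_hull_in_def)
  obtain b where b: "b \<in> T" "(b, y) \<in> P" using y by (auto simp: convex_hull_in_def)
  have "a \<in> C" using C[of a x] a x sub \<open>x \<in> C\<close> by blast
  have "b \<in> C"
    by (rule connected_inD[OF conn _ a(1) b(1) \<open>a \<in> C\<close>]) (use C sub in blast)
  then show "y \<in> C" using C[of b y] b y sub by blast
qed

text \<open>Without chains of three elements, every point of the image is minimal or maximal in the image,
  hence in its convex hull; as the hull is bounded by points of the image, the image consists of the
  minimal and the maximal points of its hull.\<close>

lemma image_determined_by_convex_hull: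
  assumes P: "Partial_order P" and X: "no_three_chain X"
    and f: "f \<in> order_embeddings X P" and T: "T \<subseteq> Field P"
    and hull: "convex_hull_in P (f ` Field X) = convex_hull_in P T"
  shows "f ` Field X \<subseteq> T"
proof
  fix p assume "p \<in> f ` Field X"
  then obtain x where x: "x \<in> Field X" "p = f x" by blast
  note sub = subset_convex_hull[OF P order_embeddingD(3)[OF f]] subset_convex_hull[OF P T]
  have "p \<in> convex_hull_in P T"
    using x sub(1) hull by blast
  then obtain a b where a: "a \<in> T" "(a, p) \<in> P" and b: "b \<in> T" "(p, b) \<in> P"
    by (auto simp: convex_hull_in_def)
  have "a \<in> convex_hull_in P (f ` Field X)" "b \<in> convex_hull_in P (f ` Field X)"
    using a b sub(2) hull by blast+
  then obtain y z where y: "y \<in> Field X" "(f y, a) \<in> P" and z: "z \<in> Field X" "(b, f z) \<in> P"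
    by (auto simp: convex_hull_in_def)
  have "(y, x) \<in> X" "(x, z) \<in> X"
    using order_embeddingD(2)[OF f y(1) x(1)] order_embeddingD(2)[OF f x(1) z(1)]
      partial_orderD(2)[OF P y(2) a(2)] partial_orderD(2)[OF P b(2) z(2)] x(2) by auto
  then have "y = x \<or> x = z"
    using X by (auto simp: no_three_chain_def)
  then show "p \<in> T"
    using partial_orderD(3)[OF P a(2)] partial_orderD(3)[OF P b(2)] a b y z x by auto
qed

section \<open>Indecomposability of interval modules\<close>

text \<open>In a decomposition \<open>A \<oplus> B\<close>, the generator \<open>1\<close> at a point of \<open>S\<close> has components \<open>a\<close> and \<open>b\<close>, exactly
  one of which vanishes because the space is one-dimensional. Structure maps carry generators to
  generators, so the vanishing component is the same along comparable points, hence on all of \<open>S\<close>.\<close>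

lemma indecomposable_interval:
  fixes U :: "('p, nat, 'k::field) rep"
  assumes conn: "connected_in P S" and S: "order_convex P S" and U: "is_module P U"
    and iso: "isomorphic P (interval_module S :: ('p, unit, 'k) rep) U"
  shows "indecomposable P U"
  unfolding indecomposable_def
proof (intro conjI allI impI)
  let ?I = "interval_module S :: ('p, unit, 'k) rep"
  have I: "is_module P ?I" by (rule is_module_interval[OF S])
  have SP: "S \<subseteq> Field P" using S by (simp add: order_convex_def)
  obtain x where x: "x \<in> S" using conn by (auto simp: connected_in_def)
  show "\<not> zero_module P U"
  proof
    assume "zero_module P U"
    moreover obtain \<phi> where "bij_betw (\<phi> x) (sp ?I x) (sp U x)"
      using iso x SP by (elim isomorphicE) blast
    ultimately have "bij_betw (\<phi> x) (UNIV :: (unit \<Rightarrow> 'k) set) {0}"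
      using x SP by (auto simp: zero_module_def interval_module_def)
    then have "\<phi> x 1 = 0" "\<phi> x 0 = 0" "inj (\<phi> x)"
      by (auto simp: bij_betw_def)
    then show False
      using injD[of "\<phi> x" 1 0] by simp
  qed
  fix A B :: "('p, nat, 'k) rep"
  assume AB: "is_module P A \<and> is_module P B \<and> isomorphic P U (direct_sum A B)"
  then have A: "is_module P A" and B: "is_module P B"
    and "isomorphic P ?I (direct_sum A B)"
    using isomorphic_trans[OF I iso] by auto
  then obtain \<phi> where \<phi>: "\<phi> \<in> Hom P ?I (direct_sum A B)"
    "\<And>y. y \<in> Field P \<Longrightarrow> bij_betw (\<phi> y) (sp ?I y) (sp (direct_sum A B) y)"
    by (elim isomorphicE) blast
  define a where "a y = \<phi> y 1 \<circ> Inl" for y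
  define b where "b y = \<phi> y 1 \<circ> Inr" for y
  have \<phi>c: "\<phi> y v = fscale (v ()) (\<phi> y 1)" if "y \<in> S" for y v
  proof -
    have "v = fscale (v ()) 1" by (auto simp: fun_eq_iff)
    then have "\<phi> y v = \<phi> y (fscale (v ()) 1)" by (rule arg_cong)
    also have "\<dots> = fscale (v ()) (\<phi> y 1)"
      by (rule lin_onD(3)[OF HomD(1)[OF \<phi>(1)]]) (use that SP in \<open>auto simp: interval_module_def\<close>)
    finally show ?thesis .
  qed
  have surj: "\<exists>c. w = fscale c (\<phi> y 1)" if "y \<in> S" "w \<in> sp (direct_sum A B) y" for y w
  proof -
    have "w \<in> \<phi> y ` sp ?I y" using \<phi>(2)[of y] that SP by (auto simp: bij_betw_def)
    then show ?thesis using \<phi>c[OF that(1)] by blast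
  qed
  have ne: "\<phi> y 1 \<noteq> 0" if "y \<in> S" for y
  proof
    assume "\<phi> y 1 = 0"
    then have "\<phi> y 1 = \<phi> y 0" using \<phi>c[OF that, of 0] by simp
    moreover have "inj_on (\<phi> y) UNIV"
      using \<phi>(2)[of y] that SP by (auto simp: bij_betw_def interval_module_def)
    ultimately have "(1 :: unit \<Rightarrow> 'k) = 0" by (simp add: inj_on_eq_iff)
    then show False by (simp add: fun_eq_iff)
  qed
  have mem: "a y \<in> sp A y" "b y \<in> sp B y" if "y \<in> S" for y
    using HomD(3)[OF \<phi>(1), of y 1] that SP by (auto simp: interval_module_def mem_direct_sum a_def b_def)
  have exactly_one: "(a y = 0) \<noteq> (b y = 0)" if y: "y \<in> S" for y
  proof -
    have "case_sum (a y) 0 \<in> sp (direct_sum A B) y"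
      using mem(1)[OF y] fs.subspace_0[OF is_moduleD(1)[OF B]] y SP by (auto simp: mem_direct_sum)
    then obtain c where c: "case_sum (a y) 0 = fscale c (\<phi> y 1)" using surj[OF y] by blast
    then have "a y = fscale c (a y)" "0 = fscale c (b y)"
      unfolding a_def b_def by (metis case_sum_comp(1) comp_linear(2), metis case_sum_comp(2) comp_linear(2))
    then have "a y = 0 \<or> b y = 0"
      using fs.scale_eq_0_iff by (metis fs.scale_zero_left)
    moreover have "\<not> (a y = 0 \<and> b y = 0)"
      using ne[OF y] sum_fun_eqI[of "\<phi> y 1" 0] by (auto simp: a_def b_def)
    ultimately show ?thesis by blast
  qed
  have nat: "tr A y z (a y) = a z" "tr B y z (b y) = b z" if "y \<in> S" "z \<in> S" "(y, z) \<in> P" for y z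
  proof -
    have "\<phi> z (tr ?I y z 1) = tr (direct_sum A B) y z (\<phi> y 1)"
      by (rule HomD(2)[OF \<phi>(1) that(3)]) (use that in \<open>auto simp: interval_module_def\<close>)
    then have "\<phi> z 1 = tr (direct_sum A B) y z (\<phi> y 1)"
      using that by (simp add: interval_module_def)
    then show "tr A y z (a y) = a z" "tr B y z (b y) = b z"
      by (simp_all add: a_def b_def)
  qed
  define C where "C = {y. a y = 0}"
  have C: "y \<in> C \<longleftrightarrow> z \<in> C" if yz: "y \<in> S" "z \<in> S" "(y, z) \<in> P" for y z
  proof -
    have "tr A y z 0 = 0" "tr B y z 0 = 0"
      using lin_on_zero[OF is_moduleD(3,1)[OF A]] lin_on_zero[OF is_moduleD(3,1)[OF B]] yz SP by auto
    then have "a y = 0 \<Longrightarrow> a z = 0" "b y = 0 \<Longrightarrow> b z = 0"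
      using nat[OF yz] by auto
    then show ?thesis
      using exactly_one[OF yz(1)] exactly_one[OF yz(2)] by (auto simp: C_def)
  qed
  have zero: "sp A y = {0}" "sp B y = {0}" if "y \<in> Field P" "y \<notin> S" for y
  proof -
    have "sp (direct_sum A B) y = \<phi> y ` {0}"
      using \<phi>(2)[OF that(1)] that(2) by (simp add: bij_betw_def interval_module_def)
    then have one: "u = v" if "u \<in> sp (direct_sum A B) y" "v \<in> sp (direct_sum A B) y" for u v
      using that by simp
    note 0 = fs.subspace_0[OF is_moduleD(1)[OF A that(1)]] fs.subspace_0[OF is_moduleD(1)[OF B that(1)]]
    have "u = 0" if "u \<in> sp A y" for u
      using one[of "case_sum u 0" "case_sum 0 0"] that 0 by (auto simp: mem_direct_sum fun_eq_iff split: sum.splits)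
    moreover have "u = 0" if "u \<in> sp B y" for u
      using one[of "case_sum 0 u" "case_sum 0 0"] that 0 by (auto simp: mem_direct_sum fun_eq_iff split: sum.splits)
    ultimately show "sp A y = {0}" "sp B y = {0}"
      using 0 by auto
  qed
  have vanish: "sp A y = {0}" if y: "y \<in> S" "a y = 0" for y
  proof -
    note 0 = fs.subspace_0[OF is_moduleD(1)[OF A]] fs.subspace_0[OF is_moduleD(1)[OF B]]
    have "u = 0" if "u \<in> sp A y" for u
    proof -
      have "case_sum u 0 \<in> sp (direct_sum A B) y"
        using that 0 y SP by (auto simp: mem_direct_sum)
      then obtain c where "case_sum u 0 = fscale c (\<phi> y 1)" using surj[OF y(1)] by blast
      then have "u = fscale c (a y)"
        unfolding a_def by (metis case_sum_comp(1) comp_linear(2))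
      then show "u = 0" using y by simp
    qed
    then show ?thesis using 0 y SP by auto
  qed
  have vanish': "sp B y = {0}" if y: "y \<in> S" "b y = 0" for y
  proof -
    note 0 = fs.subspace_0[OF is_moduleD(1)[OF A]] fs.subspace_0[OF is_moduleD(1)[OF B]]
    have "u = 0" if "u \<in> sp B y" for u
    proof -
      have "case_sum 0 u \<in> sp (direct_sum A B) y"
        using that 0 y SP by (auto simp: mem_direct_sum)
      then obtain c where "case_sum 0 u = fscale c (\<phi> y 1)" using surj[OF y(1)] by blast
      then have "u = fscale c (b y)"
        unfolding b_def by (metis case_sum_comp(2) comp_linear(2))
      then show "u = 0" using y by simp
    qed
    then show ?thesis using 0 y SP by auto
  qed
  have "S \<subseteq> C \<or> S \<inter> C = {}"
    using conn C unfolding connected_in_def by blast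
  then show "zero_module P A \<or> zero_module P B"
  proof
    assume "S \<subseteq> C"
    then have "sp A y = {0}" if "y \<in> Field P" for y
      using vanish zero(1) that by (cases "y \<in> S") (auto simp: C_def)
    then show ?thesis by (simp add: zero_module_def)
  next
    assume "S \<inter> C = {}"
    then have "sp B y = {0}" if "y \<in> Field P" for y
      using vanish' zero(2) that exactly_one by (cases "y \<in> S") (auto simp: C_def)
    then show ?thesis by (simp add: zero_module_def)
  qed
qed

section \<open>Families of order-embeddings\<close>

lemma emb_rep_in_order_embeddings:
  assumes "c \<in> Emb X P"
  shows "emb_rep c \<in> order_embeddings X P"
proof -
  obtain f where f: "f \<in> order_embeddings X P" "c = emb_equiv X P `` {f}"
    using assms by (auto simp: Emb_def quotient_def)
  have "order_automorphism X id"
    by (simp add: order_automorphism_def)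
  then have "(f, f) \<in> emb_equiv X P"
    using f(1) unfolding emb_equiv_def by fastforce
  then have "f \<in> c" using f(2) by blast
  then have "emb_rep c \<in> c"
    by (metis emb_rep_def someI)
  then show ?thesis
    using f(2) by (auto simp: emb_equiv_def)
qed

lemma finite_Emb:
  assumes "finite (Field X)" and "finite (Field P)"
  shows "finite (Emb X P)"
proof -
  have "order_embeddings X P \<subseteq> Field X \<rightarrow>\<^sub>E Field P"
    by (auto simp: order_embeddings_def)
  then have "finite (order_embeddings X P)"
    using finite_PiE[OF assms(1), of "\<lambda>_. Field P"] assms(2) finite_subset by blast
  then show ?thesis
    unfolding Emb_def by (intro finite_quotient) (auto simp: emb_equiv_def)
qed

lemma emb_unionD:
  assumes P: "finite_poset P" and F: "is_emb_family P F"
  shows "finite (emb_union F)"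
    and "e \<in> emb_union F \<Longrightarrow> finite_poset (index_poset e)"
    and "e \<in> emb_union F \<Longrightarrow> index_emb e \<in> order_embeddings (index_poset e) P"
    and "e \<in> emb_union F \<Longrightarrow> fst e \<in> F"
proof -
  show "finite (emb_union F)"
    unfolding emb_union_def
  proof (rule finite_SigmaI)
    show "finite F" using F by (simp add: is_emb_family_def)
    fix XE assume "XE \<in> F"
    then have "snd XE \<subseteq> Emb (fst XE) P" "finite_poset (fst XE)"
      using F unfolding is_emb_family_def by fastforce+
    then show "finite (snd XE)"
      using P finite_Emb[of "fst XE" P] finite_subset by (auto simp: finite_poset_def)
  qed
  show "e \<in> emb_union F \<Longrightarrow> finite_poset (index_poset e)"
    using F by (auto simp: emb_union_def is_emb_family_def index_poset_def)
  show "e \<in> emb_union F \<Longrightarrow> index_emb e \<in> order_embeddings (index_poset e) P"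
    using F unfolding emb_union_def is_emb_family_def index_emb_def index_poset_def
    by (intro emb_rep_in_order_embeddings) fastforce
  show "e \<in> emb_union F \<Longrightarrow> fst e \<in> F"
    by (auto simp: emb_union_def)
qed

section \<open>Additive functions on the split Grothendieck group\<close>

definition additive_on_modules :: "'p rel \<Rightarrow> (('p, nat, 'k::field) rep \<Rightarrow> int) \<Rightarrow> bool" where
  "additive_on_modules P v \<longleftrightarrow>
     (\<forall>M N. is_module P M \<longrightarrow> is_module P N \<longrightarrow> isomorphic P M N \<longrightarrow> v M = v N) \<and>
     (\<forall>L M N. is_module P L \<longrightarrow> is_module P M \<longrightarrow> is_module P N \<longrightarrow>
        isomorphic P L (direct_sum M N) \<longrightarrow> v L = v M + v N)"

definition linear_extension :: "'e set \<Rightarrow> ('e \<Rightarrow> ('p, nat, 'k::field) rep \<Rightarrow> int) \<Rightarrow>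
    (('p, 'k) isoclass \<Rightarrow>\<^sub>0 int) \<Rightarrow> 'e \<Rightarrow> int" where
  "linear_extension E v a =
     (\<lambda>e\<in>E. \<Sum>c\<in>Poly_Mapping.keys a. Poly_Mapping.lookup a c * the_elem (v e ` c))"

lemma linear_extension_superset:
  assumes "finite K" and "Poly_Mapping.keys a \<subseteq> K" and "e \<in> E"
  shows "linear_extension E v a e = (\<Sum>c\<in>K. Poly_Mapping.lookup a c * the_elem (v e ` c))"
  using assms unfolding linear_extension_def
  by (auto intro!: sum.mono_neutral_left simp: in_keys_iff)

lemma linear_extension_simps:
  assumes "e \<in> E"
  shows "linear_extension E v (a + b) e = linear_extension E v a e + linear_extension E v b e"
    and "linear_extension E v (a - b) e = linear_extension E v a e - linear_extension E v b e"
    and "linear_extension E v (- a) e = - linear_extension E v a e"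
    and "linear_extension E v 0 e = 0"
    and "linear_extension E v (frag_cmul k a) e = k * linear_extension E v a e"
    and "linear_extension E v (frag_of c) e = the_elem (v e ` c)"
proof -
  let ?K = "Poly_Mapping.keys a \<union> Poly_Mapping.keys b"
  have K: "finite ?K" by simp
  have "Poly_Mapping.keys (a + b) \<subseteq> ?K" "Poly_Mapping.keys (a - b) \<subseteq> ?K"
    by (auto simp: keys_add keys_diff)
  then show "linear_extension E v (a + b) e = linear_extension E v a e + linear_extension E v b e"
    and "linear_extension E v (a - b) e = linear_extension E v a e - linear_extension E v b e"
    by (simp_all add: linear_extension_superset[OF K _ assms] lookup_add lookup_minus
        algebra_simps sum.distrib sum_subtractf)
  show "linear_extension E v (- a) e = - linear_extension E v a e"
    using assms by (simp add: linear_extension_def sum_negf)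
  show "linear_extension E v 0 e = 0"
    using assms by (simp add: linear_extension_def)
  have "Poly_Mapping.keys (frag_cmul k a) \<subseteq> Poly_Mapping.keys a"
    by (rule keys_cmul)
  then show "linear_extension E v (frag_cmul k a) e = k * linear_extension E v a e"
    by (simp add: linear_extension_superset[OF finite_keys[of a] _ assms]
        sum_distrib_left mult.assoc)
  show "linear_extension E v (frag_of c) e = the_elem (v e ` c)"
    using assms by (simp add: linear_extension_def)
qed

lemma linear_extension_extensional: "linear_extension E v a \<in> extensional E"
  by (simp add: linear_extension_def)

lemma linear_extension_eqI:
  assumes "\<And>e. e \<in> E \<Longrightarrow> linear_extension E v a e = linear_extension E v b e"
  shows "linear_extension E v a = linear_extension E v b"
  using assms linear_extension_extensional by (metis extensionalityI)

lemma isoclass_in_isoclasses: "is_module P M \<Longrightarrow> isoclass P M \<in> isoclasses P"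
  for M :: "('p, nat, 'k::field) rep"
  unfolding isoclasses_def by blast

lemma value_isoclass:
  fixes M :: "('p, nat, 'k::field) rep"
  assumes "additive_on_modules P v" and "is_module P M"
  shows "the_elem (v ` isoclass P M) = v M"
proof -
  have "v ` isoclass P M = {v M}"
    using assms isomorphic_refl[OF assms(2)]
    unfolding additive_on_modules_def isoclass_def by blast
  then show ?thesis by simp
qed

text \<open>A direct sum has index type \<^typ>\<open>nat + nat\<close>, so it is itself no member of its isomorphism
  class; \<^const>\<open>sum_encode\<close> yields one.\<close>

lemma isoclass_direct_sum:
  fixes M N :: "('p, nat, 'k::field) rep"
  assumes "is_module P M" and "is_module P N"
  obtains L :: "('p, nat, 'k) rep"
  where "is_module P L" "isomorphic P L (direct_sum M N)" "isoclass P (direct_sum M N) = isoclass P L"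
proof -
  have D: "is_module P (direct_sum M N)" by (rule is_module_direct_sum[OF assms])
  have inj: "inj sum_encode" by (rule inj_sum_encode)
  note L = relabel_module[OF D inj]
  show ?thesis
    by (rule that[OF L(1) isomorphic_sym[OF D L] isoclass_eq[OF D L]])
qed

lemma K0_relations_subgroup:
  fixes P :: "'p rel"
  shows "subgroup (K0_relations P :: (('p, 'k::field) isoclass \<Rightarrow>\<^sub>0 int) set) (free_Abelian_group (isoclasses P))"
    (is "subgroup _ ?G")
proof -
  interpret G: group ?G by simp
  define R :: "(('p, 'k) isoclass \<Rightarrow>\<^sub>0 int) set" where "R =
     {frag_of (isoclass P (direct_sum M N)) - (frag_of (isoclass P M) + frag_of (isoclass P N))
      |(M :: ('p, nat, 'k) rep) (N :: ('p, nat, 'k) rep). is_module P M \<and> is_module P N}"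
  have "R \<subseteq> carrier ?G"
  proof
    fix r assume "r \<in> R"
    then obtain M N :: "('p, nat, 'k) rep" where MN: "is_module P M" "is_module P N"
      and r: "r = frag_of (isoclass P (direct_sum M N)) - (frag_of (isoclass P M) + frag_of (isoclass P N))"
      by (auto simp: R_def)
    obtain L :: "('p, nat, 'k) rep" where L: "is_module P L" "isoclass P (direct_sum M N) = isoclass P L"
      using isoclass_direct_sum[OF MN] by blast
    have "Poly_Mapping.keys r \<subseteq> {isoclass P L, isoclass P M, isoclass P N}"
    proof -
      have "Poly_Mapping.keys r \<subseteq> Poly_Mapping.keys (frag_of (isoclass P L)) \<union>
          Poly_Mapping.keys (frag_of (isoclass P M) + frag_of (isoclass P N))"
        unfolding r L(2) by (rule keys_diff)
      also have "\<dots> \<subseteq> {isoclass P L} \<union> ({isoclass P M} \<union> {isoclass P N})"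
        using keys_add[of "frag_of (isoclass P M)" "frag_of (isoclass P N)"] by auto
      finally show ?thesis by auto
    qed
    also have "\<dots> \<subseteq> isoclasses P"
      using isoclass_in_isoclasses[OF L(1)] isoclass_in_isoclasses[OF MN(1)]
        isoclass_in_isoclasses[OF MN(2)] by blast
    finally show "r \<in> carrier ?G" by simp
  qed
  then show ?thesis
    unfolding K0_relations_def R_def[symmetric] by (rule G.generate_is_subgroup)
qed

lemmas K0_relations_subset = subgroup.subset[OF K0_relations_subgroup]

lemma K0_relations_normal: "K0_relations P \<lhd> free_Abelian_group (isoclasses P)"
  by (rule comm_group.subgroup_imp_normal[OF abelian_free_Abelian_group K0_relations_subgroup])

lemma group_K0: "group (K0 P)"
  unfolding K0_def by (rule normal.factorgroup_is_group[OF K0_relations_normal])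

lemma K0_proj_hom: "K0_proj P \<in> hom (free_Abelian_group (isoclasses P)) (K0 P)"
  unfolding K0_def K0_proj_def by (rule normal.r_coset_hom_Mod[OF K0_relations_normal])

lemma carrier_K0: "carrier (K0 P) = K0_proj P ` carrier (free_Abelian_group (isoclasses P))"
  unfolding K0_def K0_proj_def FactGroup_def RCOSETS_def by auto

lemma linear_extension_K0_relations:
  fixes v :: "'e \<Rightarrow> ('p, nat, 'k::field) rep \<Rightarrow> int"
  assumes v: "\<And>e. e \<in> E \<Longrightarrow> additive_on_modules P (v e)"
    and r: "r \<in> K0_relations P" and e: "e \<in> E"
  shows "linear_extension E v r e = 0"
proof -
  let ?G = "free_Abelian_group (isoclasses P)"
  interpret G: group ?G by simp
  have relator: "h \<in> carrier ?G \<and> linear_extension E v h e = 0"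
    if h: "h \<in> {frag_of (isoclass P (direct_sum M N)) - (frag_of (isoclass P M) + frag_of (isoclass P N))
      |(M :: ('p, nat, 'k) rep) (N :: ('p, nat, 'k) rep). is_module P M \<and> is_module P N}" for h
  proof
    have "h \<in> K0_relations P"
      unfolding K0_relations_def by (rule generate.incl[OF h])
    then show "h \<in> carrier ?G" using K0_relations_subset by blast
    obtain M N :: "('p, nat, 'k) rep" where MN: "is_module P M" "is_module P N"
      and h': "h = frag_of (isoclass P (direct_sum M N)) - (frag_of (isoclass P M) + frag_of (isoclass P N))"
      using h by auto
    obtain L :: "('p, nat, 'k) rep" where L: "is_module P L" "isomorphic P L (direct_sum M N)"
      "isoclass P (direct_sum M N) = isoclass P L"
      using isoclass_direct_sum[OF MN] by blast
    have "v e L = v e M + v e N"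
      using v[OF e] L MN unfolding additive_on_modules_def by blast
    then show "linear_extension E v h e = 0"
      unfolding h' L(3) using e MN L(1)
      by (simp add: linear_extension_simps value_isoclass[OF v[OF e]])
  qed
  have "r \<in> carrier ?G \<and> linear_extension E v r e = 0"
    using r unfolding K0_relations_def
  proof (induction rule: generate.induct)
    case one
    then show ?case using e by (simp add: linear_extension_simps)
  next
    case (incl h)
    then show ?case by (rule relator)
  next
    case (inv h)
    then have h: "h \<in> carrier ?G" "linear_extension E v h e = 0" using relator by blast+
    then show ?case using e G.inv_closed[OF h(1)] by (simp add: linear_extension_simps)
  next
    case (eng h1 h2)
    then show ?case
      using e G.m_closed[of h1 h2] by (simp add: linear_extension_simps)
  qed
  then show ?thesis by blast
qed

lemma K0_induced_K0_proj:
  fixes v :: "'e \<Rightarrow> ('p, nat, 'k::field) rep \<Rightarrow> int"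
  assumes v: "\<And>e. e \<in> E \<Longrightarrow> additive_on_modules P (v e)"
  shows "K0_induced E v (K0_proj P a) = linear_extension E v a"
proof -
  have "linear_extension E v (r + a) = linear_extension E v a" if "r \<in> K0_relations P" for r
    by (rule linear_extension_eqI)
      (simp add: linear_extension_simps linear_extension_K0_relations[OF v that])
  moreover have "0 \<in> K0_relations P"
    using subgroup.one_closed[OF K0_relations_subgroup[of P]] by simp
  ultimately have "linear_extension E v ` (K0_proj P a) = {linear_extension E v a}"
    unfolding K0_proj_def r_coset_def by auto
  then show ?thesis
    by (simp add: K0_induced_def linear_extension_def)
qed

lemma group_int_power_group: "group (int_power_group E)"
  unfolding int_power_group_def by simp

lemma K0_induced_hom:
  fixes v :: "'e \<Rightarrow> ('p, nat, 'k::field) rep \<Rightarrow> int"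
  assumes v: "\<And>e. e \<in> E \<Longrightarrow> additive_on_modules P (v e)"
  shows "K0_induced E v \<in> hom (K0 P) (int_power_group E)"
proof (rule homI)
  fix x :: "('p, 'k) K0_elem" assume "x \<in> carrier (K0 P)"
  then obtain a where "x = K0_proj P a" by (auto simp: carrier_K0)
  then show "K0_induced E v x \<in> carrier (int_power_group E)"
    using linear_extension_extensional
    by (auto simp: K0_induced_K0_proj[OF v] int_power_group_def PiE_def)
next
  fix x y :: "('p, 'k) K0_elem" assume "x \<in> carrier (K0 P)" "y \<in> carrier (K0 P)"
  then obtain a b where ab: "a \<in> carrier (free_Abelian_group (isoclasses P))"
      "b \<in> carrier (free_Abelian_group (isoclasses P))"
      "x = K0_proj P a" "y = K0_proj P b"
    by (auto simp: carrier_K0)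
  have "x \<otimes>\<^bsub>K0 P\<^esub> y = K0_proj P (a + b)"
    using hom_mult[OF K0_proj_hom ab(1,2)] ab(3,4) by simp
  moreover have "linear_extension E v (a + b) = (\<lambda>e\<in>E. linear_extension E v a e + linear_extension E v b e)"
    using linear_extension_extensional
    by (intro extensionalityI[of _ E]) (auto simp: linear_extension_simps)
  ultimately show "K0_induced E v (x \<otimes>\<^bsub>K0 P\<^esub> y) =
      K0_induced E v x \<otimes>\<^bsub>int_power_group E\<^esub> K0_induced E v y"
    by (simp add: ab(3,4) K0_induced_K0_proj[OF v] int_power_group_def)
qed

lemma generate_K0_proj:
  assumes "R \<subseteq> isoclasses P"
  shows "generate (K0 P) ((\<lambda>c. K0_proj P (frag_of c)) ` R) =
    K0_proj P ` carrier (free_Abelian_group R)"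
proof -
  let ?G = "free_Abelian_group (isoclasses P)"
  interpret G: group ?G by simp
  interpret K: group "K0 P" by (rule group_K0)
  interpret proj: group_hom ?G "K0 P" "K0_proj P"
    by unfold_locales (rule K0_proj_hom)
  have R: "frag_of ` R \<subseteq> carrier ?G"
    using assms by auto
  have "generate ?G (frag_of ` R) = carrier (free_Abelian_group R)"
  proof (intro subset_antisym subsetI)
    fix a assume "a \<in> generate ?G (frag_of ` R)"
    then have "a \<in> carrier ?G \<and> Poly_Mapping.keys a \<subseteq> R"
    proof (induction rule: generate.induct)
      case (incl h)
      then show ?case using R by auto
    next
      case (inv h)
      then have "h \<in> carrier ?G" "Poly_Mapping.keys h \<subseteq> R" using R by auto
      then show ?case by simp
    next
      case (eng h1 h2)
      then show ?case using keys_add[of h1 h2] by auto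
    qed simp
    then show "a \<in> carrier (free_Abelian_group R)" by simp
  next
    fix a assume "a \<in> carrier (free_Abelian_group R)"
    then have "Poly_Mapping.keys a \<subseteq> R" by simp
    then show "a \<in> generate ?G (frag_of ` R)"
    proof (induction rule: frag_induction)
      case zero
      then show ?case using generate.one[of ?G] by simp
    next
      case (one x)
      then show ?case by (intro generate.incl) simp
    next
      case (diff a b)
      have "inv\<^bsub>?G\<^esub> b \<in> generate ?G (frag_of ` R)"
        by (rule G.generate_m_inv_closed[OF R diff(2)])
      moreover have "b \<in> carrier ?G"
        using G.generate_in_carrier[OF R diff(2)] .
      ultimately show ?case
        using generate.eng[OF diff(1), of "- b"] by simp
    qed
  qed
  moreover have "(\<lambda>c. K0_proj P (frag_of c)) ` R = K0_proj P ` frag_of ` R"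
    by (simp add: image_image)
  ultimately show ?thesis
    using proj.generate_img[OF R] by simp
qed

section \<open>Unitriangular families are bases\<close>

text \<open>The values on the classes \<open>[U d]\<close> form the incidence matrix of the order on labels. A class
  whose label is maximal in the support of a combination is detected by its own coordinate, which
  gives injectivity. Conversely, a vector of integers that is constant on equal labels is cleared by
  repeatedly subtracting a multiple of the class with a maximal label, which only changes entries
  at smaller labels; this gives surjectivity onto the image.\<close>

theorem is_basis_unitriangular:
  fixes v :: "'e \<Rightarrow> ('p, nat, 'k::field) rep \<Rightarrow> int" and U :: "'d::order \<Rightarrow> ('p, nat, 'k) rep"
  assumes E: "finite E"
    and v: "\<And>e. e \<in> E \<Longrightarrow> additive_on_modules P (v e)"
    and U: "\<And>e. e \<in> E \<Longrightarrow> is_module P (U (h e))"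
    and indec: "\<And>e. e \<in> E \<Longrightarrow> indecomposable P (U (h e))"
    and unitri: "\<And>e e'. e \<in> E \<Longrightarrow> e' \<in> E \<Longrightarrow> v e (U (h e')) = (if h e \<le> h e' then 1 else 0)"
    and label: "\<And>e e' M. e \<in> E \<Longrightarrow> e' \<in> E \<Longrightarrow> h e = h e' \<Longrightarrow> is_module P M \<Longrightarrow> v e M = v e' M"
  shows "is_basis P E (K0_induced E v) ((\<lambda>e. isoclass P (U (h e))) ` E)"
proof -
  let ?R = "(\<lambda>e. isoclass P (U (h e))) ` E"
    and ?G = "free_Abelian_group (isoclasses P :: ('p, 'k) isoclass set)"
  let ?L = "linear_extension E v" and ?\<Psi> = "K0_induced E v"
  interpret K: group "K0 P" by (rule group_K0)
  interpret Z: group "int_power_group E" by (rule group_int_power_group)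
  interpret \<Psi>: group_hom "K0 P" "int_power_group E" ?\<Psi>
    by unfold_locales (rule K0_induced_hom[OF v])
  have R: "?R \<subseteq> isoclasses P"
    using isoclass_in_isoclasses[OF U] by blast
  have val: "the_elem (v e ` isoclass P (U (h e'))) = (if h e \<le> h e' then 1 else 0)"
    if "e \<in> E" "e' \<in> E" for e e'
    using value_isoclass[OF v[OF that(1)] U[OF that(2)]] unitri[OF that] by simp
  have inj_label: "h e = h e'" if "e \<in> E" "e' \<in> E" "isoclass P (U (h e)) = isoclass P (U (h e'))" for e e'
  proof (rule order_antisym)
    have "(if h e \<le> h e' then 1 else 0) = (1::int)"
      using val[OF that(1,2)] val[OF that(1,1)] by (simp only: that(3) order_refl if_True)
    then show "h e \<le> h e'" by (simp split: if_splits)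
    have "(if h e' \<le> h e then 1 else 0) = (1::int)"
      using val[OF that(2,1)] val[OF that(2,2)] by (simp only: that(3) order_refl if_True)
    then show "h e' \<le> h e" by (simp split: if_splits)
  qed

  have kernel: "a = 0" if a: "Poly_Mapping.keys a \<subseteq> ?R" and La: "\<And>e. e \<in> E \<Longrightarrow> ?L a e = 0" for a
  proof (rule ccontr)
    assume "a \<noteq> 0"
    define D where "D = {h e |e. e \<in> E \<and> isoclass P (U (h e)) \<in> Poly_Mapping.keys a}"
    have "finite D" using E by (simp add: D_def)
    moreover have "D \<noteq> {}"
      using a \<open>a \<noteq> 0\<close> unfolding D_def by (auto simp flip: keys_eq_empty)
    ultimately obtain d where d: "d \<in> D" "\<And>d'. d' \<in> D \<Longrightarrow> d \<le> d' \<Longrightarrow> d = d'"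
      using finite_has_maximal[of D] by blast
    then obtain e where e: "e \<in> E" "d = h e" "isoclass P (U (h e)) \<in> Poly_Mapping.keys a"
      by (auto simp: D_def)
    have "?L a e = (\<Sum>c\<in>Poly_Mapping.keys a. Poly_Mapping.lookup a c * the_elem (v e ` c))"
      using e(1) by (simp add: linear_extension_def)
    also have "\<dots> = (\<Sum>c\<in>Poly_Mapping.keys a. if c = isoclass P (U (h e)) then Poly_Mapping.lookup a c else 0)"
    proof (rule sum.cong[OF refl])
      fix c assume c: "c \<in> Poly_Mapping.keys a"
      then obtain e' where e': "e' \<in> E" "c = isoclass P (U (h e'))" using a by blast
      have "h e' \<in> D" using c e' by (auto simp: D_def)
      then have "h e \<le> h e' \<longleftrightarrow> h e = h e'" using d(2) e(2) by auto
      also have "\<dots> \<longleftrightarrow> c = isoclass P (U (h e))"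
        using inj_label[OF e'(1) e(1)] e'(2) by auto
      finally show "Poly_Mapping.lookup a c * the_elem (v e ` c) =
          (if c = isoclass P (U (h e)) then Poly_Mapping.lookup a c else 0)"
        using val[OF e(1) e'(1)] e'(2) by simp
    qed
    also have "\<dots> = Poly_Mapping.lookup a (isoclass P (U (h e)))"
      using e(3) by simp
    finally show False
      using La[OF e(1)] e(3) by (simp add: in_keys_iff)
  qed

  have L_inj: "inj_on ?L (carrier (free_Abelian_group ?R))"
  proof (rule inj_onI)
    fix a b assume ab: "a \<in> carrier (free_Abelian_group ?R)" "b \<in> carrier (free_Abelian_group ?R)"
      and eq: "?L a = ?L b"
    have "Poly_Mapping.keys (a - b) \<subseteq> ?R"
      using ab keys_diff[of a b] by (auto simp only: carrier_free_Abelian_group_iff)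
    then have "a - b = 0"
      by (rule kernel) (simp add: linear_extension_simps eq)
    then show "a = b" by simp
  qed

  have solve: "\<exists>a. Poly_Mapping.keys a \<subseteq> ?R \<and> (\<forall>e\<in>E. ?L a e = w e)"
    if "finite D" and "D \<subseteq> h ` E" and "\<And>d d'. d \<in> D \<Longrightarrow> d' \<in> h ` E \<Longrightarrow> d' \<le> d \<Longrightarrow> d' \<in> D"
      and "\<And>e e'. e \<in> E \<Longrightarrow> e' \<in> E \<Longrightarrow> h e = h e' \<Longrightarrow> w e = w e'"
      and "\<And>e. e \<in> E \<Longrightarrow> h e \<notin> D \<Longrightarrow> w e = 0" for D w
    using that
  proof (induction "card D" arbitrary: D w)
    case 0
    then have "D = {}" by simp
    then show ?case
      using "0.prems"(5) by (intro exI[of _ 0]) (simp add: linear_extension_simps)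
  next
    case (Suc n)
    have "D \<noteq> {}" using Suc.hyps(2) by auto
    then obtain d where d: "d \<in> D" "\<And>d'. d' \<in> D \<Longrightarrow> d \<le> d' \<Longrightarrow> d = d'"
      using finite_has_maximal[OF Suc.prems(1)] by blast
    then obtain e0 where e0: "e0 \<in> E" "d = h e0" using Suc.prems(2) by blast
    let ?w = "\<lambda>e. w e - w e0 * (if h e \<le> d then 1 else 0)"
    have "\<exists>a. Poly_Mapping.keys a \<subseteq> ?R \<and> (\<forall>e\<in>E. ?L a e = ?w e)"
    proof (rule Suc.hyps(1)[of "D - {d}"])
      show "n = card (D - {d})" using Suc.hyps(2) d(1) Suc.prems(1) by simp
      show "finite (D - {d})" "D - {d} \<subseteq> h ` E" using Suc.prems(1,2) by auto
      show "d'' \<in> D - {d}" if "d' \<in> D - {d}" "d'' \<in> h ` E" "d'' \<le> d'" for d' d''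
        using that Suc.prems(3)[of d' d''] d(2)[of d'] by auto
      show "?w e = ?w e'" if "e \<in> E" "e' \<in> E" "h e = h e'" for e e'
        using Suc.prems(4)[OF that] that by simp
      show "?w e = 0" if "e \<in> E" "h e \<notin> D - {d}" for e
      proof (cases "h e = d")
        case True
        then show ?thesis using Suc.prems(4)[OF that(1) e0(1)] e0 by simp
      next
        case False
        then have "h e \<notin> D" using that by blast
        then have "w e = 0" by (rule Suc.prems(5)[OF that(1)])
        moreover have "\<not> h e \<le> d"
          using Suc.prems(3)[OF d(1) imageI[OF that(1)]] \<open>h e \<notin> D\<close> by blast
        ultimately show ?thesis by simp
      qed
    qed
    then obtain a where a: "Poly_Mapping.keys a \<subseteq> ?R" "\<forall>e\<in>E. ?L a e = ?w e"
      by (elim exE conjE)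
    define b where "b = frag_cmul (w e0) (frag_of (isoclass P (U (h e0))))"
    have "Poly_Mapping.keys b \<subseteq> ?R"
      using e0(1) keys_cmul[of "w e0" "frag_of (isoclass P (U (h e0)))"] by (auto simp: b_def)
    then have "Poly_Mapping.keys (a + b) \<subseteq> ?R"
      using a(1) keys_add[of a b] by blast
    moreover have "?L (a + b) e = w e" if "e \<in> E" for e
      using that e0 bspec[OF a(2) that] by (simp add: linear_extension_simps b_def val)
    ultimately show ?case by (intro exI[of _ "a + b"] conjI ballI)
  qed

  have L_label: "?L a e = ?L a e'"
    if a: "a \<in> carrier ?G" and e: "e \<in> E" "e' \<in> E" "h e = h e'" for a e e'
  proof -
    have "the_elem (v e ` c) = the_elem (v e' ` c)" if c: "c \<in> Poly_Mapping.keys a" for c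
    proof -
      obtain M :: "('p, nat, 'k) rep" where "is_module P M" "c = isoclass P M"
        using c a unfolding isoclasses_def carrier_free_Abelian_group_iff by blast
      then show ?thesis
        using label[OF e] by (simp add: value_isoclass v e)
    qed
    then show ?thesis
      using e by (simp add: linear_extension_def)
  qed
  have L_image: "?L ` carrier ?G = ?L ` carrier (free_Abelian_group ?R)"
  proof (intro subset_antisym image_subsetI)
    fix a assume a: "a \<in> carrier ?G"
    have "\<exists>b. Poly_Mapping.keys b \<subseteq> ?R \<and> (\<forall>e\<in>E. ?L b e = ?L a e)"
    proof (rule solve)
      show "finite (h ` E)" using E by simp
      show "?L a e = ?L a e'" if "e \<in> E" "e' \<in> E" "h e = h e'" for e e'
        by (rule L_label[OF a that])
    qed (assumption | rule order_refl | blast)+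
    then obtain b where b: "Poly_Mapping.keys b \<subseteq> ?R" "\<forall>e\<in>E. ?L b e = ?L a e"
      by (elim exE conjE)
    have "?L a = ?L b"
      by (rule linear_extension_eqI) (simp add: bspec[OF b(2)])
    then show "?L a \<in> ?L ` carrier (free_Abelian_group ?R)"
      using b(1) by auto
  next
    fix a assume "a \<in> carrier (free_Abelian_group ?R)"
    then have "a \<in> carrier ?G" using R by auto
    then show "?L a \<in> ?L ` carrier ?G" by blast
  qed
  have \<Psi>_proj: "?\<Psi> ` K0_proj P ` A = ?L ` A" for A
    by (simp add: image_image K0_induced_K0_proj[OF v])
  have proj_R: "(\<lambda>c. K0_proj P (frag_of c)) ` ?R \<subseteq> carrier (K0 P)"
    using R by (auto simp: carrier_K0)
  have gen: "generate (K0 P) ((\<lambda>c. K0_proj P (frag_of c)) ` ?R) = K0_proj P ` carrier (free_Abelian_group ?R)"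
    by (rule generate_K0_proj[OF R])
  have image: "?\<Psi> ` carrier (K0 P) = ?\<Psi> ` generate (K0 P) ((\<lambda>c. K0_proj P (frag_of c)) ` ?R)"
    unfolding gen carrier_K0 \<Psi>_proj L_image ..

  have "is_finite_invariant P E ?\<Psi>"
    unfolding is_finite_invariant_def is_invariant_def
  proof (intro conjI exI)
    show "?\<Psi> \<in> hom (K0 P) (int_power_group E)" by (rule K0_induced_hom[OF v])
    let ?S = "?\<Psi> ` (\<lambda>c. K0_proj P (frag_of c)) ` ?R"
    show "finite ?S" using E by simp
    show "?S \<subseteq> carrier (int_power_group E)"
      using proj_R \<Psi>.hom_closed by blast
    show "?\<Psi> ` carrier (K0 P) = generate (int_power_group E) ?S"
      unfolding image by (rule \<Psi>.generate_img[OF proj_R, symmetric])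
  qed
  moreover have "?R \<subseteq> {isoclass P U |U :: ('p, nat, 'k) rep. is_module P U \<and> indecomposable P U}"
    using U indec by blast
  moreover have "inj_on (K0_proj P) (carrier (free_Abelian_group ?R))"
  proof (rule inj_onI)
    fix a b assume ab: "a \<in> carrier (free_Abelian_group ?R)" "b \<in> carrier (free_Abelian_group ?R)"
      and eq: "K0_proj P a = K0_proj P b"
    have "?L a = ?L b"
      using arg_cong[OF eq, of ?\<Psi>] by (simp only: K0_induced_K0_proj[OF v])
    then show "a = b" using inj_onD[OF L_inj] ab by blast
  qed
  moreover have "?\<Psi> \<in> iso (subgroup_generated (K0 P) ((\<lambda>U. K0_proj P (frag_of U)) ` ?R))
      ((int_power_group E)\<lparr>carrier := ?\<Psi> ` carrier (K0 P)\<rparr>)"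
  proof -
    have car: "carrier (subgroup_generated (K0 P) ((\<lambda>U. K0_proj P (frag_of U)) ` ?R)) =
        K0_proj P ` carrier (free_Abelian_group ?R)"
      using proj_R gen by (simp only: carrier_subgroup_generated Int_absorb1)
    have sub: "K0_proj P ` carrier (free_Abelian_group ?R) \<subseteq> carrier (K0 P)"
      unfolding carrier_K0 using R by auto
    have "inj_on ?\<Psi> (K0_proj P ` carrier (free_Abelian_group ?R))"
    proof (rule inj_onI)
      fix x y assume x: "x \<in> K0_proj P ` carrier (free_Abelian_group ?R)"
        and y: "y \<in> K0_proj P ` carrier (free_Abelian_group ?R)" and eq: "?\<Psi> x = ?\<Psi> y"
      obtain a b where ab: "x = K0_proj P a" "y = K0_proj P b"
        "a \<in> carrier (free_Abelian_group ?R)" "b \<in> carrier (free_Abelian_group ?R)"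
        using x y by blast
      have "?L a = ?L b"
        using eq by (simp only: ab(1,2) K0_induced_K0_proj[OF v])
      then show "x = y" using inj_onD[OF L_inj _ ab(3,4)] ab(1,2) by blast
    qed
    then have "bij_betw ?\<Psi> (K0_proj P ` carrier (free_Abelian_group ?R)) (?\<Psi> ` carrier (K0 P))"
      unfolding image gen by (simp add: bij_betw_def)
    moreover have "?\<Psi> \<in> hom (subgroup_generated (K0 P) ((\<lambda>U. K0_proj P (frag_of U)) ` ?R))
        ((int_power_group E)\<lparr>carrier := ?\<Psi> ` carrier (K0 P)\<rparr>)"
    proof (rule homI)
      show "?\<Psi> x \<in> carrier ((int_power_group E)\<lparr>carrier := ?\<Psi> ` carrier (K0 P)\<rparr>)"
        if "x \<in> carrier (subgroup_generated (K0 P) ((\<lambda>U. K0_proj P (frag_of U)) ` ?R))" for x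
        using that sub unfolding car by auto
      show "?\<Psi> (x \<otimes>\<^bsub>subgroup_generated (K0 P) ((\<lambda>U. K0_proj P (frag_of U)) ` ?R)\<^esub> y) =
          ?\<Psi> x \<otimes>\<^bsub>(int_power_group E)\<lparr>carrier := ?\<Psi> ` carrier (K0 P)\<rparr>\<^esub> ?\<Psi> y"
        if "x \<in> carrier (subgroup_generated (K0 P) ((\<lambda>U. K0_proj P (frag_of U)) ` ?R))"
          "y \<in> carrier (subgroup_generated (K0 P) ((\<lambda>U. K0_proj P (frag_of U)) ` ?R))" for x y
        using \<Psi>.hom_mult[of x y] subsetD[OF sub, of x] subsetD[OF sub, of y] that
        unfolding car by (simp add: subgroup_generated_def)
    qed
    ultimately show ?thesis
      unfolding iso_def car by simp
  qed
  ultimately show ?thesis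
    unfolding is_basis_def by blast
qed

section \<open>Intermediate extensions of constant modules\<close>

text \<open>The one-dimensional spaces of \<^const>\<open>interval_module\<close> are copied to the index \<open>0\<close>.\<close>

definition emb0 :: "'k::field \<Rightarrow> nat \<Rightarrow> 'k" where
  "emb0 c = (\<lambda>n. if n = 0 then c else 0)"

definition interval_nat :: "'p set \<Rightarrow> ('p, nat, 'k::field) rep" where
  "interval_nat S = relabel (\<lambda>_::unit. 0) (interval_module S)"

lemma emb0_simps [simp]:
  "emb0 c 0 = c" "emb0 0 = 0" "emb0 (c + d) = emb0 c + emb0 d" "emb0 (c * d) = fscale c (emb0 d)"
  by (auto simp: emb0_def fun_eq_iff)

lemma push_unit: "push (\<lambda>_::unit. 0) u = emb0 (u ())"
  by (auto simp: push_def emb0_def fun_eq_iff)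

lemma sp_interval_nat:
  "sp (interval_nat S :: ('p, nat, 'k::field) rep) x = (if x \<in> S then range emb0 else {0})"
proof -
  have "emb0 c \<in> range (\<lambda>u :: unit \<Rightarrow> 'k. emb0 (u ()))" for c :: 'k
    by (rule image_eqI[of _ _ "\<lambda>_. c"]) simp_all
  then have "range (\<lambda>u :: unit \<Rightarrow> 'k. emb0 (u ())) = range emb0"
    by blast
  then show ?thesis
    by (simp add: interval_nat_def relabel_def push_unit interval_module_def)
qed

lemma tr_interval_nat:
  "tr (interval_nat S) x y v = (if x \<in> S \<and> y \<in> S then emb0 (v 0) else 0)"
  by (simp add: interval_nat_def relabel_def push_unit interval_module_def)

lemma interval_nat_module:
  assumes "order_convex P S"
  shows "is_module P (interval_nat S :: ('p, nat, 'k::field) rep)"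
    and "isomorphic P (interval_module S :: ('p, unit, 'k) rep) (interval_nat S)"
  using relabel_module[OF is_module_interval[OF assms], of "\<lambda>_::unit. 0::nat"]
  by (simp_all add: interval_nat_def inj_def)

lemma mem_interval_nat: "v \<in> sp (interval_nat S) x \<Longrightarrow> v = emb0 (v 0) \<and> (x \<notin> S \<longrightarrow> v = 0)"
  by (auto simp: sp_interval_nat split: if_splits)

lemma emb0_mem: "x \<in> S \<Longrightarrow> emb0 c \<in> sp (interval_nat S) x"
  by (simp add: sp_interval_nat)

lemma HomI:
  assumes "is_module P M" 
    and "\<And>x. x \<in> Field P \<Longrightarrow> lin_on (sp M x) (sp N x) (\<phi> x)"
    and "\<And>x y v. (x, y) \<in> P \<Longrightarrow> v \<in> sp M x \<Longrightarrow> \<phi> y (tr M x y v) = tr N x y (\<phi> x v)"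
  obtains \<psi> where "\<psi> \<in> Hom P M N" "\<And>x v. x \<in> Field P \<Longrightarrow> v \<in> sp M x \<Longrightarrow> \<psi> x v = \<phi> x v"
  by (rule that[OF ext_hom_in_Hom[OF assms] ext_hom_apply])

text \<open>A vector of \<open>f\<^sub>* U\<close> at \<open>f x\<close> is a morphism from the projective module on the up-set of \<open>f x\<close>;
  if the counit kills it, it corresponds under the adjunction to the zero morphism.\<close>

lemma right_extension_counit_inj:
  fixes R :: "('p, nat, 'k::field) rep"
  assumes P: "Partial_order P" and f: "f \<in> order_embeddings X P" and U: "is_module X U"
    and R: "is_right_extension X P f U R \<epsilon>"
    and x: "x \<in> Field X" and w: "w \<in> sp R (f x)" and \<epsilon>w: "\<epsilon> x w = 0"
  shows "w = 0"
proof -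
  have Rm: "is_module P R" and \<epsilon>: "\<epsilon> \<in> Hom X (restriction f R) U"
    and univ: "\<And>N :: ('p, nat, 'k) rep. is_module P N \<Longrightarrow> g \<in> Hom X (restriction f N) U \<Longrightarrow>
      \<exists>!h. h \<in> Hom P N R \<and> (\<forall>x\<in>Field X. \<forall>v\<in>sp N (f x). \<epsilon> x (h (f x) v) = g x v)" for g
    using R unfolding is_right_extension_def by blast+
  define S where "S = {p. (f x, p) \<in> P}"
  have S: "order_convex P S"
    using partial_orderD(2)[OF P] unfolding order_convex_def S_def by (blast intro: FieldI2)
  have fx: "f x \<in> S"
    using order_embeddingD(1)[OF f x] partial_orderD(1)[OF P] by (simp add: S_def)
  let ?K = "interval_nat S :: ('p, nat, 'k) rep"
  have K: "is_module P ?K" by (rule interval_nat_module(1)[OF S])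
  \<comment> \<open>The morphism that sends the generator at \<open>f x\<close> to \<open>w\<close>.\<close>
  obtain h where h: "h \<in> Hom P ?K R"
    "\<And>p v. p \<in> Field P \<Longrightarrow> v \<in> sp ?K p \<Longrightarrow> h p v = fscale (v 0) (tr R (f x) p w)"
  proof (rule HomI[OF K])
    fix p assume p: "p \<in> Field P"
    show "lin_on (sp ?K p) (sp R p) (\<lambda>v. fscale (v 0) (tr R (f x) p w))"
    proof (rule lin_onI)
      fix v assume v: "v \<in> sp ?K p"
      show "fscale (v 0) (tr R (f x) p w) \<in> sp R p"
      proof (cases "p \<in> S")
        case True
        then show ?thesis
          using is_moduleD(6)[OF Rm _ w, of p] fs.subspace_scale[OF is_moduleD(1)[OF Rm p]]
          by (simp add: S_def)
      next
        case False
        then show ?thesis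
          using mem_interval_nat[OF v] fs.subspace_0[OF is_moduleD(1)[OF Rm p]] by simp
      qed
    qed (simp_all add: fun_eq_iff algebra_simps)
  next
    fix p q v assume pq: "(p, q) \<in> P" and v: "v \<in> sp ?K p"
    note lin = is_moduleD(3)[OF Rm pq]
    show "fscale (tr ?K p q v 0) (tr R (f x) q w) = tr R p q (fscale (v 0) (tr R (f x) p w))"
    proof (cases "p \<in> S")
      case True
      then have *: "(f x, p) \<in> P" "q \<in> S"
        using pq partial_orderD(2)[OF P] by (auto simp: S_def)
      then show ?thesis
        using True is_moduleD(6)[OF Rm *(1) w] is_moduleD(5)[OF Rm *(1) pq w]
        by (simp add: tr_interval_nat lin_onD(3)[OF lin])
    next
      case False
      then show ?thesis
        using mem_interval_nat[OF v] lin_on_zero[OF lin is_moduleD(1)[OF Rm]] pq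
        by (simp add: tr_interval_nat FieldI1)
    qed
  qed blast
  obtain z where z: "z \<in> Hom P ?K R" "\<And>p v. p \<in> Field P \<Longrightarrow> v \<in> sp ?K p \<Longrightarrow> z p v = 0"
  proof (rule HomI[OF K])
    show "lin_on (sp ?K p) (sp R p) (\<lambda>v. 0)" if "p \<in> Field P" for p
      using fs.subspace_0[OF is_moduleD(1)[OF Rm that]] by (intro lin_onI) auto
    show "0 = tr R p q 0" if "(p, q) \<in> P" for p q
      using lin_on_zero[OF is_moduleD(3)[OF Rm that] is_moduleD(1)[OF Rm]] that by (simp add: FieldI1)
  qed blast
  obtain g where g: "g \<in> Hom X (restriction f ?K) U"
    "\<And>y v. y \<in> Field X \<Longrightarrow> v \<in> sp (restriction f ?K) y \<Longrightarrow> g y v = 0"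
  proof (rule HomI[OF is_module_restriction[OF f K]])
    show "lin_on (sp (restriction f ?K) y) (sp U y) (\<lambda>v. 0)" if "y \<in> Field X" for y
      using fs.subspace_0[OF is_moduleD(1)[OF U that]] by (intro lin_onI) auto
    show "0 = tr U y y' 0" if "(y, y') \<in> X" for y y'
      using lin_on_zero[OF is_moduleD(3)[OF U that] is_moduleD(1)[OF U]] that by (simp add: FieldI1)
  qed blast
  have lin\<epsilon>: "lin_on (sp R (f y)) (sp U y) (\<epsilon> y)" if "y \<in> Field X" for y
    using HomD(1)[OF \<epsilon> that] by (simp add: restriction_def)
  have \<epsilon>0: "\<epsilon> y 0 = 0" if "y \<in> Field X" for y
    by (rule lin_on_zero[OF lin\<epsilon>[OF that] is_moduleD(1)[OF Rm order_embeddingD(1)[OF f that]]])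
  have "\<epsilon> y (h (f y) v) = g y v" if y: "y \<in> Field X" and v: "v \<in> sp ?K (f y)" for y v
  proof (cases "f y \<in> S")
    case True
    then have fxy: "(f x, f y) \<in> P" and xy: "(x, y) \<in> X"
      using order_embeddingD(2)[OF f x y] by (auto simp: S_def)
    have "\<epsilon> y (tr R (f x) (f y) w) = tr U x y (\<epsilon> x w)"
      using HomD(2)[OF \<epsilon> xy, of w] w by (simp add: restriction_def)
    also have "\<dots> = 0"
      using lin_on_zero[OF is_moduleD(3,1)[OF U]] xy x \<epsilon>w by simp
    finally have "\<epsilon> y (fscale (v 0) (tr R (f x) (f y) w)) = 0"
      using lin_onD(3)[OF lin\<epsilon>[OF y] is_moduleD(6)[OF Rm fxy w]] by simp
    then show ?thesis
      using h(2)[OF order_embeddingD(1)[OF f y] v] g(2)[OF y, of v] v by (simp add: restriction_def)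
  next
    case False
    then have "v = 0" using mem_interval_nat[OF v] by blast
    then show ?thesis
      using h(2)[OF order_embeddingD(1)[OF f y] v] g(2)[OF y, of v] v \<epsilon>0[OF y]
      by (simp add: restriction_def)
  qed
  moreover have "\<epsilon> y (z (f y) v) = g y v" if y: "y \<in> Field X" and v: "v \<in> sp ?K (f y)" for y v
    using z(2)[OF order_embeddingD(1)[OF f y] v] g(2)[OF y, of v] v \<epsilon>0[OF y]
    by (simp add: restriction_def)
  ultimately have "h = z"
    using univ[OF K g(1)] h(1) z(1) by blast
  have "w = h (f x) (emb0 1)"
    using h(2)[OF order_embeddingD(1)[OF f x] emb0_mem[OF fx]]
      is_moduleD(4)[OF Rm order_embeddingD(1)[OF f x] w] by simp
  also have "\<dots> = 0"
    unfolding \<open>h = z\<close> by (rule z(2)[OF order_embeddingD(1)[OF f x] emb0_mem[OF fx]])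
  finally show ?thesis .
qed

lemma is_module_constant: "is_module X (interval_module (Field X) :: ('x, unit, 'k::field) rep)"
  by (rule is_module_interval) (auto simp: order_convex_def intro: FieldI1)

text \<open>The canonical map \<open>\<theta>\<close> factors as \<open>f\<^sub>! U \<rightarrow> J \<rightarrow> f\<^sub>* U\<close> through the interval module \<open>J\<close> of the
  convex hull, whose restriction along \<open>f\<close> is \<open>U\<close>. A point of the hull lies above some point of the
  image, where the unit makes the first map surjective, and below some point of the image, where the
  counit makes the second map injective. Hence the image of \<open>\<theta>\<close> is \<open>J\<close>.\<close>

lemma isomorphic_image_theta:
  fixes X :: "'x rel" and P :: "'p rel" and L R :: "('p, nat, 'k::field) rep"
  defines "U \<equiv> interval_module (Field X) :: ('x, unit, 'k) rep"
  assumes P: "Partial_order P" and f: "f \<in> order_embeddings X P"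
    and L: "is_left_extension X P f U L \<eta>" and R: "is_right_extension X P f U R \<epsilon>"
  defines "\<theta> \<equiv> THE \<theta>. \<theta> \<in> Hom P L R \<and> (\<forall>x\<in>Field X. \<forall>u\<in>sp U x. \<epsilon> x (\<theta> (f x) (\<eta> x u)) = u)"
  shows "isomorphic P (interval_module (convex_hull_in P (f ` Field X)) :: ('p, unit, 'k) rep)
    (image_module \<theta> L R)"
proof -
  define H where "H = convex_hull_in P (f ` Field X)"
  let ?J = "interval_nat H :: ('p, nat, 'k) rep" and ?I = "interval_module H :: ('p, unit, 'k) rep"
  have H: "order_convex P H"
    unfolding H_def by (rule order_convex_convex_hull[OF P])
  have J: "is_module P ?J" by (rule interval_nat_module(1)[OF H])
  have I: "is_module P ?I" by (rule is_module_interval[OF H])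
  have U: "is_module X U" unfolding U_def by (rule is_module_constant)
  have fH: "f x \<in> H" if "x \<in> Field X" for x
    using subset_convex_hull[OF P order_embeddingD(3)[OF f]] that by (auto simp: H_def)
  note fP = order_embeddingD(1)[OF f]
  have Lm: "is_module P L" and \<eta>: "\<eta> \<in> Hom X U (restriction f L)"
    and univL: "\<And>N :: ('p, nat, 'k) rep. is_module P N \<Longrightarrow> g \<in> Hom X U (restriction f N) \<Longrightarrow>
      \<exists>!h. h \<in> Hom P L N \<and> (\<forall>x\<in>Field X. \<forall>u\<in>sp U x. h (f x) (\<eta> x u) = g x u)" for g
    using L unfolding is_left_extension_def by blast+
  have Rm: "is_module P R" and \<epsilon>: "\<epsilon> \<in> Hom X (restriction f R) U"
    and univR: "\<And>N :: ('p, nat, 'k) rep. is_module P N \<Longrightarrow> g \<in> Hom X (restriction f N) U \<Longrightarrow>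
      \<exists>!h. h \<in> Hom P N R \<and> (\<forall>x\<in>Field X. \<forall>v\<in>sp N (f x). \<epsilon> x (h (f x) v) = g x v)" for g
    using R unfolding is_right_extension_def by blast+
  have spU: "sp U x = UNIV" and trU: "y \<in> Field X \<Longrightarrow> tr U x y u = u" if "x \<in> Field X" for x y u
    using that by (simp_all add: U_def interval_module_def)
  have \<eta>mem: "\<eta> x u \<in> sp L (f x)" if "x \<in> Field X" for x u
    using HomD(3)[OF \<eta> that] spU[OF that] by (simp add: restriction_def)

  \<comment> \<open>The maps \<open>g\<close> and \<open>g'\<close> are the mutually inverse identifications of \<open>U\<close> with the restriction of \<open>J\<close>.\<close>
  obtain g where g: "g \<in> Hom X U (restriction f ?J)"
    "\<And>x u. x \<in> Field X \<Longrightarrow> u \<in> sp U x \<Longrightarrow> g x u = emb0 (u ())"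
  proof (rule HomI[OF U])
    show "lin_on (sp U x) (sp (restriction f ?J) x) (\<lambda>u. emb0 (u ()))" if "x \<in> Field X" for x
      using emb0_mem[OF fH[OF that]] by (intro lin_onI) (auto simp: restriction_def)
    show "emb0 (tr U x y u ()) = tr (restriction f ?J) x y (emb0 (u ()))" if "(x, y) \<in> X" for x y u
      using that fH trU by (simp add: restriction_def tr_interval_nat FieldI1 FieldI2)
  qed blast
  obtain h where h: "h \<in> Hom P L ?J"
    and h\<eta>: "\<And>x u. x \<in> Field X \<Longrightarrow> h (f x) (\<eta> x u) = emb0 (u ())"
    using univL[OF J g(1)] g(2) spU by (metis UNIV_I)
  obtain g' where g': "g' \<in> Hom X (restriction f ?J) U"
    "\<And>x v. x \<in> Field X \<Longrightarrow> v \<in> sp (restriction f ?J) x \<Longrightarrow> g' x v = (\<lambda>_. v 0)"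
  proof (rule HomI[OF is_module_restriction[OF f J]])
    show "lin_on (sp (restriction f ?J) x) (sp U x) (\<lambda>v _. v 0)" if "x \<in> Field X" for x
      using spU[OF that] by (intro lin_onI) (auto simp: fun_eq_iff)
    show "(\<lambda>_. tr (restriction f ?J) x y v 0) = tr U x y (\<lambda>_. v 0)" if "(x, y) \<in> X" for x y v
      using that fH trU by (simp add: restriction_def tr_interval_nat FieldI1 FieldI2)
  qed blast
  obtain h' where h': "h' \<in> Hom P ?J R"
    and h'\<epsilon>: "\<And>x c. x \<in> Field X \<Longrightarrow> \<epsilon> x (h' (f x) (emb0 c)) = (\<lambda>_. c)"
  proof -
    obtain h' where *: "h' \<in> Hom P ?J R"
      "\<And>x v. x \<in> Field X \<Longrightarrow> v \<in> sp ?J (f x) \<Longrightarrow> \<epsilon> x (h' (f x) v) = g' x v"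
      using univR[OF J g'(1)] by blast
    have "\<epsilon> x (h' (f x) (emb0 c)) = (\<lambda>_. c)" if x: "x \<in> Field X" for x c
      using *(2)[OF x emb0_mem[OF fH[OF x]]] g'(2)[OF x, of "emb0 c"] emb0_mem[OF fH[OF x], of c]
      by (simp add: restriction_def)
    then show ?thesis using that *(1) by blast
  qed

  obtain \<theta>' where \<theta>': "\<theta>' \<in> Hom P L R"
    and \<theta>'_eq: "\<And>p v. p \<in> Field P \<Longrightarrow> v \<in> sp L p \<Longrightarrow> \<theta>' p v = h' p (h p v)"
  proof (rule HomI[OF Lm])
    show "lin_on (sp L p) (sp R p) (\<lambda>v. h' p (h p v))" if "p \<in> Field P" for p
      by (rule lin_on_comp[OF HomD(1)[OF h that] HomD(1)[OF h' that]])
    show "h' q (h q (tr L p q v)) = tr R p q (h' p (h p v))" if "(p, q) \<in> P" "v \<in> sp L p" for p q v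
      using HomD(2)[OF h that] HomD(2)[OF h' that(1) HomD(3)[OF h _ that(2)]] that(1)
      by (simp add: FieldI1)
  qed blast
  have \<theta>'_id: "\<epsilon> x (\<theta>' (f x) (\<eta> x u)) = u" if "x \<in> Field X" for x u
    using \<theta>'_eq[OF fP[OF that] \<eta>mem[OF that]] h\<eta>[OF that] h'\<epsilon>[OF that] by simp
  have "\<theta> = \<theta>'"
    unfolding \<theta>_def
  proof (rule the_equality)
    show "\<theta>' \<in> Hom P L R \<and> (\<forall>x\<in>Field X. \<forall>u\<in>sp U x. \<epsilon> x (\<theta>' (f x) (\<eta> x u)) = u)"
      using \<theta>' \<theta>'_id by blast
    fix \<theta>1 assume \<theta>1: "\<theta>1 \<in> Hom P L R \<and> (\<forall>x\<in>Field X. \<forall>u\<in>sp U x. \<epsilon> x (\<theta>1 (f x) (\<eta> x u)) = u)"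
    have eq: "\<theta>1 (f x) (\<eta> x u) = \<theta>' (f x) (\<eta> x u)" if x: "x \<in> Field X" for x u
    proof -
      have sub: "fs.subspace (sp R (f x))" by (rule is_moduleD(1)[OF Rm fP[OF x]])
      have mem: "\<theta>1 (f x) (\<eta> x u) \<in> sp R (f x)" "\<theta>' (f x) (\<eta> x u) \<in> sp R (f x)"
        using HomD(3)[OF _ fP[OF x] \<eta>mem[OF x]] \<theta>1 \<theta>' by blast+
      have lin: "lin_on (sp R (f x)) (sp U x) (\<epsilon> x)"
        using HomD(1)[OF \<epsilon> x] by (simp add: restriction_def)
      have "\<epsilon> x (\<theta>1 (f x) (\<eta> x u)) = u"
        using \<theta>1 x spU[OF x] by simp
      then have "\<epsilon> x (\<theta>1 (f x) (\<eta> x u) - \<theta>' (f x) (\<eta> x u)) = 0"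
        by (simp only: lin_on_diff[OF lin sub mem] \<theta>'_id[OF x] diff_self)
      then have "\<theta>1 (f x) (\<eta> x u) - \<theta>' (f x) (\<eta> x u) = 0"
        by (rule right_extension_counit_inj[OF P f U R x fs.subspace_diff[OF sub mem]])
      then show ?thesis by simp
    qed
    obtain k where k: "k \<in> Hom X U (restriction f R)"
      "\<And>x u. x \<in> Field X \<Longrightarrow> u \<in> sp U x \<Longrightarrow> k x u = \<theta>' (f x) (\<eta> x u)"
    proof (rule HomI[OF U])
      show "lin_on (sp U x) (sp (restriction f R) x) (\<lambda>u. \<theta>' (f x) (\<eta> x u))" if x: "x \<in> Field X" for x
        using lin_on_comp[OF HomD(1)[OF \<eta> x], of "sp R (f x)" "\<theta>' (f x)"] HomD(1)[OF \<theta>' fP[OF x]]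
        by (simp add: restriction_def)
      show "\<theta>' (f y) (\<eta> y (tr U x y u)) = tr (restriction f R) x y (\<theta>' (f x) (\<eta> x u))"
        if xy: "(x, y) \<in> X" and u: "u \<in> sp U x" for x y u
      proof -
        have x: "x \<in> Field X" "y \<in> Field X" using xy by (auto simp: FieldI1 FieldI2)
        have "(f x, f y) \<in> P" using order_embeddingD(2)[OF f x] xy by simp
        then have "\<theta>' (f y) (tr L (f x) (f y) (\<eta> x u)) = tr R (f x) (f y) (\<theta>' (f x) (\<eta> x u))"
          by (rule HomD(2)[OF \<theta>' _ \<eta>mem[OF x(1)]])
        then show ?thesis
          using HomD(2)[OF \<eta> xy u] by (simp add: restriction_def)
      qed
    qed blast
    show "\<theta>1 = \<theta>'"
      using univL[OF Rm k(1)] \<theta>1 \<theta>' k(2) eq by metis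
  qed
  have image: "sp (image_module \<theta> L R) p = h' p ` sp ?J p" if p: "p \<in> Field P" for p
  proof -
    have "h p ` sp L p = sp ?J p"
    proof (intro subset_antisym subsetI)
      show "v \<in> sp ?J p" if "v \<in> h p ` sp L p" for v
        using that HomD(3)[OF h p] by blast
      fix v assume v: "v \<in> sp ?J p"
      show "v \<in> h p ` sp L p"
      proof (cases "p \<in> H")
        case True
        then obtain x where x: "x \<in> Field X" "(f x, p) \<in> P"
          by (auto simp: H_def convex_hull_in_def)
        have "h p (tr L (f x) p (\<eta> x (\<lambda>_. v 0))) = emb0 (v 0)"
          using HomD(2)[OF h x(2) \<eta>mem[OF x(1)], of "\<lambda>_. v 0"] h\<eta>[OF x(1)] fH[OF x(1)] True
          by (simp add: tr_interval_nat)
        then show ?thesis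
          using mem_interval_nat[OF v] is_moduleD(6)[OF Lm x(2) \<eta>mem[OF x(1)]] by (metis imageI)
      next
        case False
        then have "v = 0" using mem_interval_nat[OF v] by blast
        then show ?thesis
          using lin_on_zero[OF HomD(1)[OF h p] is_moduleD(1)[OF Lm p]]
            fs.subspace_0[OF is_moduleD(1)[OF Lm p]] by (metis imageI)
      qed
    qed
    moreover have "sp (image_module \<theta> L R) p = h' p ` h p ` sp L p"
      unfolding \<open>\<theta> = \<theta>'\<close> image_module_def image_image
      using \<theta>'_eq[OF p] by (auto intro!: image_cong)
    ultimately show ?thesis by simp
  qed
  have h'_inj: "c = d" if p: "p \<in> H" and eq: "h' p (emb0 c) = h' p (emb0 d)" for p c d
  proof -
    obtain y where y: "y \<in> Field X" "(p, f y) \<in> P"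
      using p by (auto simp: H_def convex_hull_in_def)
    have "h' (f y) (emb0 c) = tr R p (f y) (h' p (emb0 c))" for c
      using HomD(2)[OF h' y(2) emb0_mem[OF p]] p fH[OF y(1)] by (simp add: tr_interval_nat)
    then have "\<epsilon> y (h' (f y) (emb0 c)) = \<epsilon> y (h' (f y) (emb0 d))"
      by (simp add: eq)
    then show ?thesis
      using h'\<epsilon>[OF y(1)] by (simp add: fun_eq_iff)
  qed
  have trJ: "tr ?J p q (emb0 (v ())) = emb0 (tr ?I p q v ())" for p q v
    by (simp add: tr_interval_nat interval_module_def)
  have memJ: "emb0 (v ()) \<in> sp ?J p" if "v \<in> sp ?I p" for p v
    using that by (auto simp: interval_module_def sp_interval_nat split: if_splits)
  have spJ: "sp ?J p = (\<lambda>v. emb0 (v ())) ` sp ?I p" for p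
    unfolding interval_nat_def by (simp add: relabel_def push_unit)
  have "isomorphic P ?I (image_module \<theta> L R)"
  proof (rule isomorphicI[OF I, where \<phi> = "\<lambda>p v. h' p (emb0 (v ()))"])
    fix p assume p: "p \<in> Field P"
    have "lin_on (sp ?I p) (sp ?J p) (\<lambda>v. emb0 (v ()))"
      using memJ by (intro lin_onI) auto
    moreover have "lin_on (sp ?J p) (sp (image_module \<theta> L R) p) (h' p)"
      using HomD(1)[OF h' p] by (auto simp: lin_on_def image[OF p])
    ultimately show "lin_on (sp ?I p) (sp (image_module \<theta> L R) p) (\<lambda>v. h' p (emb0 (v ())))"
      by (rule lin_on_comp)
    have "inj_on (\<lambda>v. h' p (emb0 (v ()))) (sp ?I p)"
    proof (cases "p \<in> H")
      case True
      then show ?thesis using h'_inj by (auto simp: inj_on_def fun_eq_iff)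
    next
      case False
      then show ?thesis by (simp add: interval_module_def)
    qed
    then show "bij_betw (\<lambda>v. h' p (emb0 (v ()))) (sp ?I p) (sp (image_module \<theta> L R) p)"
      by (simp add: bij_betw_def image[OF p] spJ image_image)
  next
    fix p q v assume "(p, q) \<in> P" and v: "v \<in> sp ?I p"
    then show "h' q (emb0 (tr ?I p q v ())) = tr (image_module \<theta> L R) p q (h' p (emb0 (v ())))"
      using HomD(2)[OF h' _ memJ[OF v], of q] by (simp add: image_module_def trJ)
  qed
  then show ?thesis by (simp only: H_def)
qed

section \<open>Left and right extensions of constant modules\<close>

text \<open>The right extension of the constant module is, at \<open>p\<close>, the space of functions on
  \<open>{y. p \<le> f y}\<close> that are constant along comparable elements.\<close>

lemma right_extension_exists:
  fixes X :: "'x rel" and P :: "'p rel"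
  defines "U \<equiv> interval_module (Field X) :: ('x, unit, 'k::field) rep"
  assumes X: "finite_poset X" and P: "Partial_order P" and f: "f \<in> order_embeddings X P"
  shows "\<exists>(R :: ('p, nat, 'k) rep) \<epsilon>. is_right_extension X P f U R \<epsilon>"
proof -
  have fin: "finite (Field X)" using X by (auto simp: finite_poset_def)
  obtain enc :: "'x \<Rightarrow> nat" where enc: "inj_on enc (Field X)"
    using finite_imp_inj_to_nat_seg[OF fin] by blast
  define above where "above p = {y \<in> Field X. (p, f y) \<in> P}" for p
  define R :: "('p, nat, 'k) rep" where "R =
    \<lparr>sp = (\<lambda>p. {w. (\<forall>n. n \<notin> enc ` above p \<longrightarrow> w n = 0) \<and>
             (\<forall>y\<in>above p. \<forall>z\<in>above p. (y, z) \<in> X \<longrightarrow> w (enc y) = w (enc z))}),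
      tr = (\<lambda>p q w n. if n \<in> enc ` above q then w n else 0)\<rparr>"
  have memR: "w \<in> sp R p \<longleftrightarrow> (\<forall>n. n \<notin> enc ` above p \<longrightarrow> w n = 0) \<and>
      (\<forall>y\<in>above p. \<forall>z\<in>above p. (y, z) \<in> X \<longrightarrow> w (enc y) = w (enc z))" for w p
    by (simp add: R_def)
  have trR: "tr R p q w n = (if n \<in> enc ` above q then w n else 0)" for p q w n
    by (simp add: R_def)
  have above_mono: "above q \<subseteq> above p" if "(p, q) \<in> P" for p q
    using partial_orderD(2)[OF P that] by (auto simp: above_def)
  have above_self: "x \<in> above (f x)" if "x \<in> Field X" for x
    using that partial_orderD(1)[OF P order_embeddingD(1)[OF f that]] by (simp add: above_def)
  have aboveX: "above p \<subseteq> Field X" for p by (auto simp: above_def)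
  have Rm: "is_module P R"
  proof (rule is_moduleI)
    fix p
    show sub: "fs.subspace (sp R p)"
      by (rule fs.subspaceI; unfold memR) auto
    show "\<exists>B. finite B \<and> fs.span B = sp R p"
      by (rule finitely_generated_finite_support[OF sub, of "enc ` above p"])
        (use finite_subset[OF aboveX fin] in \<open>auto simp: memR\<close>)
  next
    fix p q assume "(p, q) \<in> P"
    then show "lin_on (sp R p) (sp R q) (tr R p q)"
      using above_mono[of p q] by (intro lin_onI) (auto simp: memR trR fun_eq_iff)
  next
    fix p v assume "v \<in> sp R p"
    then show "tr R p p v = v"
      by (auto simp: fun_eq_iff trR memR)
  next
    fix p q r v assume "(p, q) \<in> P" "(q, r) \<in> P"
    then show "tr R q r (tr R p q v) = tr R p r v"
      using above_mono[of q r] by (auto simp: fun_eq_iff trR)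
  qed
  have U: "is_module X U" unfolding U_def by (rule is_module_constant)
  have spU: "sp U x = UNIV" and trU: "y \<in> Field X \<Longrightarrow> tr U x y u = u" if "x \<in> Field X" for x y u
    using that by (simp_all add: U_def interval_module_def)
  obtain \<epsilon> where \<epsilon>: "\<epsilon> \<in> Hom X (restriction f R) U"
    "\<And>x w. x \<in> Field X \<Longrightarrow> w \<in> sp (restriction f R) x \<Longrightarrow> \<epsilon> x w = (\<lambda>_. w (enc x))"
  proof (rule HomI[OF is_module_restriction[OF f Rm]])
    show "lin_on (sp (restriction f R) x) (sp U x) (\<lambda>w _. w (enc x))" if "x \<in> Field X" for x
      using spU[OF that] by (intro lin_onI) (auto simp: fun_eq_iff)
    show "(\<lambda>_. tr (restriction f R) x y w (enc y)) = tr U x y (\<lambda>_. w (enc x))"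
      if xy: "(x, y) \<in> X" and w: "w \<in> sp (restriction f R) x" for x y w
    proof -
      have x: "x \<in> Field X" and y: "y \<in> Field X" using xy by (auto simp: FieldI1 FieldI2)
      have "y \<in> above (f x)" using order_embeddingD(2)[OF f x y] xy y by (simp add: above_def)
      then have "w (enc x) = w (enc y)"
        using w xy above_self[OF x] by (simp add: restriction_def memR)
      then show ?thesis
        using above_self[OF y] trU[OF x y] by (simp add: restriction_def trR)
    qed
  qed blast
  have "is_right_extension X P f U R \<epsilon>"
    unfolding is_right_extension_def
  proof (intro conjI allI impI ballI Rm \<epsilon>(1))
    fix N :: "('p, nat, 'k) rep" and g
    assume N: "is_module P N" and g: "g \<in> Hom X (restriction f N) U"
    define dec where "dec = inv_into (Field X) enc"
    have dec: "dec (enc y) = y" if "y \<in> Field X" for y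
      using enc that by (simp add: dec_def)
    \<comment> \<open>The coordinate at \<open>y\<close> of the image of \<open>v\<close> is forced: transport \<open>v\<close> to \<open>f y\<close> and apply \<open>g\<close>.\<close>
    define h0 where "h0 p v n = (if n \<in> enc ` above p then g (dec n) (tr N p (f (dec n)) v) () else 0)"
      for p v n
    have h0: "h0 p v (enc y) = g y (tr N p (f y) v) ()" if "y \<in> above p" for p v y
      using that dec[OF subsetD[OF aboveX that]] by (simp add: h0_def)
    have gN: "g y (tr N p (f y) v) = tr U x y (g x (tr N p (f x) v))"
      if "(x, y) \<in> X" "(p, f x) \<in> P" "v \<in> sp N p" for x y p v
    proof -
      have x: "x \<in> Field X" "y \<in> Field X" using that(1) by (auto simp: FieldI1 FieldI2)
      have fxy: "(f x, f y) \<in> P" using order_embeddingD(2)[OF f x] that(1) by simp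
      have "g y (tr N (f x) (f y) (tr N p (f x) v)) = tr U x y (g x (tr N p (f x) v))"
        using HomD(2)[OF g that(1)] is_moduleD(6)[OF N that(2,3)] by (simp add: restriction_def)
      then show ?thesis
        using is_moduleD(5)[OF N that(2) fxy that(3)] by simp
    qed
    have g_lin: "lin_on (sp N (f y)) (sp U y) (g y)" if "y \<in> Field X" for y
      using HomD(1)[OF g that] by (simp add: restriction_def)
    obtain h where h: "h \<in> Hom P N R" "\<And>p v. p \<in> Field P \<Longrightarrow> v \<in> sp N p \<Longrightarrow> h p v = h0 p v"
    proof (rule HomI[OF N])
      show "lin_on (sp N p) (sp R p) (h0 p)" if "p \<in> Field P" for p
      proof (rule lin_onI)
        have lin: "lin_on (sp N p) (sp U y) (\<lambda>v. g y (tr N p (f y) v))" if "y \<in> above p" for y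
          using that lin_on_comp[OF is_moduleD(3)[OF N] g_lin] by (auto simp: above_def)
        show "h0 p v \<in> sp R p" if v: "v \<in> sp N p" for v
          unfolding memR
        proof (intro conjI allI impI ballI)
          show "h0 p v n = 0" if "n \<notin> enc ` above p" for n
            using that by (simp add: h0_def)
          fix y z assume y: "y \<in> above p" and z: "z \<in> above p" and yz: "(y, z) \<in> X"
          show "h0 p v (enc y) = h0 p v (enc z)"
            using gN[OF yz _ v] y z trU aboveX unfolding h0[OF y] h0[OF z] by (auto simp: above_def)
        qed
        show "h0 p (u + v) = h0 p u + h0 p v" if "u \<in> sp N p" "v \<in> sp N p" for u v
        proof
          fix n show "h0 p (u + v) n = (h0 p u + h0 p v) n"
          proof (cases "n \<in> enc ` above p")
            case True
            then obtain y where y: "y \<in> above p" "n = enc y" by blast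
            show ?thesis
              using lin_onD(2)[OF lin[OF y(1)] that] h0[OF y(1)] y(2) by simp
          qed (simp add: h0_def)
        qed
        show "h0 p (fscale c v) = fscale c (h0 p v)" if "v \<in> sp N p" for c v
        proof
          fix n show "h0 p (fscale c v) n = fscale c (h0 p v) n"
          proof (cases "n \<in> enc ` above p")
            case True
            then obtain y where y: "y \<in> above p" "n = enc y" by blast
            show ?thesis
              using lin_onD(3)[OF lin[OF y(1)] that] h0[OF y(1)] y(2) by simp
          qed (simp add: h0_def)
        qed
      qed
      show "h0 q (tr N p q v) = tr R p q (h0 p v)" if pq: "(p, q) \<in> P" and v: "v \<in> sp N p" for p q v
      proof
        fix n show "h0 q (tr N p q v) n = tr R p q (h0 p v) n"
        proof (cases "n \<in> enc ` above q")
          case True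
          then obtain y where y: "y \<in> above q" "n = enc y" by blast
          then have "y \<in> above p" "(q, f y) \<in> P" using above_mono[OF pq] by (auto simp: above_def)
          then show ?thesis
            using y h0 trR is_moduleD(5)[OF N pq _ v] by simp
        qed (simp add: h0_def trR)
      qed
    qed blast
    show "\<exists>!h. h \<in> Hom P N R \<and> (\<forall>x\<in>Field X. \<forall>v\<in>sp N (f x). \<epsilon> x (h (f x) v) = g x v)"
    proof (rule ex1I[of _ h])
      have "\<epsilon> x (h (f x) v) = g x v" if x: "x \<in> Field X" and v: "v \<in> sp N (f x)" for x v
      proof -
        note fx = order_embeddingD(1)[OF f x]
        have "\<epsilon> x (h (f x) v) = (\<lambda>_. h (f x) v (enc x))"
          using \<epsilon>(2)[OF x] HomD(3)[OF h(1) fx v] by (simp add: restriction_def)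
        also have "\<dots> = g x v"
          by (simp add: h(2)[OF fx v] h0[OF above_self[OF x]] is_moduleD(4)[OF N fx v])
        finally show ?thesis .
      qed
      then show "h \<in> Hom P N R \<and> (\<forall>x\<in>Field X. \<forall>v\<in>sp N (f x). \<epsilon> x (h (f x) v) = g x v)"
        using h(1) by blast
      fix k assume k: "k \<in> Hom P N R \<and> (\<forall>x\<in>Field X. \<forall>v\<in>sp N (f x). \<epsilon> x (k (f x) v) = g x v)"
      then have kH: "k \<in> Hom P N R" by blast
      show "k = h"
      proof (rule Hom_eqI[OF kH h(1)])
        fix p v assume p: "p \<in> Field P" and v: "v \<in> sp N p"
        have "k p v n = h0 p v n" for n
        proof (cases "n \<in> enc ` above p")
          case True
          then obtain y where y: "y \<in> above p" "n = enc y" by blast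
          then have yX: "y \<in> Field X" and py: "(p, f y) \<in> P" by (auto simp: above_def)
          note tv = is_moduleD(6)[OF N py v]
          have "k p v n = tr R p (f y) (k p v) (enc y)"
            using above_self[OF yX] y(2) by (simp add: trR)
          also have "\<dots> = k (f y) (tr N p (f y) v) (enc y)"
            using HomD(2)[OF kH py v] by simp
          also have "\<dots> = \<epsilon> y (k (f y) (tr N p (f y) v)) ()"
            using \<epsilon>(2)[OF yX] HomD(3)[OF kH order_embeddingD(1)[OF f yX] tv] by (simp add: restriction_def)
          also have "\<dots> = g y (tr N p (f y) v) ()"
            using k yX tv by simp
          finally show ?thesis using h0[OF y(1)] y(2) by simp
        next
          case False
          then show ?thesis using HomD(3)[OF kH p v] by (simp add: memR h0_def)
        qed
        then show "k p v = h p v" using h(2)[OF p v] by (simp add: fun_eq_iff)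
      qed
    qed
  qed
  then show ?thesis by blast
qed

text \<open>The left extension of the constant module is, at \<open>p\<close>, the space with one basis vector for each
  connected component of \<open>{x. f x \<le> p}\<close>. A component is named by the chosen representative
  \<open>r p x\<close> of its elements \<open>x\<close>.\<close>

lemma left_extension_exists:
  fixes X :: "'x rel" and P :: "'p rel"
  defines "U \<equiv> interval_module (Field X) :: ('x, unit, 'k::field) rep"
  assumes X: "finite_poset X" and P: "Partial_order P" and f: "f \<in> order_embeddings X P"
  shows "\<exists>(L :: ('p, nat, 'k) rep) \<eta>. is_left_extension X P f U L \<eta>"
proof -
  have fin: "finite (Field X)" using X by (auto simp: finite_poset_def)
  obtain enc :: "'x \<Rightarrow> nat" where enc: "inj_on enc (Field X)"
    using finite_imp_inj_to_nat_seg[OF fin] by blast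
  define below where "below p = {x \<in> Field X. (f x, p) \<in> P}" for p
  \<comment> \<open>Lying in the same component, expressed by subsets that are unions of components.\<close>
  define linked where "linked p x y \<longleftrightarrow> (\<forall>C. (\<forall>a\<in>below p. \<forall>b\<in>below p. (a, b) \<in> X \<longrightarrow> (a \<in> C \<longleftrightarrow> b \<in> C))
      \<longrightarrow> (x \<in> C \<longleftrightarrow> y \<in> C))" for p x y
  define r where "r p x = (SOME y. y \<in> below p \<and> linked p x y)" for p x
  have belowX: "below p \<subseteq> Field X" for p by (auto simp: below_def)
  have below_mono: "below p \<subseteq> below q" if "(p, q) \<in> P" for p q
    using partial_orderD(2)[OF P _ that] by (auto simp: below_def)
  have below_self: "x \<in> below (f x)" if "x \<in> Field X" for x
    using that partial_orderD(1)[OF P order_embeddingD(1)[OF f that]] by (simp add: below_def)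
  have "r p x \<in> below p \<and> linked p x (r p x)" if "x \<in> below p" for p x
    unfolding r_def by (rule someI[of _ x]) (use that in \<open>simp add: linked_def\<close>)
  then have r_below: "r p x \<in> below p" and r_linked: "linked p x (r p x)" if "x \<in> below p" for p x
    using that by blast+
  have r_const: "c (r p x) = c x"
    if "x \<in> below p" and c: "\<And>a b. a \<in> below p \<Longrightarrow> b \<in> below p \<Longrightarrow> (a, b) \<in> X \<Longrightarrow> c a = c b"
    for p x and c :: "'x \<Rightarrow> 'x"
  proof -
    have "x \<in> {z. c z = c x} \<longleftrightarrow> r p x \<in> {z. c z = c x}"
      using r_linked[OF that(1)] c unfolding linked_def by (elim allE[of _ "{z. c z = c x}"]) auto
    then show ?thesis by simp
  qed
  have r_edge: "r p a = r p b" if "a \<in> below p" "b \<in> below p" "(a, b) \<in> X" for p a b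
  proof -
    have "linked p a = linked p b"
      unfolding linked_def fun_eq_iff using that by blast
    then show ?thesis by (simp add: r_def)
  qed
  have r_r: "r q (r p x) = r q x" if "x \<in> below p" "(p, q) \<in> P" for p q x
    using r_const[OF that(1), of "r q"] r_edge below_mono[OF that(2)] by blast
  define reps where "reps p = r p ` below p" for p
  have reps_fin: "finite (reps p)" for p
    using finite_subset[OF belowX fin] by (simp add: reps_def)
  have reps_below: "reps p \<subseteq> below p" for p
    using r_below by (auto simp: reps_def)
  have Preflx: "(p, p) \<in> P" if "p \<in> Field P" for p
    by (rule partial_orderD(1)[OF P that])
  have r_reps: "r p i = i" if "i \<in> reps p" "p \<in> Field P" for p i
    using that r_r[OF _ Preflx] by (auto simp: reps_def)
  have r_in: "r q i \<in> reps q" if "i \<in> below q" for q i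
    using that by (simp add: reps_def)
  have enc_eq: "enc i = enc j \<longleftrightarrow> i = j" if "i \<in> below p" "j \<in> below q" for i j p q
    using that belowX enc by (metis inj_on_eq_iff subsetD)

  define L :: "('p, nat, 'k) rep" where "L =
    \<lparr>sp = (\<lambda>p. {w. \<forall>n. n \<notin> enc ` reps p \<longrightarrow> w n = 0}),
      tr = (\<lambda>p q w n. \<Sum>i\<in>reps p. if enc (r q i) = n then w (enc i) else 0)\<rparr>"
  have memL: "w \<in> sp L p \<longleftrightarrow> (\<forall>n. n \<notin> enc ` reps p \<longrightarrow> w n = 0)" for w p
    by (simp add: L_def)
  have trL: "tr L p q w n = (\<Sum>i\<in>reps p. if enc (r q i) = n then w (enc i) else 0)" for p q w n
    by (simp add: L_def)
  have eqL: "w = w'" if "w \<in> sp L p" "w' \<in> sp L p" "\<And>i. i \<in> reps p \<Longrightarrow> w (enc i) = w' (enc i)" for w w' p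
  proof
    fix n show "w n = w' n" using that by (cases "n \<in> enc ` reps p") (auto simp: memL)
  qed
  have trL_mem: "tr L p q w \<in> sp L q" if pq: "(p, q) \<in> P" for p q w
    unfolding memL trL
  proof (intro allI impI sum.neutral ballI)
    fix n i assume n: "n \<notin> enc ` reps q" and "i \<in> reps p"
    then have "r q i \<in> reps q" using r_in below_mono[OF pq] reps_below by blast
    then show "(if enc (r q i) = n then w (enc i) else 0) = 0" using n by auto
  qed
  have trL_enc: "tr L p q w (enc j) = (\<Sum>i\<in>reps p. if r q i = j then w (enc i) else 0)"
    if pq: "(p, q) \<in> P" and j: "j \<in> reps q" for p q w j
    unfolding trL
  proof (rule sum.cong[OF refl])
    fix i assume "i \<in> reps p"
    then have "r q i \<in> below q" "j \<in> below q"
      using r_below below_mono[OF pq] reps_below j by blast+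
    then show "(if enc (r q i) = enc j then w (enc i) else 0) = (if r q i = j then w (enc i) else 0)"
      by (simp add: enc_eq)
  qed
  \<comment> \<open>Summation over the fibres of the map between the sets of components.\<close>
  have trL_sum: "(\<Sum>j\<in>reps q. tr L p q w (enc j) * c j) = (\<Sum>i\<in>reps p. w (enc i) * c (r q i))"
    if pq: "(p, q) \<in> P" for p q w c
  proof -
    have "(\<Sum>j\<in>reps q. tr L p q w (enc j) * c j) =
        (\<Sum>j\<in>reps q. \<Sum>i\<in>reps p. if r q i = j then w (enc i) * c j else 0)"
      by (intro sum.cong refl) (auto simp: trL_enc[OF pq] sum_distrib_right intro!: sum.cong)
    also have "\<dots> = (\<Sum>i\<in>reps p. \<Sum>j\<in>reps q. if r q i = j then w (enc i) * c j else 0)"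
      by (rule sum.swap)
    also have "\<dots> = (\<Sum>i\<in>reps p. w (enc i) * c (r q i))"
    proof (rule sum.cong[OF refl])
      fix i assume "i \<in> reps p"
      then have "r q i \<in> reps q" using r_in below_mono[OF pq] reps_below by blast
      then show "(\<Sum>j\<in>reps q. if r q i = j then w (enc i) * c j else 0) = w (enc i) * c (r q i)"
        using reps_fin by simp
    qed
    finally show ?thesis .
  qed
  have Lm: "is_module P L"
  proof (rule is_moduleI)
    fix p
    show sub: "fs.subspace (sp L p)"
      by (rule fs.subspaceI; unfold memL) auto
    show "\<exists>B. finite B \<and> fs.span B = sp L p"
      by (rule finitely_generated_finite_support[OF sub, of "enc ` reps p"]) (use reps_fin in \<open>auto simp: memL\<close>)
  next
    fix p q assume pq: "(p, q) \<in> P"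
    show "lin_on (sp L p) (sp L q) (tr L p q)"
      by (rule lin_onI)
        (auto simp: trL_mem[OF pq] fun_eq_iff trL sum.distrib[symmetric] sum_distrib_left intro!: sum.cong)
  next
    fix p v assume p: "p \<in> Field P" and v: "v \<in> sp L p"
    show "tr L p p v = v"
    proof (rule eqL[OF trL_mem[OF Preflx[OF p]] v])
      fix i assume i: "i \<in> reps p"
      have "tr L p p v (enc i) = (\<Sum>j\<in>reps p. if j = i then v (enc j) else 0)"
        unfolding trL_enc[OF Preflx[OF p] i] using r_reps p by (intro sum.cong) auto
      then show "tr L p p v (enc i) = v (enc i)" using i reps_fin by simp
    qed
  next
    fix p q s v assume pq: "(p, q) \<in> P" and qs: "(q, s) \<in> P"
    note ps = partial_orderD(2)[OF P pq qs]
    show "tr L q s (tr L p q v) = tr L p s v"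
    proof (rule eqL[OF trL_mem[OF qs] trL_mem[OF ps]])
      fix k assume k: "k \<in> reps s"
      have "tr L q s (tr L p q v) (enc k) = (\<Sum>j\<in>reps q. tr L p q v (enc j) * (if r s j = k then 1 else 0))"
        unfolding trL_enc[OF qs k] by (intro sum.cong) auto
      also have "\<dots> = (\<Sum>i\<in>reps p. v (enc i) * (if r s (r q i) = k then 1 else 0))"
        by (rule trL_sum[OF pq])
      also have "\<dots> = tr L p s v (enc k)"
        unfolding trL_enc[OF ps k]
      proof (rule sum.cong[OF refl])
        fix i assume "i \<in> reps p"
        then have "r s (r q i) = r s i"
          using r_r[OF _ qs] below_mono[OF pq] reps_below by blast
        then show "v (enc i) * (if r s (r q i) = k then 1 else 0) = (if r s i = k then v (enc i) else 0)"
          by simp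
      qed
      finally show "tr L q s (tr L p q v) (enc k) = tr L p s v (enc k)" .
    qed
  qed

  have U: "is_module X U" unfolding U_def by (rule is_module_constant)
  have spU: "sp U x = UNIV" and trU: "y \<in> Field X \<Longrightarrow> tr U x y u = u" if "x \<in> Field X" for x y u
    using that by (simp_all add: U_def interval_module_def)
  define \<delta> :: "'k \<Rightarrow> 'x \<Rightarrow> nat \<Rightarrow> 'k" where "\<delta> c i n = (if n = enc i then c else 0)" for c i n
  have \<delta>_mem: "\<delta> c i \<in> sp L p" if "i \<in> reps p" for c i p
    using that by (auto simp: memL \<delta>_def)
  have tr_\<delta>: "tr L p q (\<delta> c i) = \<delta> c (r q i)" if pq: "(p, q) \<in> P" and i: "i \<in> reps p" for p q c i
  proof (rule eqL[OF trL_mem[OF pq] \<delta>_mem])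
    show ri: "r q i \<in> reps q" using i r_in below_mono[OF pq] reps_below by blast
    fix j assume j: "j \<in> reps q"
    have "tr L p q (\<delta> c i) (enc j) = (\<Sum>k\<in>reps p. if k = i then (if r q k = j then c else 0) else 0)"
      unfolding trL_enc[OF pq j]
    proof (rule sum.cong[OF refl])
      fix k assume "k \<in> reps p"
      then have "enc k = enc i \<longleftrightarrow> k = i" using i reps_below enc_eq by blast
      then show "(if r q k = j then \<delta> c i (enc k) else 0) = (if k = i then if r q k = j then c else 0 else 0)"
        by (simp add: \<delta>_def)
    qed
    also have "\<dots> = (if r q i = j then c else 0)" using i reps_fin by simp
    also have "\<dots> = \<delta> c (r q i) (enc j)"
      using enc_eq[of j q "r q i" q] j ri reps_below by (auto simp: \<delta>_def)
    finally show "tr L p q (\<delta> c i) (enc j) = \<delta> c (r q i) (enc j)" .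
  qed
  obtain \<eta> where \<eta>: "\<eta> \<in> Hom X U (restriction f L)"
    "\<And>x u. x \<in> Field X \<Longrightarrow> u \<in> sp U x \<Longrightarrow> \<eta> x u = \<delta> (u ()) (r (f x) x)"
  proof (rule HomI[OF U])
    show "lin_on (sp U x) (sp (restriction f L) x) (\<lambda>u. \<delta> (u ()) (r (f x) x))" if "x \<in> Field X" for x
      using \<delta>_mem[OF r_in[OF below_self[OF that]]]
      by (intro lin_onI) (auto simp: restriction_def \<delta>_def fun_eq_iff)
    show "\<delta> (tr U x y u ()) (r (f y) y) = tr (restriction f L) x y (\<delta> (u ()) (r (f x) x))"
      if xy: "(x, y) \<in> X" for x y u
    proof -
      have x: "x \<in> Field X" and y: "y \<in> Field X" using xy by (auto simp: FieldI1 FieldI2)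
      have fxy: "(f x, f y) \<in> P" using order_embeddingD(2)[OF f x y] xy by simp
      have "x \<in> below (f y)" using x fxy by (simp add: below_def)
      then have "r (f y) (r (f x) x) = r (f y) y"
        using r_r[OF below_self[OF x] fxy] r_edge[OF _ below_self[OF y] xy] by simp
      then show ?thesis
        using tr_\<delta>[OF fxy r_in[OF below_self[OF x]]] trU[OF x y] by (simp add: restriction_def)
    qed
  qed blast
  have "is_left_extension X P f U L \<eta>"
    unfolding is_left_extension_def
  proof (intro conjI allI impI ballI Lm \<eta>(1))
    fix N :: "('p, nat, 'k) rep" and g
    assume N: "is_module P N" and g: "g \<in> Hom X U (restriction f N)"
    define G where "G x = g x (\<lambda>_. 1)" for x
    have G: "G x \<in> sp N (f x)" if "x \<in> Field X" for x
      using HomD(3)[OF g that] spU[OF that] by (simp add: G_def restriction_def)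
    have gG: "g x u = fscale (u ()) (G x)" if x: "x \<in> Field X" for x u
    proof -
      have "u = fscale (u ()) (\<lambda>_. 1)" by (auto simp: fun_eq_iff)
      then have "g x u = g x (fscale (u ()) (\<lambda>_. 1))" by (rule arg_cong)
      also have "\<dots> = fscale (u ()) (g x (\<lambda>_. 1))"
        using lin_onD(3)[OF HomD(1)[OF g x]] spU[OF x] by simp
      finally show ?thesis by (simp add: G_def)
    qed
    \<comment> \<open>The vector \<open>t p x\<close> is the only possible image of the basis vector of the component of \<open>x\<close> at \<open>p\<close>.\<close>
    define t where "t p x = tr N (f x) p (G x)" for p x
    have t_mem: "t p x \<in> sp N p" if "x \<in> below p" for p x
      using that is_moduleD(6)[OF N _ G] by (auto simp: t_def below_def)
    have t_edge: "t p x = t p y" if x: "x \<in> below p" and y: "y \<in> below p" and xy: "(x, y) \<in> X" for p x y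
    proof -
      have xX: "x \<in> Field X" "y \<in> Field X" and yp: "(f y, p) \<in> P" using x y by (auto simp: below_def)
      have fxy: "(f x, f y) \<in> P" using order_embeddingD(2)[OF f xX] xy by simp
      have "G y = tr N (f x) (f y) (G x)"
        using HomD(2)[OF g xy, of "\<lambda>_. 1"] spU xX trU by (simp add: G_def restriction_def)
      then show ?thesis
        using is_moduleD(5)[OF N fxy yp G[OF xX(1)]] by (simp add: t_def)
    qed
    have t_r: "t p (r p x) = t p x" if "x \<in> below p" for p x
    proof -
      have "x \<in> {z. t p z = t p x} \<longleftrightarrow> r p x \<in> {z. t p z = t p x}"
        using r_linked[OF that] t_edge[of _ p] unfolding linked_def
        by (elim allE[of _ "{z. t p z = t p x}"]) auto
      then show ?thesis by simp
    qed
    have t_tr: "tr N p q (t p x) = t q x" if "x \<in> below p" "(p, q) \<in> P" for p q x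
      using that is_moduleD(5)[OF N _ that(2) G] by (auto simp: t_def below_def)
    define h0 where "h0 p w = (\<Sum>i\<in>reps p. fscale (w (enc i)) (t p i))" for p w
    have h0_\<delta>: "h0 p (\<delta> c i) = fscale c (t p i)" if i: "i \<in> reps p" for p c i
    proof -
      have "h0 p (\<delta> c i) = (\<Sum>k\<in>reps p. if k = i then fscale c (t p i) else 0)"
        unfolding h0_def
      proof (rule sum.cong[OF refl])
        fix k assume "k \<in> reps p"
        then have "enc k = enc i \<longleftrightarrow> k = i" using i reps_below enc_eq by blast
        then show "fscale (\<delta> c i (enc k)) (t p k) = (if k = i then fscale c (t p i) else 0)"
          by (simp add: \<delta>_def)
      qed
      then show ?thesis using i reps_fin by simp
    qed
    have h0_mem: "h0 p w \<in> sp N p" if p: "p \<in> Field P" for p w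
      unfolding h0_def using t_mem reps_below
      by (intro fs.subspace_sum fs.subspace_scale is_moduleD(1)[OF N p]) blast
    have h0_lin: "lin_on V (sp N p) (h0 p)" if p: "p \<in> Field P" for p V
      by (rule lin_onI) (simp_all add: h0_mem[OF p], simp_all add: h0_def fs.scale_left_distrib
          sum.distrib fs.scale_sum_right)
    obtain h where h: "h \<in> Hom P L N" "\<And>p w. p \<in> Field P \<Longrightarrow> w \<in> sp L p \<Longrightarrow> h p w = h0 p w"
    proof (rule HomI[OF Lm])
      show "lin_on (sp L p) (sp N p) (h0 p)" if "p \<in> Field P" for p
        by (rule h0_lin[OF that])
      show "h0 q (tr L p q w) = tr N p q (h0 p w)" if pq: "(p, q) \<in> P" for p q w
      proof -
        have p: "p \<in> Field P" using pq by (rule FieldI1)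
        note lin = is_moduleD(3)[OF N pq] and sub = is_moduleD(1)[OF N p]
        have i_below: "i \<in> below p" "i \<in> below q" if "i \<in> reps p" for i
          using that reps_below below_mono[OF pq] by blast+
        have "h0 q (tr L p q w) n = (\<Sum>i\<in>reps p. fscale (w (enc i)) (t q i)) n" for n
        proof -
          have "h0 q (tr L p q w) n = (\<Sum>j\<in>reps q. tr L p q w (enc j) * t q j n)"
            by (simp add: h0_def sum_fun_apply)
          also have "\<dots> = (\<Sum>i\<in>reps p. w (enc i) * t q (r q i) n)"
            by (rule trL_sum[OF pq])
          also have "\<dots> = (\<Sum>i\<in>reps p. fscale (w (enc i)) (t q i)) n"
            using t_r i_below by (simp add: sum_fun_apply)
          finally show ?thesis .
        qed
        then have "h0 q (tr L p q w) = (\<Sum>i\<in>reps p. fscale (w (enc i)) (t q i))" by (rule ext)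
        also have "\<dots> = (\<Sum>i\<in>reps p. tr N p q (fscale (w (enc i)) (t p i)))"
          using t_mem i_below t_tr pq by (intro sum.cong refl) (simp add: lin_onD(3)[OF lin])
        also have "\<dots> = tr N p q (h0 p w)"
          unfolding h0_def
          by (rule lin_on_sum[OF lin sub, symmetric]) (intro fs.subspace_scale[OF sub] t_mem i_below)
        finally show ?thesis .
      qed
    qed blast
    show "\<exists>!h. h \<in> Hom P L N \<and> (\<forall>x\<in>Field X. \<forall>u\<in>sp U x. h (f x) (\<eta> x u) = g x u)"
    proof (rule ex1I[of _ h])
      have "h (f x) (\<eta> x u) = g x u" if x: "x \<in> Field X" for x u
      proof -
        note b = below_self[OF x] and fx = order_embeddingD(1)[OF f x]
        have "h (f x) (\<eta> x u) = h0 (f x) (\<delta> (u ()) (r (f x) x))"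
          using \<eta>(2)[OF x, of u] spU[OF x] h(2)[OF fx \<delta>_mem[OF r_in[OF b]]] by simp
        also have "\<dots> = fscale (u ()) (t (f x) x)"
          using h0_\<delta>[OF r_in[OF b]] t_r[OF b] by simp
        also have "t (f x) x = G x"
          unfolding t_def by (rule is_moduleD(4)[OF N fx G[OF x]])
        finally show ?thesis by (simp only: gG[OF x])
      qed
      then show "h \<in> Hom P L N \<and> (\<forall>x\<in>Field X. \<forall>u\<in>sp U x. h (f x) (\<eta> x u) = g x u)"
        using h(1) by blast
      fix k assume k: "k \<in> Hom P L N \<and> (\<forall>x\<in>Field X. \<forall>u\<in>sp U x. k (f x) (\<eta> x u) = g x u)"
      then have kH: "k \<in> Hom P L N" by blast
      show "k = h"
      proof (rule Hom_eqI[OF kH h(1)])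
        fix p w assume p: "p \<in> Field P" and w: "w \<in> sp L p"
        note sub = is_moduleD(1)[OF Lm p]
        have k_\<delta>: "k p (\<delta> 1 i) = t p i" if i: "i \<in> reps p" for i
        proof -
          have x: "i \<in> Field X" and ip: "(f i, p) \<in> P" using i reps_below by (auto simp: below_def)
          have "\<delta> 1 i = tr L (f i) p (\<eta> i (\<lambda>_. 1))"
            using tr_\<delta>[OF ip r_in[OF below_self[OF x]]] \<eta>(2)[OF x, of "\<lambda>_. 1"] spU[OF x]
              r_r[OF below_self[OF x] ip] r_reps[OF i p] by simp
          then have "k p (\<delta> 1 i) = tr N (f i) p (k (f i) (\<eta> i (\<lambda>_. 1)))"
            using HomD(2)[OF kH ip, of "\<eta> i (\<lambda>_. 1)"] HomD(3)[OF \<eta>(1) x, of "\<lambda>_. 1"] spU[OF x]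
            by (simp add: restriction_def)
          then show ?thesis
            using k x spU[OF x] by (simp add: t_def G_def)
        qed
        have "w = (\<Sum>i\<in>reps p. fscale (w (enc i)) (\<delta> 1 i))"
        proof (rule eqL[OF w])
          show "(\<Sum>i\<in>reps p. fscale (w (enc i)) (\<delta> 1 i)) \<in> sp L p"
            by (intro fs.subspace_sum[OF sub] fs.subspace_scale[OF sub] \<delta>_mem)
          fix i assume i: "i \<in> reps p"
          have "(\<Sum>j\<in>reps p. fscale (w (enc j)) (\<delta> 1 j)) (enc i) = (\<Sum>j\<in>reps p. if j = i then w (enc i) else 0)"
            unfolding sum_fun_apply
          proof (rule sum.cong[OF refl])
            fix j assume "j \<in> reps p"
            then have "enc i = enc j \<longleftrightarrow> j = i" using i reps_below enc_eq by blast
            then show "fscale (w (enc j)) (\<delta> 1 j) (enc i) = (if j = i then w (enc i) else 0)"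
              by (simp add: \<delta>_def)
          qed
          then show "w (enc i) = (\<Sum>i\<in>reps p. fscale (w (enc i)) (\<delta> 1 i)) (enc i)"
            using i reps_fin by simp
        qed
        then have "k p w = k p (\<Sum>i\<in>reps p. fscale (w (enc i)) (\<delta> 1 i))" by (rule arg_cong)
        also have "\<dots> = (\<Sum>i\<in>reps p. k p (fscale (w (enc i)) (\<delta> 1 i)))"
          by (rule lin_on_sum[OF HomD(1)[OF kH p] sub]) (intro fs.subspace_scale[OF sub] \<delta>_mem)
        also have "\<dots> = h0 p w"
          unfolding h0_def
          by (intro sum.cong refl) (simp add: lin_onD(3)[OF HomD(1)[OF kH p] \<delta>_mem] k_\<delta>)
        finally show "k p w = h p w" using h(2)[OF p w] by simp
      qed
    qed
  qed
  then show ?thesis by blast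
qed

lemma isomorphic_intermediate_extension:
  fixes X :: "'x rel" and P :: "'p rel"
  assumes X: "finite_poset X" and P: "Partial_order P" and f: "f \<in> order_embeddings X P"
  shows "isomorphic P (interval_module (convex_hull_in P (f ` Field X)) :: ('p, unit, 'k::field) rep)
    (intermediate_extension X P f (interval_module (Field X) :: ('x, unit, 'k) rep))"
proof -
  let ?U = "interval_module (Field X) :: ('x, unit, 'k) rep"
  obtain L \<eta> where L: "left_extension X P f ?U = (L, \<eta>)" by (cases "left_extension X P f ?U")
  obtain R \<epsilon> where R: "right_extension X P f ?U = (R, \<epsilon>)" by (cases "right_extension X P f ?U")
  have "case left_extension X P f ?U of (L, \<eta>) \<Rightarrow> is_left_extension X P f ?U L \<eta>"
    unfolding left_extension_def
    by (rule someI_ex) (use left_extension_exists[OF X P f, where 'k = 'k] in auto)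
  then have "is_left_extension X P f ?U L \<eta>" by (simp add: L)
  moreover have "case right_extension X P f ?U of (R, \<epsilon>) \<Rightarrow> is_right_extension X P f ?U R \<epsilon>"
    unfolding right_extension_def
    by (rule someI_ex) (use right_extension_exists[OF X P f, where 'k = 'k] in auto)
  then have "is_right_extension X P f ?U R \<epsilon>" by (simp add: R)
  ultimately show ?thesis
    using isomorphic_image_theta[OF P f]
    by (simp add: intermediate_extension_def theta_map_def L R)
qed

section \<open>The basis of interval modules\<close>

theorem theorem5p11:
  fixes P :: "'p rel" and \<F> :: "('x, 'p) emb_family"
  assumes "finite_poset P"
    and "is_emb_family P \<F>"
    and "\<forall>(X, E)\<in>\<F>. connected_poset X"
    and "\<forall>(X, E)\<in>\<F>. no_three_chain X"
  shows "is_basis P (emb_union \<F>)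
           (mult_invariant \<F> :: ('p, 'k::field) K0_elem \<Rightarrow> ('x, 'p) emb_index \<Rightarrow> int)
           (R_set P \<F>) \<and>
         (\<forall>e\<in>emb_union \<F>.
           isomorphic P
             (interval_module (convex_hull_in P (index_emb e ` Field (index_poset e)))
                :: ('p, unit, 'k) rep)
             (intermediate_extension (index_poset e) P (index_emb e)
                (interval_module (Field (index_poset e)) :: ('x, unit, 'k) rep)))"
proof (intro conjI ballI)
  note e_props = emb_unionD[OF assms(1,2)]
  have P: "Partial_order P" using assms(1) by (simp add: finite_poset_def)
  define T where "T e = index_emb e ` Field (index_poset e)" for e :: "('x, 'p) emb_index"
  define h where "h e = convex_hull_in P (T e)" for e
  define v :: "('x, 'p) emb_index \<Rightarrow> ('p, nat, 'k) rep \<Rightarrow> int" where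
    "v e M = int (multiplicity_in (index_poset e)
      (interval_module (Field (index_poset e)) :: ('x, unit, 'k) rep) (restriction (index_emb e) M))" for e M
  have X: "Partial_order (index_poset e)" "connected_poset (index_poset e)" "no_three_chain (index_poset e)"
    if "e \<in> emb_union \<F>" for e
    using e_props(2)[OF that] e_props(4)[OF that] assms(3,4)
    by (auto simp: finite_poset_def index_poset_def)
  have TP: "T e \<subseteq> Field P" if "e \<in> emb_union \<F>" for e
    unfolding T_def by (rule order_embeddingD(3)[OF e_props(3)[OF that]])
  have Tconn: "connected_in P (T e)" if "e \<in> emb_union \<F>" for e
    unfolding T_def by (rule connected_in_image[OF e_props(3)[OF that] connected_in_Field[OF X(2)[OF that]]])
  have v_rank: "v e M = int (generalized_rank P (T e) M)" if e: "e \<in> emb_union \<F>" and M: "is_module P M" for e M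
    unfolding v_def T_def
    using multiplicity_interval_eq_generalized_rank[OF is_module_restriction[OF e_props(3)[OF e] M]]
      generalized_rank_restriction[OF X(1)[OF e] P e_props(3)[OF e]] by metis
  have hull: "order_convex P (h e)" for e
    unfolding h_def by (rule order_convex_convex_hull[OF P])

  have "is_basis P (emb_union \<F>) (K0_induced (emb_union \<F>) v)
      ((\<lambda>e. isoclass P (interval_nat (h e))) ` emb_union \<F>)"
  proof (rule is_basis_unitriangular[OF e_props(1)])
    fix e assume e: "e \<in> emb_union \<F>"
    show "additive_on_modules P (v e)"
      unfolding additive_on_modules_def
    proof (intro conjI allI impI)
      fix M N :: "('p, nat, 'k) rep"
      assume "is_module P M" "is_module P N" "isomorphic P M N"
      then show "v e M = v e N"
        using generalized_rank_iso[OF _ _ TP[OF e]] by (simp add: v_rank[OF e])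
    next
      fix L M N :: "('p, nat, 'k) rep"
      assume L: "is_module P L" and MN: "is_module P M" "is_module P N"
        and iso: "isomorphic P L (direct_sum M N)"
      show "v e L = v e M + v e N"
        using generalized_rank_iso[OF L is_module_direct_sum[OF MN] TP[OF e] iso]
          generalized_rank_direct_sum[OF MN TP[OF e] Tconn[OF e]]
        by (simp add: v_rank[OF e] L MN)
    qed
    show U: "is_module P (interval_nat (h e) :: ('p, nat, 'k) rep)"
      by (rule interval_nat_module(1)[OF hull])
    have "connected_in P (h e)"
      unfolding h_def by (rule connected_in_convex_hull[OF P TP[OF e] Tconn[OF e]])
    then show "indecomposable P (interval_nat (h e) :: ('p, nat, 'k) rep)"
      by (rule indecomposable_interval[OF _ hull U interval_nat_module(2)[OF hull]])
  next
    fix e e' assume e: "e \<in> emb_union \<F>" and e': "e' \<in> emb_union \<F>"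
    have ne: "T e \<noteq> {}" using Tconn[OF e] by (simp add: connected_in_def)
    have "v e (interval_nat (h e')) = int (generalized_rank P (T e) (interval_module (h e') :: ('p, unit, 'k) rep))"
      using generalized_rank_iso[OF is_module_interval[OF hull] interval_nat_module(1)[OF hull]
          TP[OF e] interval_nat_module(2)[OF hull, where 'k = 'k]]
      by (simp add: v_rank[OF e interval_nat_module(1)[OF hull]])
    also have "\<dots> = (if T e \<subseteq> h e' then 1 else 0)"
      by (simp add: generalized_rank_interval[OF P TP[OF e] ne hull])
    also have "T e \<subseteq> h e' \<longleftrightarrow> h e \<subseteq> h e'"
      using convex_hull_subset_iff[OF P TP[OF e] hull[of e']] by (simp add: h_def)
    finally show "v e (interval_nat (h e')) = (if h e \<subseteq> h e' then 1 else 0)" .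
  next
    fix e e' and M :: "('p, nat, 'k) rep"
    assume e: "e \<in> emb_union \<F>" and e': "e' \<in> emb_union \<F>" and eq: "h e = h e'" and M: "is_module P M"
    have "T e \<subseteq> T e'"
      using image_determined_by_convex_hull[OF P X(3)[OF e] e_props(3)[OF e] TP[OF e']] eq
      by (simp add: T_def h_def)
    moreover have "T e' \<subseteq> T e"
      using image_determined_by_convex_hull[OF P X(3)[OF e'] e_props(3)[OF e'] TP[OF e]] eq
      by (simp add: T_def h_def)
    ultimately show "v e M = v e' M"
      by (simp add: v_rank[OF e M] v_rank[OF e' M])
  qed
  moreover have "(\<lambda>e. isoclass P (interval_nat (h e) :: ('p, nat, 'k) rep)) ` emb_union \<F> = R_set P \<F>"
    unfolding R_set_def
    using isoclass_eq[OF is_module_interval[OF hull] interval_nat_module[OF hull, where 'k = 'k]]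
    by (intro image_cong refl) (simp add: h_def T_def)
  moreover have "K0_induced (emb_union \<F>) v = mult_invariant \<F>"
    by (simp add: mult_invariant_def v_def[abs_def])
  ultimately show "is_basis P (emb_union \<F>)
      (mult_invariant \<F> :: ('p, 'k) K0_elem \<Rightarrow> ('x, 'p) emb_index \<Rightarrow> int) (R_set P \<F>)"
    by simp
next
  fix e assume e: "e \<in> emb_union \<F>"
  have "Partial_order P" using assms(1) by (simp add: finite_poset_def)
  then show "isomorphic P
      (interval_module (convex_hull_in P (index_emb e ` Field (index_poset e))) :: ('p, unit, 'k) rep)
      (intermediate_extension (index_poset e) P (index_emb e)
        (interval_module (Field (index_poset e)) :: ('x, unit, 'k) rep))"
    using emb_unionD(2,3)[OF assms(1,2) e] by (intro isomorphic_intermediate_extension)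
qed

end
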